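(* Let $M$ be a real 3-manifold with a flag structure $(T^1,T^2)$ and a fixed contact form $\theta$ (a global section of $E$), with pseudo-flag coframe bundle $X$ and adapted coframe bundle $Y$ carrying the adapted connection $\pi$. Let $s:M\to Y$ be a section factoring through an embedding of $X$ into $Y$ such that $s^*\phi=0$; i.e. for a section $(\theta,\theta^1,\theta^2)$ of $X$ one has $s^*\omega=\theta$, $s^*\omega^1=\theta^1$, $s^*\omega^2=\theta^2$, $s^*\phi=0$. Then $$s^*TC_2(\pi)=\frac1{8\pi^2}\left(\Big(\tfrac12G+\tfrac1{16}R^2-\tau^1_2\tau^2_1\Big)\,\theta\wedge\theta^1\wedge\theta^2+\theta^1_1\wedge\Big(E^2\,\theta\wedge\theta^1+E^1\,\theta\wedge\theta^2-\tfrac R2\,\theta^1\wedge\theta^2\Big)\right),$$ where $TC_2(\pi)=\frac1{24\pi^2}\mathrm{tr}(\pi\wedge\pi\wedge\pi)$ and $\theta^1_1,\tau^1_2,\tau^2_1,R,E^1,E^2,G$ are the pseudo-flag quantities defined in the context.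
   Context: Flag structure: for a real 3-manifold $M$ put $T^{\mathbb C}=TM\otimes\mathbb C$. A flag structure is a choice of two complex line sub-bundles $T^1,T^2\subset T^{\mathbb C}$ with $T^1\cap T^2=\{0\}$ such that $T^1\oplus T^2$ is a contact distribution: locally there is a complex-valued 1-form $\theta$ with $\ker\theta=T^1\oplus T^2$ and $d\theta\wedge\theta$ nowhere zero. The bundle $E$: $E\to M$ is the $\mathbb C^*$-bundle whose fibre at $x$ consists of all complex covectors $\theta$ on $T_xM$ with $\ker\theta=T^1_x\oplus T^2_x$. It carries the tautological 1-form $\omega_\theta=(\text{pull-back of }\theta\text{ to }T_\theta E)$. The coframe bundle $Y$: the fibre of $Y\to E$ over $\varepsilon\in E$ (lying over $x\in M$) is the set of quadruples $(\omega,\omega^1,\omega^2,\phi)$ of complex covectors on $T_\varepsilon E$ where $\omega$ is the tautological form, $\omega^1$ and $\omega^2$ are pull-backs of complex covectors on $T_xM$, the first nonzero on $T^1$ and zero on $T^2$, the second zero on $T^1$ and nonzero on $T^2$, and $d\omega=\omega\wedge\phi+\omega^1\wedge\omega^2$ at $\varepsilon$. The same letters denote the tautological 1-forms on $Y$. Canonical forms: $\omega^1_1,\phi^1,\phi^2,\psi$ are the unique complex-valued 1-forms on $Y$ for which, with some functions $Q^1,Q^2$ on $Y$, $$d\omega=\omega\wedge\phi+\omega^1\wedge\omega^2,\quad d\omega^1=\tfrac12\omega^1\wedge\phi+\omega^1\wedge\omega^1_1+\omega\wedge\phi^1,\quad d\omega^2=\tfrac12\omega^2\wedge\phi-\omega^2\wedge\omega^1_1+\omega\wedge\phi^2,$$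 $$d\phi=\omega^1\wedge\phi^2-\omega^2\wedge\phi^1+\omega\wedge\psi,\qquad d\omega^1_1=\tfrac32\omega^2\wedge\phi^1+\tfrac32\omega^1\wedge\phi^2,$$ $$d\phi^1-\phi^1\wedge\omega^1_1-\tfrac12\omega^1\wedge\psi-\tfrac12\phi\wedge\phi^1=Q^1\,\omega\wedge\omega^2,\qquad d\phi^2+\phi^2\wedge\omega^1_1-\tfrac12\omega^2\wedge\psi-\tfrac12\phi\wedge\phi^2=Q^2\,\omega\wedge\omega^1 .$$ Adapted connection: $$\pi=\begin{pmatrix} -\frac12\phi-\frac13\omega^1_1 & -\phi^2 & -\frac14\psi\\ \omega^1 & \frac23\omega^1_1 & \frac12\phi^1\\ 2\omega & 2\omega^2 & \frac12\phi-\frac13\omega^1_1\end{pmatrix}.$$ Pseudo-flag bundle $X$: with $\theta$ fixed, $X\to M$ is the $\mathbb C^*$-bundle of coframes $(\theta,\theta^1,\theta^2)$ with $\theta^1$ nonzero on $T^1$ and zero on $T^2$, $\theta^2$ zero on $T^1$ and nonzero on $T^2$, and $d\theta=\theta^1\wedge\theta^2$ (all obtained from one by $\theta^1\mapsto a\theta^1$, $\theta^2\mapsto a^{-1}\theta^2$, $a\in\mathbb C^*$). On $X$ there are unique 1-forms $\theta^1_1,\tau^1,\tau^2$ with $d\theta^1=\theta^1\wedge\theta^1_1+\theta\wedge\tau^1$, $d\theta^2=-\theta^2\wedge\theta^1_1+\theta\wedge\tau^2$, $\theta^1_1\equiv-\frac{da}a$ mod $\theta^1,\theta^2,\theta$,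 and $\tau^1\wedge\theta^2=\tau^2\wedge\theta^1=0$. Write $\tau^1=\tau^1_2\theta^2$, $\tau^2=\tau^2_1\theta^1$, $d\theta^1_1=R\,\theta^1\wedge\theta^2+W^1\theta^1\wedge\theta+W^2\theta^2\wedge\theta$, $dR=R_0\theta+R_1\theta^1+R_2\theta^2$. Set $$E^1=\tfrac23\big(W^2-\tfrac14R_2\big),\qquad E^2=\tfrac23\big(W^1-\tfrac14R_1\big).$$ All these forms and functions are pulled back to $M$ by the chosen section of $X$, and keep the same names. For the section $s$ one has $s^*\psi=E^2\theta^1-E^1\theta^2+G\theta$, which defines the function $G$. *)

theory Defs
  imports "HOL-Analysis.Analysis"
begin

section \<open>Smooth manifolds\<close>

text \<open>Only meaningful for open \<open>S\<close>.\<close>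

primrec Ck_on :: "nat \<Rightarrow> 'a::euclidean_space set \<Rightarrow> ('a \<Rightarrow> 'b::real_normed_vector) \<Rightarrow> bool" where
  "Ck_on 0 S f \<longleftrightarrow> continuous_on S f"
| "Ck_on (Suc k) S f \<longleftrightarrow>
     (\<forall>x\<in>S. f differentiable (at x)) \<and> (\<forall>v. Ck_on k S (\<lambda>x. frechet_derivative f (at x) v))"

definition smooth_on :: "'a::euclidean_space set \<Rightarrow> ('a \<Rightarrow> 'b::real_normed_vector) \<Rightarrow> bool" where
  "smooth_on S f \<longleftrightarrow> (\<forall>k. Ck_on k S f)"

text \<open>A chart is a pair of its domain and its coordinate map; values of the coordinate map outside
  the domain are irrelevant.  The topology of the manifold is the one induced by the atlas.\<close>

type_synonym ('p, 'v) chart = "'p set \<times> ('p \<Rightarrow> 'v)"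

record ('p, 'v) mfd =
  pts :: "'p set"
  atlas :: "('p, 'v) chart set"

definition chart_inv :: "('p, 'v) chart \<Rightarrow> 'v \<Rightarrow> 'p" where
  "chart_inv \<kappa> = inv_into (fst \<kappa>) (snd \<kappa>)"

definition open_in :: "('p, 'v::euclidean_space) mfd \<Rightarrow> 'p set \<Rightarrow> bool" where
  "open_in N S \<longleftrightarrow> S \<subseteq> pts N \<and> (\<forall>\<kappa>\<in>atlas N. open (snd \<kappa> ` (S \<inter> fst \<kappa>)))"

definition smooth_manifold :: "('p, 'v::euclidean_space) mfd \<Rightarrow> bool" where
  "smooth_manifold N \<longleftrightarrow>
     pts N = (\<Union>\<kappa>\<in>atlas N. fst \<kappa>) \<and>
     (\<forall>\<kappa>\<in>atlas N. inj_on (snd \<kappa>) (fst \<kappa>) \<and> open (snd \<kappa> ` fst \<kappa>)) \<and>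
     (\<forall>\<kappa>\<in>atlas N. \<forall>\<mu>\<in>atlas N.
        open (snd \<kappa> ` (fst \<kappa> \<inter> fst \<mu>)) \<and>
        smooth_on (snd \<kappa> ` (fst \<kappa> \<inter> fst \<mu>)) (snd \<mu> \<circ> chart_inv \<kappa>)) \<and>
     (\<forall>x\<in>pts N. \<forall>y\<in>pts N. x \<noteq> y \<longrightarrow>
        (\<exists>S T. open_in N S \<and> open_in N T \<and> x \<in> S \<and> y \<in> T \<and> S \<inter> T = {})) \<and>
     (\<exists>B. countable B \<and> (\<forall>S\<in>B. open_in N S) \<and>
        (\<forall>S x. open_in N S \<and> x \<in> S \<longrightarrow> (\<exists>T\<in>B. x \<in> T \<and> T \<subseteq> S)))"

definition smooth_fun_on ::
    "('p, 'v::euclidean_space) mfd \<Rightarrow> 'p set \<Rightarrow> ('p \<Rightarrow> 'b::real_normed_vector) \<Rightarrow> bool" where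
  "smooth_fun_on N S f \<longleftrightarrow>
     (\<forall>\<kappa>\<in>atlas N. smooth_on (snd \<kappa> ` (S \<inter> fst \<kappa>)) (f \<circ> chart_inv \<kappa>))"

definition smooth_near ::
    "('p, 'v::euclidean_space) mfd \<Rightarrow> 'p \<Rightarrow> ('p \<Rightarrow> 'b::real_normed_vector) \<Rightarrow> bool" where
  "smooth_near N x f \<longleftrightarrow> (\<exists>S. open_in N S \<and> x \<in> S \<and> smooth_fun_on N S f)"

definition smooth_map ::
    "('p, 'v::euclidean_space) mfd \<Rightarrow> ('q, 'w::euclidean_space) mfd \<Rightarrow> ('p \<Rightarrow> 'q) \<Rightarrow> bool" where
  "smooth_map N P f \<longleftrightarrow>
     f ` pts N \<subseteq> pts P \<and>
     (\<forall>\<kappa>\<in>atlas N. \<forall>\<mu>\<in>atlas P.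
        open (snd \<kappa> ` (fst \<kappa> \<inter> f -` fst \<mu>)) \<and>
        smooth_on (snd \<kappa> ` (fst \<kappa> \<inter> f -` fst \<mu>)) (snd \<mu> \<circ> f \<circ> chart_inv \<kappa>))"


section \<open>Tangent vectors\<close>

text \<open>A tangent vector is the directional derivative it defines on germs of real functions, extended
  by 0 to functions that are not smooth near the point.  \<open>tvec N \<kappa> x v\<close> is the vector at \<open>x\<close> whose
  components in the chart \<open>\<kappa>\<close> are \<open>v\<close>.\<close>

type_synonym 'p tan = "('p \<Rightarrow> real) \<Rightarrow> real"

definition tvec ::
    "('p, 'v::euclidean_space) mfd \<Rightarrow> ('p, 'v) chart \<Rightarrow> 'p \<Rightarrow> 'v \<Rightarrow> 'p tan" where
  "tvec N \<kappa> x v = (\<lambda>f. if smooth_near N x f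
      then frechet_derivative (f \<circ> chart_inv \<kappa>) (at (snd \<kappa> x)) v else 0)"

definition tangent :: "('p, 'v::euclidean_space) mfd \<Rightarrow> 'p \<Rightarrow> 'p tan set" where
  "tangent N x = {tvec N \<kappa> x v | \<kappa> v. \<kappa> \<in> atlas N \<and> x \<in> fst \<kappa>}"

definition tlin :: "real \<Rightarrow> 'p tan \<Rightarrow> real \<Rightarrow> 'p tan \<Rightarrow> 'p tan" where
  "tlin a V b W = (\<lambda>f. a * V f + b * W f)"

definition push ::
    "('q, 'w::euclidean_space) mfd \<Rightarrow> ('p \<Rightarrow> 'q) \<Rightarrow> 'p \<Rightarrow> 'p tan \<Rightarrow> 'q tan" where
  "push P f x V = (\<lambda>g. if smooth_near P (f x) g then V (g \<circ> f) else 0)"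

definition smooth_vfield_on ::
    "('p, 'v::euclidean_space) mfd \<Rightarrow> 'p set \<Rightarrow> ('p \<Rightarrow> 'p tan) \<Rightarrow> bool" where
  "smooth_vfield_on N S A \<longleftrightarrow>
     (\<forall>\<kappa>\<in>atlas N. \<exists>a. smooth_on (snd \<kappa> ` (S \<inter> fst \<kappa>)) a \<and>
        (\<forall>y\<in>S \<inter> fst \<kappa>. A y = tvec N \<kappa> y (a (snd \<kappa> y))))"

definition smooth_embedding ::
    "('p, 'v::euclidean_space) mfd \<Rightarrow> ('q, 'w::euclidean_space) mfd \<Rightarrow> ('p \<Rightarrow> 'q) \<Rightarrow> bool" where
  "smooth_embedding N P f \<longleftrightarrow>
     smooth_map N P f \<and> inj_on f (pts N) \<and>
     (\<forall>x\<in>pts N. inj_on (push P f x) (tangent N x)) \<and>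
     (\<forall>S. open_in N S \<longrightarrow> (\<exists>T. open_in P T \<and> f ` S = f ` pts N \<inter> T))"

text \<open>The complexified tangent space: the pair \<open>(V, W)\<close> stands for \<open>V + \<i> W\<close>.\<close>

type_synonym 'p ctan = "'p tan \<times> 'p tan"

definition ctangent :: "('p, 'v::euclidean_space) mfd \<Rightarrow> 'p \<Rightarrow> 'p ctan set" where
  "ctangent N x = tangent N x \<times> tangent N x"

definition czero :: "'p ctan" where
  "czero = (\<lambda>_. 0, \<lambda>_. 0)"

definition cscale :: "complex \<Rightarrow> 'p ctan \<Rightarrow> 'p ctan" where
  "cscale z Z = (tlin (Re z) (fst Z) (- Im z) (snd Z), tlin (Re z) (snd Z) (Im z) (fst Z))"

definition cadd :: "'p ctan \<Rightarrow> 'p ctan \<Rightarrow> 'p ctan" where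
  "cadd Z Z' = (tlin 1 (fst Z) 1 (fst Z'), tlin 1 (snd Z) 1 (snd Z'))"


section \<open>Complex-valued differential forms\<close>

text \<open>Complex covectors at a point are real-linear on the tangent space and, to make them
  determined by their values there, 0 elsewhere.  \<open>cov_ext\<close> is the complex-linear extension to the
  complexified tangent space.\<close>

type_synonym 'p cov = "'p tan \<Rightarrow> complex"
type_synonym 'p cov2 = "'p tan \<Rightarrow> 'p tan \<Rightarrow> complex"
type_synonym 'p cov3 = "'p tan \<Rightarrow> 'p tan \<Rightarrow> 'p tan \<Rightarrow> complex"

definition covectors :: "('p, 'v::euclidean_space) mfd \<Rightarrow> 'p \<Rightarrow> 'p cov set" where
  "covectors N x = {\<alpha>.
     (\<forall>V\<in>tangent N x. \<forall>W\<in>tangent N x. \<forall>a b.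
        \<alpha> (tlin a V b W) = of_real a * \<alpha> V + of_real b * \<alpha> W) \<and>
     (\<forall>V. V \<notin> tangent N x \<longrightarrow> \<alpha> V = 0)}"

definition cov_ext :: "'p cov \<Rightarrow> 'p ctan \<Rightarrow> complex" where
  "cov_ext \<alpha> Z = \<alpha> (fst Z) + \<i> * \<alpha> (snd Z)"

definition wedge :: "'p cov \<Rightarrow> 'p cov \<Rightarrow> 'p cov2" (infixl \<open>\<^bold>\<and>\<close> 70) where
  "(\<alpha> \<^bold>\<and> \<beta>) V W = \<alpha> V * \<beta> W - \<alpha> W * \<beta> V"

text \<open>The wedge product of a 1-covector with a 2-covector (in either order).\<close>

definition wedge12 :: "'p cov \<Rightarrow> 'p cov2 \<Rightarrow> 'p cov3" (infixr \<open>\<^bold>\<and>\<^sub>2\<close> 65) where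
  "(\<alpha> \<^bold>\<and>\<^sub>2 \<zeta>) U V W = \<alpha> U * \<zeta> V W - \<alpha> V * \<zeta> U W + \<alpha> W * \<zeta> U V"

definition local_form ::
    "('p, 'v::euclidean_space) mfd \<Rightarrow> ('p, 'v) chart \<Rightarrow> ('p \<Rightarrow> 'p cov) \<Rightarrow> 'v \<Rightarrow> 'v \<Rightarrow> complex" where
  "local_form N \<kappa> \<eta> v z = \<eta> (chart_inv \<kappa> z) (tvec N \<kappa> (chart_inv \<kappa> z) v)"

definition smooth_form_on ::
    "('p, 'v::euclidean_space) mfd \<Rightarrow> 'p set \<Rightarrow> ('p \<Rightarrow> 'p cov) \<Rightarrow> bool" where
  "smooth_form_on N S \<eta> \<longleftrightarrow>
     (\<forall>y\<in>S. \<eta> y \<in> covectors N y) \<and>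
     (\<forall>\<kappa>\<in>atlas N. \<forall>v. smooth_on (snd \<kappa> ` (S \<inter> fst \<kappa>)) (local_form N \<kappa> \<eta> v))"

text \<open>\<open>has_ext_deriv N \<eta> y \<zeta>\<close>: the 2-covector \<open>\<zeta>\<close> at \<open>y\<close> is the value of the exterior derivative of the
  1-form \<open>\<eta>\<close>, with the convention \<open>d\<eta>(V, W) = V \<eta>(W) - W \<eta>(V) - \<eta>([V, W])\<close>; the bracket term
  vanishes for the coordinate vector fields used here.\<close>

definition has_ext_deriv ::
    "('p, 'v::euclidean_space) mfd \<Rightarrow> ('p \<Rightarrow> 'p cov) \<Rightarrow> 'p \<Rightarrow> 'p cov2 \<Rightarrow> bool" where
  "has_ext_deriv N \<eta> y \<zeta> \<longleftrightarrow>
     (\<forall>\<kappa>\<in>atlas N. y \<in> fst \<kappa> \<longrightarrow>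
        (\<forall>v. local_form N \<kappa> \<eta> v differentiable (at (snd \<kappa> y))) \<and>
        (\<forall>v w. frechet_derivative (local_form N \<kappa> \<eta> w) (at (snd \<kappa> y)) v
               - frechet_derivative (local_form N \<kappa> \<eta> v) (at (snd \<kappa> y)) w
             = \<zeta> (tvec N \<kappa> y v) (tvec N \<kappa> y w)))"

definition diff :: "('p \<Rightarrow> complex) \<Rightarrow> 'p cov" where
  "diff f V = Complex (V (\<lambda>p. Re (f p))) (V (\<lambda>p. Im (f p)))"

text \<open>\<open>lift N P f x \<alpha>\<close> is the pull-back to the tangent space at \<open>x\<close> of a covector \<open>\<alpha>\<close> at \<open>f x\<close>.\<close>

definition lift ::
    "('p, 'v::euclidean_space) mfd \<Rightarrow> ('q, 'w::euclidean_space) mfd \<Rightarrow> ('p \<Rightarrow> 'q) \<Rightarrow> 'p \<Rightarrow> 'q cov \<Rightarrow> 'p cov"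
  where
  "lift N P f x \<alpha> = (\<lambda>V. if V \<in> tangent N x then \<alpha> (push P f x V) else 0)"

definition pullback ::
    "('p, 'v::euclidean_space) mfd \<Rightarrow> ('q, 'w::euclidean_space) mfd \<Rightarrow> ('p \<Rightarrow> 'q) \<Rightarrow>
     ('q \<Rightarrow> 'q cov) \<Rightarrow> 'p \<Rightarrow> 'p cov" where
  "pullback N P f \<eta> x = lift N P f x (\<eta> (f x))"

definition pullback3 ::
    "('q, 'w::euclidean_space) mfd \<Rightarrow> ('p \<Rightarrow> 'q) \<Rightarrow> ('q \<Rightarrow> 'q cov3) \<Rightarrow> 'p \<Rightarrow> 'p cov3" where
  "pullback3 P f \<Omega> x U V W = \<Omega> (f x) (push P f x U) (push P f x V) (push P f x W)"


section \<open>Flag structures and the bundle E\<close>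

definition complex_line_subbundle ::
    "('p, 'v::euclidean_space) mfd \<Rightarrow> ('p \<Rightarrow> 'p ctan set) \<Rightarrow> bool" where
  "complex_line_subbundle N T \<longleftrightarrow>
     (\<forall>x\<in>pts N. \<exists>S A B. open_in N S \<and> x \<in> S \<and> smooth_vfield_on N S A \<and> smooth_vfield_on N S B \<and>
        (\<forall>y\<in>S. (A y, B y) \<noteq> czero \<and> T y = {cscale z (A y, B y) | z. True}))"

definition cplane :: "('p \<Rightarrow> 'p ctan set) \<Rightarrow> ('p \<Rightarrow> 'p ctan set) \<Rightarrow> 'p \<Rightarrow> 'p ctan set" where
  "cplane T1 T2 x = {cadd Z Z' | Z Z'. Z \<in> T1 x \<and> Z' \<in> T2 x}"

definition cov_kernel :: "('p, 'v::euclidean_space) mfd \<Rightarrow> 'p \<Rightarrow> 'p cov \<Rightarrow> 'p ctan set" where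
  "cov_kernel N x \<alpha> = {Z \<in> ctangent N x. cov_ext \<alpha> Z = 0}"

definition flag_structure ::
    "('m, 'v::euclidean_space) mfd \<Rightarrow> ('m \<Rightarrow> 'm ctan set) \<Rightarrow> ('m \<Rightarrow> 'm ctan set) \<Rightarrow> bool" where
  "flag_structure M T1 T2 \<longleftrightarrow>
     complex_line_subbundle M T1 \<and> complex_line_subbundle M T2 \<and>
     (\<forall>x\<in>pts M. T1 x \<inter> T2 x = {czero}) \<and>
     (\<forall>x\<in>pts M. \<exists>S \<theta>. open_in M S \<and> x \<in> S \<and> smooth_form_on M S \<theta> \<and>
        (\<forall>y\<in>S. cov_kernel M y (\<theta> y) = cplane T1 T2 y \<and>
           (\<exists>\<zeta>. has_ext_deriv M \<theta> y \<zeta> \<and>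
              (\<exists>U\<in>tangent M y. \<exists>V\<in>tangent M y. \<exists>W\<in>tangent M y. (\<theta> y \<^bold>\<and>\<^sub>2 \<zeta>) U V W \<noteq> 0))))"

text \<open>The total space of E consists of the pairs of a point and a covector at that point.  Its charts
  are the trivialisations \<open>l \<theta>\<^sub>0(x) \<mapsto> (x, l)\<close> given by a local smooth section \<open>\<theta>\<^sub>0\<close> over an open part of a
  chart domain of \<open>M\<close>.\<close>

type_synonym 'm epoint = "'m \<times> 'm cov"

definition Epts ::
    "('m, 'v::euclidean_space) mfd \<Rightarrow> ('m \<Rightarrow> 'm ctan set) \<Rightarrow> ('m \<Rightarrow> 'm ctan set) \<Rightarrow> 'm epoint set" where
  "Epts M T1 T2 = {(x, \<alpha>). x \<in> pts M \<and> \<alpha> \<in> covectors M x \<and> cov_kernel M x \<alpha> = cplane T1 T2 x}"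

definition bundleE ::
    "('m, 'v::euclidean_space) mfd \<Rightarrow> ('m \<Rightarrow> 'm ctan set) \<Rightarrow> ('m \<Rightarrow> 'm ctan set) \<Rightarrow>
     ('m epoint, 'v \<times> complex) mfd" where
  "bundleE M T1 T2 = \<lparr> pts = Epts M T1 T2,
     atlas = {({(x, \<alpha>) \<in> Epts M T1 T2. x \<in> S},
               \<lambda>(x, \<alpha>). (snd \<kappa> x, THE l. \<alpha> = (\<lambda>V. l * \<theta>\<^sub>0 x V))) | \<kappa> S \<theta>\<^sub>0.
       \<kappa> \<in> atlas M \<and> open_in M S \<and> S \<subseteq> fst \<kappa> \<and> smooth_form_on M S \<theta>\<^sub>0 \<and>
       (\<forall>x\<in>S. (x, \<theta>\<^sub>0 x) \<in> Epts M T1 T2)} \<rparr>"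

definition tautE ::
    "('m, 'v::euclidean_space) mfd \<Rightarrow> ('m \<Rightarrow> 'm ctan set) \<Rightarrow> ('m \<Rightarrow> 'm ctan set) \<Rightarrow>
     'm epoint \<Rightarrow> 'm epoint cov" where
  "tautE M T1 T2 \<epsilon> = lift (bundleE M T1 T2) M fst \<epsilon> (snd \<epsilon>)"

definition contact_form ::
    "('m, 'v::euclidean_space) mfd \<Rightarrow> ('m \<Rightarrow> 'm ctan set) \<Rightarrow> ('m \<Rightarrow> 'm ctan set) \<Rightarrow> ('m \<Rightarrow> 'm cov) \<Rightarrow> bool"
  where
  "contact_form M T1 T2 \<theta> \<longleftrightarrow>
     smooth_form_on M (pts M) \<theta> \<and> (\<forall>x\<in>pts M. (x, \<theta> x) \<in> pts (bundleE M T1 T2))"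

text \<open>Covectors at \<open>x\<close> that are nonzero on the line \<open>A x\<close> and zero on the line \<open>B x\<close>.\<close>

definition adapted_covectors ::
    "('m, 'v::euclidean_space) mfd \<Rightarrow> ('m \<Rightarrow> 'm ctan set) \<Rightarrow> ('m \<Rightarrow> 'm ctan set) \<Rightarrow> 'm \<Rightarrow> 'm cov set" where
  "adapted_covectors M A B x =
     {\<alpha> \<in> covectors M x. (\<exists>Z\<in>A x. cov_ext \<alpha> Z \<noteq> 0) \<and> (\<forall>Z\<in>B x. cov_ext \<alpha> Z = 0)}"


section \<open>The coframe bundle Y\<close>

text \<open>A point of Y is \<open>(\<epsilon>, w, w1, w2, f)\<close> with \<open>\<epsilon>\<close> in E and \<open>(w, w1, w2, f)\<close> the coframe
  \<open>(\<omega>, \<omega>\<^sup>1, \<omega>\<^sup>2, \<phi>)\<close> at \<open>\<epsilon>\<close>.\<close>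

type_synonym 'm ypoint =
  "'m epoint \<times> 'm epoint cov \<times> 'm epoint cov \<times> 'm epoint cov \<times> 'm epoint cov"

definition Ypts ::
    "('m, 'v::euclidean_space) mfd \<Rightarrow> ('m \<Rightarrow> 'm ctan set) \<Rightarrow> ('m \<Rightarrow> 'm ctan set) \<Rightarrow> 'm ypoint set" where
  "Ypts M T1 T2 = {(\<epsilon>, w, w1, w2, f).
     \<epsilon> \<in> pts (bundleE M T1 T2) \<and> w = tautE M T1 T2 \<epsilon> \<and>
     w1 \<in> lift (bundleE M T1 T2) M fst \<epsilon> ` adapted_covectors M T1 T2 (fst \<epsilon>) \<and>
     w2 \<in> lift (bundleE M T1 T2) M fst \<epsilon> ` adapted_covectors M T2 T1 (fst \<epsilon>) \<and>
     f \<in> covectors (bundleE M T1 T2) \<epsilon> \<and>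
     has_ext_deriv (bundleE M T1 T2) (tautE M T1 T2) \<epsilon>
       (\<lambda>V W. (w \<^bold>\<and> f) V W + (w1 \<^bold>\<and> w2) V W)}"

text \<open>Two coframes \<open>(\<omega>, \<eta>1, \<eta>2, \<xi>)\<close> and \<open>(\<omega>, w1, w2, f)\<close> in the same fibre are related by
  \<open>w1 = a \<eta>1 + b \<omega>\<close> and \<open>w2 = a\<^sup>-\<^sup>1 \<eta>2 + c \<omega>\<close> with \<open>a \<noteq> 0\<close>, and then
  \<open>\<omega> \<and> f + w1 \<and> w2 = \<omega> \<and> \<xi> + \<eta>1 \<and> \<eta>2\<close> gives \<open>f = \<xi> + a c \<eta>1 - a\<^sup>-\<^sup>1 b \<eta>2 + t \<omega>\<close>.  A local smooth section of Y
  thus trivialises Y with fibre coordinates \<open>(a, b, c, t)\<close>; these trivialisations are the charts of Y.\<close>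

definition Ycoord ::
    "'e cov \<Rightarrow> 'e cov \<Rightarrow> 'e cov \<Rightarrow> 'e cov \<Rightarrow> 'e cov \<Rightarrow> 'e cov \<Rightarrow> 'e cov \<Rightarrow>
     complex \<times> complex \<times> complex \<times> complex" where
  "Ycoord \<omega> \<eta>1 \<eta>2 \<xi> w1 w2 f = (THE q. case q of (a, b, c, t) \<Rightarrow> a \<noteq> 0 \<and>
     w1 = (\<lambda>V. a * \<eta>1 V + b * \<omega> V) \<and>
     w2 = (\<lambda>V. inverse a * \<eta>2 V + c * \<omega> V) \<and>
     f = (\<lambda>V. \<xi> V + a * c * \<eta>1 V - inverse a * b * \<eta>2 V + t * \<omega> V))"

definition bundleY ::
    "('m, 'v::euclidean_space) mfd \<Rightarrow> ('m \<Rightarrow> 'm ctan set) \<Rightarrow> ('m \<Rightarrow> 'm ctan set) \<Rightarrow>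
     ('m ypoint, ('v \<times> complex) \<times> (complex \<times> complex \<times> complex \<times> complex)) mfd" where
  "bundleY M T1 T2 = \<lparr> pts = Ypts M T1 T2,
     atlas = {({(\<epsilon>, w, w1, w2, f) \<in> Ypts M T1 T2. \<epsilon> \<in> S},
               \<lambda>(\<epsilon>, w, w1, w2, f).
                 (snd \<kappa> \<epsilon>, Ycoord (tautE M T1 T2 \<epsilon>) (\<eta>1 \<epsilon>) (\<eta>2 \<epsilon>) (\<xi> \<epsilon>) w1 w2 f)) | \<kappa> S \<eta>1 \<eta>2 \<xi>.
       \<kappa> \<in> atlas (bundleE M T1 T2) \<and> open_in (bundleE M T1 T2) S \<and> S \<subseteq> fst \<kappa> \<and>
       smooth_form_on (bundleE M T1 T2) S \<eta>1 \<and>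
       smooth_form_on (bundleE M T1 T2) S \<eta>2 \<and>
       smooth_form_on (bundleE M T1 T2) S \<xi> \<and>
       (\<forall>\<epsilon>\<in>S. (\<epsilon>, tautE M T1 T2 \<epsilon>, \<eta>1 \<epsilon>, \<eta>2 \<epsilon>, \<xi> \<epsilon>) \<in> Ypts M T1 T2)} \<rparr>"

text \<open>The tautological forms \<open>\<omega>, \<omega>\<^sup>1, \<omega>\<^sup>2, \<phi>\<close> on Y.\<close>

definition Yomega where
  "Yomega M T1 T2 y = lift (bundleY M T1 T2) (bundleE M T1 T2) fst y ((\<lambda>(\<epsilon>, w, w1, w2, f). w) y)"

definition Yomega1 where
  "Yomega1 M T1 T2 y = lift (bundleY M T1 T2) (bundleE M T1 T2) fst y ((\<lambda>(\<epsilon>, w, w1, w2, f). w1) y)"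

definition Yomega2 where
  "Yomega2 M T1 T2 y = lift (bundleY M T1 T2) (bundleE M T1 T2) fst y ((\<lambda>(\<epsilon>, w, w1, w2, f). w2) y)"

definition Yphi where
  "Yphi M T1 T2 y = lift (bundleY M T1 T2) (bundleE M T1 T2) fst y ((\<lambda>(\<epsilon>, w, w1, w2, f). f) y)"

text \<open>The arguments \<open>\<omega>11, \<phi>1, \<phi>2, \<psi>\<close> are \<open>\<omega>\<^sup>1\<^sub>1, \<phi>\<^sup>1, \<phi>\<^sup>2, \<psi>\<close>.\<close>

definition canonical_forms ::
    "('m, 'v::euclidean_space) mfd \<Rightarrow> ('m \<Rightarrow> 'm ctan set) \<Rightarrow> ('m \<Rightarrow> 'm ctan set) \<Rightarrow>
     ('m ypoint \<Rightarrow> 'm ypoint cov) \<Rightarrow> ('m ypoint \<Rightarrow> 'm ypoint cov) \<Rightarrow>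
     ('m ypoint \<Rightarrow> 'm ypoint cov) \<Rightarrow> ('m ypoint \<Rightarrow> 'm ypoint cov) \<Rightarrow> bool" where
  "canonical_forms M T1 T2 \<omega>11 \<phi>1 \<phi>2 \<psi> \<longleftrightarrow>
     (let Y = bundleY M T1 T2; \<omega> = Yomega M T1 T2; \<omega>1 = Yomega1 M T1 T2; \<omega>2 = Yomega2 M T1 T2;
          \<phi> = Yphi M T1 T2 in
      smooth_form_on Y (pts Y) \<omega>11 \<and> smooth_form_on Y (pts Y) \<phi>1 \<and>
      smooth_form_on Y (pts Y) \<phi>2 \<and> smooth_form_on Y (pts Y) \<psi> \<and>
      (\<exists>Q1 Q2 :: 'm ypoint \<Rightarrow> complex. \<forall>y\<in>pts Y.
        has_ext_deriv Y \<omega> y (\<lambda>V W. (\<omega> y \<^bold>\<and> \<phi> y) V W + (\<omega>1 y \<^bold>\<and> \<omega>2 y) V W) \<and>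
        has_ext_deriv Y \<omega>1 y (\<lambda>V W.
          1/2 * (\<omega>1 y \<^bold>\<and> \<phi> y) V W + (\<omega>1 y \<^bold>\<and> \<omega>11 y) V W + (\<omega> y \<^bold>\<and> \<phi>1 y) V W) \<and>
        has_ext_deriv Y \<omega>2 y (\<lambda>V W.
          1/2 * (\<omega>2 y \<^bold>\<and> \<phi> y) V W - (\<omega>2 y \<^bold>\<and> \<omega>11 y) V W + (\<omega> y \<^bold>\<and> \<phi>2 y) V W) \<and>
        has_ext_deriv Y \<phi> y (\<lambda>V W.
          (\<omega>1 y \<^bold>\<and> \<phi>2 y) V W - (\<omega>2 y \<^bold>\<and> \<phi>1 y) V W + (\<omega> y \<^bold>\<and> \<psi> y) V W) \<and>
        has_ext_deriv Y \<omega>11 y (\<lambda>V W.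
          3/2 * (\<omega>2 y \<^bold>\<and> \<phi>1 y) V W + 3/2 * (\<omega>1 y \<^bold>\<and> \<phi>2 y) V W) \<and>
        has_ext_deriv Y \<phi>1 y (\<lambda>V W.
          (\<phi>1 y \<^bold>\<and> \<omega>11 y) V W + 1/2 * (\<omega>1 y \<^bold>\<and> \<psi> y) V W + 1/2 * (\<phi> y \<^bold>\<and> \<phi>1 y) V W
          + Q1 y * (\<omega> y \<^bold>\<and> \<omega>2 y) V W) \<and>
        has_ext_deriv Y \<phi>2 y (\<lambda>V W.
          - (\<phi>2 y \<^bold>\<and> \<omega>11 y) V W + 1/2 * (\<omega>2 y \<^bold>\<and> \<psi> y) V W + 1/2 * (\<phi> y \<^bold>\<and> \<phi>2 y) V W
          + Q2 y * (\<omega> y \<^bold>\<and> \<omega>1 y) V W)))"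


section \<open>The adapted connection and its Chern-Simons form\<close>

definition adapted_connection ::
    "('m, 'v::euclidean_space) mfd \<Rightarrow> ('m \<Rightarrow> 'm ctan set) \<Rightarrow> ('m \<Rightarrow> 'm ctan set) \<Rightarrow>
     ('m ypoint \<Rightarrow> 'm ypoint cov) \<Rightarrow> ('m ypoint \<Rightarrow> 'm ypoint cov) \<Rightarrow>
     ('m ypoint \<Rightarrow> 'm ypoint cov) \<Rightarrow> ('m ypoint \<Rightarrow> 'm ypoint cov) \<Rightarrow>
     'm ypoint \<Rightarrow> 'm ypoint tan \<Rightarrow> complex^3^3" where
  "adapted_connection M T1 T2 \<omega>11 \<phi>1 \<phi>2 \<psi> y V =
     (let \<omega> = Yomega M T1 T2; \<omega>1 = Yomega1 M T1 T2; \<omega>2 = Yomega2 M T1 T2; \<phi> = Yphi M T1 T2 in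
      vector [
        vector [- (1/2) * \<phi> y V - 1/3 * \<omega>11 y V, - \<phi>2 y V, - (1/4) * \<psi> y V],
        vector [\<omega>1 y V, 2/3 * \<omega>11 y V, 1/2 * \<phi>1 y V],
        vector [2 * \<omega> y V, 2 * \<omega>2 y V, 1/2 * \<phi> y V - 1/3 * \<omega>11 y V]])"

definition mwedge ::
    "('p tan \<Rightarrow> complex^'n^'n) \<Rightarrow> ('p tan \<Rightarrow> complex^'n^'n) \<Rightarrow> 'p tan \<Rightarrow> 'p tan \<Rightarrow> complex^'n^'n" where
  "mwedge A B V W = A V ** B W - A W ** B V"

definition mwedge12 ::
    "('p tan \<Rightarrow> complex^'n^'n) \<Rightarrow> ('p tan \<Rightarrow> 'p tan \<Rightarrow> complex^'n^'n) \<Rightarrow>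
     'p tan \<Rightarrow> 'p tan \<Rightarrow> 'p tan \<Rightarrow> complex^'n^'n" where
  "mwedge12 A Z U V W = A U ** Z V W - A V ** Z U W + A W ** Z U V"

definition TC2 :: "('p \<Rightarrow> 'p tan \<Rightarrow> complex^'n^'n) \<Rightarrow> 'p \<Rightarrow> 'p cov3" where
  "TC2 A y U V W =
     1 / (24 * (of_real pi)\<^sup>2) * trace (mwedge12 (A y) (mwedge (A y) (A y)) U V W)"


section \<open>The pseudo-flag bundle X\<close>

text \<open>As \<open>\<theta>\<close> is fixed, the coframe \<open>(\<theta>, \<theta>\<^sup>1, \<theta>\<^sup>2)\<close> at \<open>x\<close> is recorded as \<open>(x, \<theta>\<^sup>1, \<theta>\<^sup>2)\<close>.  The charts of X
  are the trivialisations by \<open>a\<close> relative to a local smooth section \<open>(\<eta>1, \<eta>2)\<close>.\<close>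

type_synonym 'm xpoint = "'m \<times> 'm cov \<times> 'm cov"

definition Xpts ::
    "('m, 'v::euclidean_space) mfd \<Rightarrow> ('m \<Rightarrow> 'm ctan set) \<Rightarrow> ('m \<Rightarrow> 'm ctan set) \<Rightarrow> ('m \<Rightarrow> 'm cov) \<Rightarrow>
     'm xpoint set" where
  "Xpts M T1 T2 \<theta> = {(x, \<alpha>1, \<alpha>2). x \<in> pts M \<and>
     \<alpha>1 \<in> adapted_covectors M T1 T2 x \<and> \<alpha>2 \<in> adapted_covectors M T2 T1 x \<and>
     has_ext_deriv M \<theta> x (\<alpha>1 \<^bold>\<and> \<alpha>2)}"

definition bundleX ::
    "('m, 'v::euclidean_space) mfd \<Rightarrow> ('m \<Rightarrow> 'm ctan set) \<Rightarrow> ('m \<Rightarrow> 'm ctan set) \<Rightarrow> ('m \<Rightarrow> 'm cov) \<Rightarrow>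
     ('m xpoint, 'v \<times> complex) mfd" where
  "bundleX M T1 T2 \<theta> = \<lparr> pts = Xpts M T1 T2 \<theta>,
     atlas = {({(x, \<alpha>1, \<alpha>2) \<in> Xpts M T1 T2 \<theta>. x \<in> S},
               \<lambda>(x, \<alpha>1, \<alpha>2). (snd \<kappa> x,
                  THE a. a \<noteq> 0 \<and> \<alpha>1 = (\<lambda>V. a * \<eta>1 x V) \<and> \<alpha>2 = (\<lambda>V. inverse a * \<eta>2 x V))) | \<kappa> S \<eta>1 \<eta>2.
       \<kappa> \<in> atlas M \<and> open_in M S \<and> S \<subseteq> fst \<kappa> \<and>
       smooth_form_on M S \<eta>1 \<and> smooth_form_on M S \<eta>2 \<and>
       (\<forall>x\<in>S. (x, \<eta>1 x, \<eta>2 x) \<in> Xpts M T1 T2 \<theta>)} \<rparr>"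

text \<open>The forms \<open>\<theta>, \<theta>\<^sup>1, \<theta>\<^sup>2\<close> on X.\<close>

definition Xtheta where
  "Xtheta M T1 T2 \<theta> = pullback (bundleX M T1 T2 \<theta>) M fst \<theta>"

definition Xtheta1 where
  "Xtheta1 M T1 T2 \<theta> p = lift (bundleX M T1 T2 \<theta>) M fst p ((\<lambda>(x, \<alpha>1, \<alpha>2). \<alpha>1) p)"

definition Xtheta2 where
  "Xtheta2 M T1 T2 \<theta> p = lift (bundleX M T1 T2 \<theta>) M fst p ((\<lambda>(x, \<alpha>1, \<alpha>2). \<alpha>2) p)"

text \<open>The arguments \<open>\<theta>11, \<tau>1, \<tau>2\<close> are \<open>\<theta>\<^sup>1\<^sub>1, \<tau>\<^sup>1, \<tau>\<^sup>2\<close>.  The fibre coordinate \<open>a\<close> is the last component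
  of each chart of X.\<close>

definition pseudo_flag_forms ::
    "('m, 'v::euclidean_space) mfd \<Rightarrow> ('m \<Rightarrow> 'm ctan set) \<Rightarrow> ('m \<Rightarrow> 'm ctan set) \<Rightarrow> ('m \<Rightarrow> 'm cov) \<Rightarrow>
     ('m xpoint \<Rightarrow> 'm xpoint cov) \<Rightarrow> ('m xpoint \<Rightarrow> 'm xpoint cov) \<Rightarrow>
     ('m xpoint \<Rightarrow> 'm xpoint cov) \<Rightarrow> bool" where
  "pseudo_flag_forms M T1 T2 \<theta> \<theta>11 \<tau>1 \<tau>2 \<longleftrightarrow>
     (let X = bundleX M T1 T2 \<theta>; t = Xtheta M T1 T2 \<theta>; t1 = Xtheta1 M T1 T2 \<theta>; t2 = Xtheta2 M T1 T2 \<theta> in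
      smooth_form_on X (pts X) \<theta>11 \<and> smooth_form_on X (pts X) \<tau>1 \<and> smooth_form_on X (pts X) \<tau>2 \<and>
      (\<forall>p\<in>pts X.
        has_ext_deriv X t1 p (\<lambda>V W. (t1 p \<^bold>\<and> \<theta>11 p) V W + (t p \<^bold>\<and> \<tau>1 p) V W) \<and>
        has_ext_deriv X t2 p (\<lambda>V W. - (t2 p \<^bold>\<and> \<theta>11 p) V W + (t p \<^bold>\<and> \<tau>2 p) V W) \<and>
        (\<forall>\<kappa>\<in>atlas X. p \<in> fst \<kappa> \<longrightarrow> (\<exists>f1 f2 f. \<forall>V\<in>tangent X p.
           \<theta>11 p V = - (diff (\<lambda>q. snd (snd \<kappa> q)) V / snd (snd \<kappa> p))
                     + f1 * t1 p V + f2 * t2 p V + f * t p V)) \<and>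
        (\<forall>V\<in>tangent X p. \<forall>W\<in>tangent X p. (\<tau>1 p \<^bold>\<and> t2 p) V W = 0 \<and> (\<tau>2 p \<^bold>\<and> t1 p) V W = 0)))"

text \<open>The functions \<open>\<tau>12, \<tau>21, W1, W2\<close> are \<open>\<tau>\<^sup>1\<^sub>2, \<tau>\<^sup>2\<^sub>1, W\<^sup>1, W\<^sup>2\<close>.\<close>

definition pseudo_flag_functions ::
    "('m, 'v::euclidean_space) mfd \<Rightarrow> ('m \<Rightarrow> 'm ctan set) \<Rightarrow> ('m \<Rightarrow> 'm ctan set) \<Rightarrow> ('m \<Rightarrow> 'm cov) \<Rightarrow>
     ('m xpoint \<Rightarrow> 'm xpoint cov) \<Rightarrow> ('m xpoint \<Rightarrow> 'm xpoint cov) \<Rightarrow> ('m xpoint \<Rightarrow> 'm xpoint cov) \<Rightarrow>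
     ('m xpoint \<Rightarrow> complex) \<Rightarrow> ('m xpoint \<Rightarrow> complex) \<Rightarrow> ('m xpoint \<Rightarrow> complex) \<Rightarrow>
     ('m xpoint \<Rightarrow> complex) \<Rightarrow> ('m xpoint \<Rightarrow> complex) \<Rightarrow>
     ('m xpoint \<Rightarrow> complex) \<Rightarrow> ('m xpoint \<Rightarrow> complex) \<Rightarrow> ('m xpoint \<Rightarrow> complex) \<Rightarrow> bool" where
  "pseudo_flag_functions M T1 T2 \<theta> \<theta>11 \<tau>1 \<tau>2 \<tau>12 \<tau>21 R W1 W2 R0 R1 R2 \<longleftrightarrow>
     (let X = bundleX M T1 T2 \<theta>; t = Xtheta M T1 T2 \<theta>; t1 = Xtheta1 M T1 T2 \<theta>; t2 = Xtheta2 M T1 T2 \<theta> in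
      smooth_fun_on X (pts X) R \<and>
      (\<forall>p\<in>pts X.
        (\<forall>V\<in>tangent X p. \<tau>1 p V = \<tau>12 p * t2 p V \<and> \<tau>2 p V = \<tau>21 p * t1 p V) \<and>
        has_ext_deriv X \<theta>11 p (\<lambda>V W.
          R p * (t1 p \<^bold>\<and> t2 p) V W + W1 p * (t1 p \<^bold>\<and> t p) V W + W2 p * (t2 p \<^bold>\<and> t p) V W) \<and>
        (\<forall>V\<in>tangent X p. diff R V = R0 p * t p V + R1 p * t1 p V + R2 p * t2 p V)))"


section \<open>Sections\<close>

definition Xsection where
  "Xsection M T1 T2 \<theta> \<theta>1 \<theta>2 \<longleftrightarrow>
     smooth_form_on M (pts M) \<theta>1 \<and> smooth_form_on M (pts M) \<theta>2 \<and>
     (\<forall>x\<in>pts M. (x, \<theta>1 x, \<theta>2 x) \<in> pts (bundleX M T1 T2 \<theta>))"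

definition Ysection where
  "Ysection M T1 T2 s \<longleftrightarrow>
     smooth_map M (bundleY M T1 T2) s \<and> (\<forall>x\<in>pts M. fst (fst (s x)) = x)"

definition Yfactors_through_X where
  "Yfactors_through_X M T1 T2 \<theta> \<sigma> s \<longleftrightarrow>
     (\<exists>\<iota>. smooth_embedding (bundleX M T1 T2 \<theta>) (bundleY M T1 T2) \<iota> \<and>
          (\<forall>p\<in>pts (bundleX M T1 T2 \<theta>). fst (fst (\<iota> p)) = fst p) \<and>
          (\<forall>x\<in>pts M. s x = \<iota> (\<sigma> x)))"

end

theory Submission
  imports Defs
begin

text \<open>Along \<open>s\<close> there are two systems of structure equations on \<open>M\<close>: those of Y, pulled back by \<open>s\<close>, and those of X,
pulled back by \<open>\<sigma>\<close>.  They describe the exterior derivatives of the same coframe \<open>(\<theta>, \<theta>\<^sup>1, \<theta>\<^sup>2)\<close>, and comparing them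
determines the connection matrix.  The equations for \<open>d\<theta>\<^sup>1\<close> and \<open>d\<theta>\<^sup>2\<close> give
\<open>s\<^sup>*\<omega>\<^sup>1\<^sub>1 = \<theta>\<^sup>1\<^sub>1 + c \<theta>\<close> for some function \<open>c\<close>, and \<open>s\<^sup>*\<phi>\<^sup>1 \<equiv> c \<theta>\<^sup>1 + \<tau>\<^sup>1\<^sub>2 \<theta>\<^sup>2\<close>, \<open>s\<^sup>*\<phi>\<^sup>2 \<equiv> \<tau>\<^sup>2\<^sub>1 \<theta>\<^sup>1 - c \<theta>\<^sup>2\<close> modulo \<open>\<theta>\<close>.  As \<open>s\<^sup>*\<phi> = 0\<close>,
the equation for \<open>d\<phi>\<close> and the given form of \<open>s\<^sup>*\<psi>\<close> show that their \<open>\<theta>\<close>-coefficients are \<open>E\<^sup>1\<close> and \<open>E\<^sup>2\<close> (\<open>compare_structure_equations\<close>).  Comparing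
\<open>d\<omega>\<^sup>1\<^sub>1\<close> with \<open>d\<theta>\<^sup>1\<^sub>1\<close> on \<open>ker \<theta>\<close> gives \<open>-3 c - R = c\<close>, hence \<open>c = - R / 4\<close> (\<open>connection_pullback\<close>).  For \<open>\<phi> = 0\<close> the
trace is
\<open>tr(\<pi>\<^sup>3) = 3 (\<phi>\<^sup>1 \<and> \<phi>\<^sup>2 \<and> \<omega> + 1/2 \<psi> \<and> \<omega>\<^sup>1 \<and> \<omega>\<^sup>2 + \<omega>\<^sup>1\<^sub>1 \<and> (\<phi>\<^sup>2 \<and> \<omega>\<^sup>1 + \<phi>\<^sup>1 \<and> \<omega>\<^sup>2))\<close> (\<open>trace_cube_adapted\<close>), and substitution of the
pulled-back forms yields the formula.

Most of the work is to justify the pull-backs.  Naturality of the exterior derivative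
(\<open>pullback_ext_deriv\<close>) rests on the symmetry of second derivatives.  To apply it to maps into X and
Y, charts must be injective, and the tautological forms linear in each chart.  For Y this is linear algebra
in the fibres (\<open>Ypts_fibre\<close>, \<open>Ypts_move\<close>, \<open>Ycoord_eq\<close>), once the tangent spaces of E
are known to be independent of the chart; for X it follows from \<open>Xpts_fibre\<close>.\<close>

section \<open>Functions of class \<open>C\<^sup>k\<close>\<close>

abbreviation fd :: "('a::euclidean_space \<Rightarrow> 'b::real_normed_vector) \<Rightarrow> 'a \<Rightarrow> 'a \<Rightarrow> 'b" where
  "fd f x v \<equiv> frechet_derivative f (at x) v"

lemma has_derivative_fd:
  assumes "f differentiable (at x)"
  shows "(f has_derivative fd f x) (at x)"
  using assms frechet_derivative_works by blast

lemma fd_eqI: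
  assumes "(f has_derivative f') (at x)"
  shows "fd f x v = f' v"
  using assms frechet_derivative_at by metis

lemma linear_fd:
  assumes "f differentiable (at x)"
  shows "linear (fd f x)"
  using linear_frechet_derivative[OF assms] .

lemma has_derivative_cong_open:
  assumes "open S" "x \<in> S" "\<And>y. y \<in> S \<Longrightarrow> f y = g y"
  shows "(f has_derivative D) (at x) \<longleftrightarrow> (g has_derivative D) (at x)"
  using has_derivative_transform_within_open[OF _ assms(1,2)] assms(3) by metis

lemma fd_cong_open:
  assumes "open S" "x \<in> S" "\<And>y. y \<in> S \<Longrightarrow> f y = g y"
  shows "fd f x v = fd g x v"
  unfolding frechet_derivative_def
  using has_derivative_cong_open[of S x f g, OF assms(1,2)] assms(3) by simp

lemma differentiable_cong_open:
  assumes "open S" "x \<in> S" "\<And>y. y \<in> S \<Longrightarrow> f y = g y"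
  shows "f differentiable (at x) \<longleftrightarrow> g differentiable (at x)"
  unfolding differentiable_def
  using has_derivative_cong_open[of S x f g, OF assms(1,2)] assms(3) by simp

lemma Ck_on_cong:
  assumes "open S" "\<And>y. y \<in> S \<Longrightarrow> f y = g y"
  shows "Ck_on k S f \<longleftrightarrow> Ck_on k S g"
  using assms(2)
proof (induction k arbitrary: f g)
  case 0
  then show ?case by (auto intro: continuous_on_cong)
next
  case (Suc k)
  have "Ck_on k S (\<lambda>x. fd f x v) = Ck_on k S (\<lambda>x. fd g x v)" for v
    by (rule Suc.IH) (rule fd_cong_open[OF assms(1)], use Suc.prems in auto)
  moreover have "f differentiable (at x) \<longleftrightarrow> g differentiable (at x)" if "x \<in> S" for x
    using differentiable_cong_open[OF assms(1) that] Suc.prems by blast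
  ultimately show ?case by simp
qed

lemma Ck_on_subset:
  assumes "Ck_on k S f" "T \<subseteq> S"
  shows "Ck_on k T f"
  using assms
  by (induction k arbitrary: f) (auto intro: continuous_on_subset)

lemma Ck_on_Suc_continuous:
  assumes "Ck_on (Suc k) S f"
  shows "continuous_on S f"
  using assms by (auto intro!: continuous_at_imp_continuous_on differentiable_imp_continuous_within)

lemma Ck_on_lower:
  assumes "Ck_on (Suc k) S f"
  shows "Ck_on k S f"
  using assms
proof (induction k arbitrary: f)
  case 0
  show ?case using Ck_on_Suc_continuous[OF 0] by simp
next
  case (Suc k)
  then show ?case by simp
qed

lemma Ck_on_const: "Ck_on k S (\<lambda>x. c)"
proof (induction k arbitrary: c)
  case (Suc k)
  have "fd (\<lambda>x. c) x v = 0" for x v by (simp add: frechet_derivative_const)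
  then show ?case using Suc by simp
qed simp

lemma Ck_on_add:
  assumes "open S" "Ck_on k S f" "Ck_on k S g"
  shows "Ck_on k S (\<lambda>x. f x + g x)"
  using assms(2,3)
proof (induction k arbitrary: f g)
  case 0
  then show ?case by (simp add: continuous_on_add)
next
  case (Suc k)
  have "Ck_on k S (\<lambda>x. fd (\<lambda>x. f x + g x) x v)" for v
  proof -
    have "fd (\<lambda>x. f x + g x) x v = fd f x v + fd g x v" if "x \<in> S" for x
      by (rule fd_eqI) (use Suc.prems that in \<open>auto intro!: derivative_intros has_derivative_fd\<close>)
    then have "Ck_on k S (\<lambda>x. fd (\<lambda>x. f x + g x) x v) = Ck_on k S (\<lambda>x. fd f x v + fd g x v)"
      by (rule Ck_on_cong[OF assms(1)])
    then show ?thesis using Suc by auto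
  qed
  then show ?case using Suc.prems by auto
qed

lemma Ck_on_scaleR:
  assumes "open S" "Ck_on k S f" "Ck_on k S g"
  shows "Ck_on k S (\<lambda>x. f x *\<^sub>R g x)"
  using assms(2,3)
proof (induction k arbitrary: f g)
  case 0
  then show ?case by (simp add: continuous_on_scaleR)
next
  case (Suc k)
  have "Ck_on k S (\<lambda>x. fd (\<lambda>x. f x *\<^sub>R g x) x v)" for v
  proof -
    have "fd (\<lambda>x. f x *\<^sub>R g x) x v = f x *\<^sub>R fd g x v + fd f x v *\<^sub>R g x" if "x \<in> S" for x
      by (rule fd_eqI) (use Suc.prems that in \<open>auto intro!: derivative_intros has_derivative_fd\<close>)
    then have "Ck_on k S (\<lambda>x. fd (\<lambda>x. f x *\<^sub>R g x) x v)
        = Ck_on k S (\<lambda>x. f x *\<^sub>R fd g x v + fd f x v *\<^sub>R g x)"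
      by (rule Ck_on_cong[OF assms(1)])
    moreover have "Ck_on k S f" "Ck_on k S g" using Suc.prems Ck_on_lower by blast+
    ultimately show ?thesis using Suc by (auto intro!: Ck_on_add[OF assms(1)])
  qed
  then show ?case using Suc.prems by (auto intro: derivative_intros)
qed

lemma Ck_on_sum:
  assumes "open S" "finite I" "\<And>i. i \<in> I \<Longrightarrow> Ck_on k S (f i)"
  shows "Ck_on k S (\<lambda>x. \<Sum>i\<in>I. f i x)"
  using assms(2,3)
  by (induction I rule: finite_induct) (auto intro!: Ck_on_const Ck_on_add[OF assms(1)])

lemma Ck_on_inner:
  assumes "open S" "Ck_on k S g"
  shows "Ck_on k S (\<lambda>x. g x \<bullet> i)"
  using assms(2)
proof (induction k arbitrary: g)
  case 0
  then show ?case by (auto intro: continuous_intros)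
next
  case (Suc k)
  have "Ck_on k S (\<lambda>x. fd (\<lambda>x. g x \<bullet> i) x v)" for v
  proof -
    have "fd (\<lambda>x. g x \<bullet> i) x v = fd g x v \<bullet> i" if "x \<in> S" for x
      by (rule fd_eqI) (use Suc.prems that in \<open>auto intro!: derivative_intros has_derivative_fd\<close>)
    then have "Ck_on k S (\<lambda>x. fd (\<lambda>x. g x \<bullet> i) x v) = Ck_on k S (\<lambda>x. fd g x v \<bullet> i)"
      by (rule Ck_on_cong[OF assms(1)])
    then show ?thesis using Suc by auto
  qed
  then show ?case using Suc.prems by (auto intro: derivative_intros)
qed

lemma fd_compose:
  assumes "g differentiable (at x)" "f differentiable (at (g x))"
  shows "fd (f \<circ> g) x v = fd f (g x) (fd g x v)"
  using frechet_derivative_compose[OF assms] by simp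

text \<open>The chain rule is expanded over the basis of the middle space, because \<open>Ck_on\<close> speaks only of
derivatives in constant directions; the induction then needs products and sums only.\<close>

lemma Ck_on_compose:
  assumes "open S" "open T" "Ck_on k T f" "Ck_on k S g" "g ` S \<subseteq> T"
  shows "Ck_on k S (f \<circ> g)"
  using assms(3,4)
proof (induction k arbitrary: f)
  case 0
  then show ?case using assms(5)
    by (metis Ck_on.simps(1) continuous_on_compose continuous_on_subset)
next
  case (Suc k)
  have df: "f differentiable (at (g x))" and dg: "g differentiable (at x)" if "x \<in> S" for x
    using Suc.prems that assms(5) by auto
  have "Ck_on k S (\<lambda>x. fd (f \<circ> g) x v)" for v
  proof -
    have "fd (f \<circ> g) x v = (\<Sum>i\<in>Basis. (fd g x v \<bullet> i) *\<^sub>R ((\<lambda>y. fd f y i) \<circ> g) x)" if "x \<in> S" for x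
    proof -
      have "fd (f \<circ> g) x v = fd f (g x) (\<Sum>i\<in>Basis. (fd g x v \<bullet> i) *\<^sub>R i)"
        using fd_compose[OF dg[OF that] df[OF that]] by (simp add: euclidean_representation)
      also have "\<dots> = (\<Sum>i\<in>Basis. (fd g x v \<bullet> i) *\<^sub>R fd f (g x) i)"
        using linear_fd[OF df[OF that]] by (simp add: linear_sum linear_scale)
      finally show ?thesis by simp
    qed
    then have "Ck_on k S (\<lambda>x. fd (f \<circ> g) x v)
        = Ck_on k S (\<lambda>x. \<Sum>i\<in>Basis. (fd g x v \<bullet> i) *\<^sub>R ((\<lambda>y. fd f y i) \<circ> g) x)"
      by (rule Ck_on_cong[OF assms(1)])
    moreover have "Ck_on k S ((\<lambda>y. fd f y i) \<circ> g)" for i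
      by (rule Suc.IH) (use Suc.prems(1) Ck_on_lower[OF Suc.prems(2)] in simp_all)
    then have "Ck_on k S (\<lambda>x. (fd g x v \<bullet> i) *\<^sub>R ((\<lambda>y. fd f y i) \<circ> g) x)" for i
      using Suc.prems(2) by (intro Ck_on_scaleR[OF assms(1)] Ck_on_inner[OF assms(1)]) (auto simp: comp_def)
    then have "Ck_on k S (\<lambda>x. \<Sum>i\<in>Basis. (fd g x v \<bullet> i) *\<^sub>R ((\<lambda>y. fd f y i) \<circ> g) x)"
      by (intro Ck_on_sum[OF assms(1)]) auto
    ultimately show ?thesis by simp
  qed
  moreover have "(f \<circ> g) differentiable (at x)" if "x \<in> S" for x
    using differentiable_chain_at[OF dg df] that by blast
  ultimately show ?case unfolding Ck_on.simps by blast
qed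

lemma Ck_on_bounded_linear:
  assumes "bounded_linear h"
  shows "Ck_on k S h"
proof (cases k)
  case 0
  then show ?thesis using assms by (simp add: linear_continuous_on)
next
  case (Suc m)
  have "fd h x v = h v" for x v
    by (rule fd_eqI) (rule bounded_linear_imp_has_derivative[OF assms])
  then show ?thesis using Suc bounded_linear_imp_differentiable[OF assms] Ck_on_const by auto
qed

lemma smooth_on_compose:
  assumes "open S" "open T" "smooth_on T f" "smooth_on S g" "g ` S \<subseteq> T"
  shows "smooth_on S (f \<circ> g)"
  using assms Ck_on_compose unfolding smooth_on_def by blast

lemma smooth_on_subset: "smooth_on S f \<Longrightarrow> T \<subseteq> S \<Longrightarrow> smooth_on T f"
  unfolding smooth_on_def using Ck_on_subset by blast

lemma smooth_on_cong:
  assumes "open S" "\<And>y. y \<in> S \<Longrightarrow> f y = g y"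
  shows "smooth_on S f \<longleftrightarrow> smooth_on S g"
  unfolding smooth_on_def using Ck_on_cong[of S f g, OF assms(1)] assms(2) by simp

lemma smooth_on_continuous: "smooth_on S f \<Longrightarrow> continuous_on S f"
  unfolding smooth_on_def by (metis Ck_on.simps(1))

lemma smooth_on_differentiable: "smooth_on S f \<Longrightarrow> x \<in> S \<Longrightarrow> f differentiable (at x)"
  unfolding smooth_on_def by (metis Ck_on.simps(2))

lemma smooth_on_fd: "smooth_on S f \<Longrightarrow> smooth_on S (\<lambda>x. fd f x v)"
  unfolding smooth_on_def by (metis Ck_on.simps(2))

lemma smooth_on_inner: "open S \<Longrightarrow> smooth_on S f \<Longrightarrow> smooth_on S (\<lambda>x. f x \<bullet> i)"
  unfolding smooth_on_def using Ck_on_inner by blast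

lemma smooth_on_bounded_linear: "bounded_linear h \<Longrightarrow> smooth_on S h"
  unfolding smooth_on_def using Ck_on_bounded_linear by blast

lemma smooth_on_slice: "smooth_on S (\<lambda>z. (z, c))"
  unfolding smooth_on_def
proof
  fix k
  have d: "((\<lambda>z. (z, c)) has_derivative (\<lambda>v. (v, 0))) (at z)" for z :: 'a
    by (auto intro!: derivative_eq_intros)
  have "(\<lambda>z. (z, c)) differentiable (at z)" for z :: 'a
    using d unfolding differentiable_def by blast
  moreover have "fd (\<lambda>z. (z, c)) z v = (v, 0)" for z v :: 'a using fd_eqI[OF d] .
  ultimately show "Ck_on k S (\<lambda>z. (z, c))"
    by (cases k) (simp_all only: Ck_on.simps, auto intro: continuous_intros Ck_on_const)
qed

text \<open>The second difference over a small parallelogram is symmetric in \<open>u\<close> and \<open>v\<close>; two applications of the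
mean value theorem turn it into a mixed derivative at an intermediate point.  This is what makes mixed
derivatives commute.\<close>

lemma mixed_difference_mvt:
  fixes f :: "'a::euclidean_space \<Rightarrow> real"
  assumes "smooth_on S f" "h > 0"
    and box: "\<And>s t. 0 \<le> s \<Longrightarrow> s \<le> h \<Longrightarrow> 0 \<le> t \<Longrightarrow> t \<le> h \<Longrightarrow> z + s *\<^sub>R u + t *\<^sub>R v \<in> S"
  shows "\<exists>\<xi> \<eta>. 0 \<le> \<xi> \<and> \<xi> \<le> h \<and> 0 \<le> \<eta> \<and> \<eta> \<le> h \<and>
    f (z + h *\<^sub>R u + h *\<^sub>R v) - f (z + h *\<^sub>R u) - f (z + h *\<^sub>R v) + f z
      = h * h * fd (\<lambda>y. fd f y u) (z + \<xi> *\<^sub>R u + \<eta> *\<^sub>R v) v"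
proof -
  have D: "((\<lambda>s. g (a + s *\<^sub>R b)) has_real_derivative fd g (a + s *\<^sub>R b) b) (at s)"
    if "smooth_on S g" "a + s *\<^sub>R b \<in> S" for g :: "'a \<Rightarrow> real" and a b s
  proof -
    have g: "(g has_derivative fd g (a + s *\<^sub>R b)) (at (a + s *\<^sub>R b))"
      using smooth_on_differentiable[OF that] by (rule has_derivative_fd)
    have "((\<lambda>s. a + s *\<^sub>R b) has_derivative (\<lambda>t. t *\<^sub>R b)) (at s)"
      by (auto intro!: derivative_eq_intros)
    from has_derivative_compose[OF this g]
    have "((\<lambda>s. g (a + s *\<^sub>R b)) has_derivative (\<lambda>t. fd g (a + s *\<^sub>R b) (t *\<^sub>R b))) (at s)" .
    moreover have "fd g (a + s *\<^sub>R b) (t *\<^sub>R b) = fd g (a + s *\<^sub>R b) b * t" for t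
      using linear_fd[OF smooth_on_differentiable[OF that]] by (simp add: linear_scale)
    ultimately show ?thesis by (simp add: has_field_derivative_def)
  qed
  let ?g = "\<lambda>s. f (z + h *\<^sub>R v + s *\<^sub>R u) - f (z + s *\<^sub>R u)"
  have "\<exists>\<xi>>0. \<xi> < h \<and> ?g h - ?g 0 = (h - 0) * (fd f (z + h *\<^sub>R v + \<xi> *\<^sub>R u) u - fd f (z + \<xi> *\<^sub>R u) u)"
  proof (rule MVT2[OF assms(2)])
    fix s :: real assume "0 \<le> s" "s \<le> h"
    then show "(?g has_real_derivative
        (fd f (z + h *\<^sub>R v + s *\<^sub>R u) u - fd f (z + s *\<^sub>R u) u)) (at s)"
      using box[of s 0] box[of s h] assms(2)
      by (intro DERIV_diff D assms(1)) (auto simp: algebra_simps)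
  qed
  then obtain \<xi> where \<xi>: "0 < \<xi>" "\<xi> < h"
    "?g h - ?g 0 = h * (fd f (z + h *\<^sub>R v + \<xi> *\<^sub>R u) u - fd f (z + \<xi> *\<^sub>R u) u)" by auto
  let ?k = "\<lambda>t. fd f (z + \<xi> *\<^sub>R u + t *\<^sub>R v) u"
  have "\<exists>\<eta>>0. \<eta> < h \<and> ?k h - ?k 0 = (h - 0) * fd (\<lambda>y. fd f y u) (z + \<xi> *\<^sub>R u + \<eta> *\<^sub>R v) v"
  proof (rule MVT2[OF assms(2)])
    fix t :: real assume "0 \<le> t" "t \<le> h"
    then show "(?k has_real_derivative fd (\<lambda>y. fd f y u) (z + \<xi> *\<^sub>R u + t *\<^sub>R v) v) (at t)"
      using box[of \<xi> t] \<xi> by (intro D smooth_on_fd assms(1)) auto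
  qed
  then obtain \<eta> where "0 < \<eta>" "\<eta> < h"
    "?k h - ?k 0 = h * fd (\<lambda>y. fd f y u) (z + \<xi> *\<^sub>R u + \<eta> *\<^sub>R v) v" by auto
  then show ?thesis using \<xi>
    by (intro exI[of _ \<xi>] exI[of _ \<eta>]) (auto simp: algebra_simps)
qed

text \<open>If the two mixed derivatives differed at \<open>z\<close>, then by continuity the sets of their values on a
small parallelogram would be disjoint, whereas both represent the same second difference.\<close>

lemma mixed_derivatives_commute_real:
  fixes f :: "'a::euclidean_space \<Rightarrow> real"
  assumes "open S" "smooth_on S f" "z \<in> S"
  shows "fd (\<lambda>y. fd f y u) z v = fd (\<lambda>y. fd f y v) z u"
proof (rule ccontr)
  let ?A = "\<lambda>x. fd (\<lambda>y. fd f y u) x v" and ?B = "\<lambda>x. fd (\<lambda>y. fd f y v) x u"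
  assume ne: "?A z \<noteq> ?B z"
  let ?e = "\<bar>?A z - ?B z\<bar> / 2"
  have e: "?e > 0" using ne by simp
  have "continuous_on S ?A" "continuous_on S ?B"
    using assms(2) smooth_on_continuous smooth_on_fd by blast+
  then have "isCont ?A z" "isCont ?B z" using assms continuous_on_eq_continuous_at by blast+
  then obtain d1 d2 where d: "d1 > 0" "d2 > 0"
    "\<And>y. dist y z < d1 \<Longrightarrow> dist (?A y) (?A z) < ?e" "\<And>y. dist y z < d2 \<Longrightarrow> dist (?B y) (?B z) < ?e"
    using e unfolding continuous_at_eps_delta by metis
  obtain d3 where d3: "d3 > 0" "\<And>y. dist y z < d3 \<Longrightarrow> y \<in> S"
    using assms(1,3) by (metis open_dist)
  define d where "d = min d1 (min d2 d3)"
  define N where "N = norm u + norm v + 1"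
  define h where "h = d / (2 * N)"
  have N: "N > 0" unfolding N_def by (smt (verit) norm_ge_zero)
  have dp: "d > 0" using d d3 by (simp add: d_def)
  then have h: "h > 0" using N by (simp add: h_def)
  have small: "dist (z + s *\<^sub>R u + t *\<^sub>R v) z < d" if "0 \<le> s" "s \<le> h" "0 \<le> t" "t \<le> h" for s t
  proof -
    have "dist (z + s *\<^sub>R u + t *\<^sub>R v) z = norm (s *\<^sub>R u + t *\<^sub>R v)" by (simp add: dist_norm add.assoc)
    also have "\<dots> \<le> s * norm u + t * norm v"
      using norm_triangle_ineq[of "s *\<^sub>R u" "t *\<^sub>R v"] that by simp
    also have "\<dots> \<le> h * norm u + h * norm v" using that by (intro add_mono mult_right_mono) auto
    also have "\<dots> \<le> h * N" using h by (simp add: N_def algebra_simps)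
    also have "\<dots> = d / 2" using N by (simp add: h_def)
    finally show ?thesis using dp by simp
  qed
  have box: "z + s *\<^sub>R u + t *\<^sub>R v \<in> S" if "0 \<le> s" "s \<le> h" "0 \<le> t" "t \<le> h" for s t
    using small[OF that] d3(2) by (simp add: d_def)
  have box': "z + s *\<^sub>R v + t *\<^sub>R u \<in> S" if "0 \<le> s" "s \<le> h" "0 \<le> t" "t \<le> h" for s t
    using box[OF that(3,4) that(1,2)] by (simp add: algebra_simps)
  obtain p q where pq: "0 \<le> p" "p \<le> h" "0 \<le> q" "q \<le> h"
    "f (z + h *\<^sub>R u + h *\<^sub>R v) - f (z + h *\<^sub>R u) - f (z + h *\<^sub>R v) + f z
      = h * h * ?A (z + p *\<^sub>R u + q *\<^sub>R v)"
    using mixed_difference_mvt[OF assms(2) h box] by blast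
  obtain p' q' where pq': "0 \<le> p'" "p' \<le> h" "0 \<le> q'" "q' \<le> h"
    "f (z + h *\<^sub>R v + h *\<^sub>R u) - f (z + h *\<^sub>R v) - f (z + h *\<^sub>R u) + f z
      = h * h * ?B (z + p' *\<^sub>R v + q' *\<^sub>R u)"
    using mixed_difference_mvt[OF assms(2) h box'] by blast
  have "z + h *\<^sub>R v + h *\<^sub>R u = z + h *\<^sub>R u + h *\<^sub>R v" by (simp add: algebra_simps)
  then have "h * h * ?A (z + p *\<^sub>R u + q *\<^sub>R v) = h * h * ?B (z + p' *\<^sub>R v + q' *\<^sub>R u)"
    using pq(5) pq'(5) by (simp only:)
  then have "?A (z + p *\<^sub>R u + q *\<^sub>R v) = ?B (z + p' *\<^sub>R v + q' *\<^sub>R u)"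
    using h by simp
  moreover have "dist (z + p *\<^sub>R u + q *\<^sub>R v) z < d1" using small[OF pq(1-4)] by (simp add: d_def)
  moreover have "dist (z + p' *\<^sub>R v + q' *\<^sub>R u) z < d2"
    using small[OF pq'(3,4,1,2)] by (simp add: d_def algebra_simps)
  ultimately have "\<bar>?B (z + p' *\<^sub>R v + q' *\<^sub>R u) - ?A z\<bar> < ?e" "\<bar>?B (z + p' *\<^sub>R v + q' *\<^sub>R u) - ?B z\<bar> < ?e"
    using d(3)[of "z + p *\<^sub>R u + q *\<^sub>R v"] d(4)[of "z + p' *\<^sub>R v + q' *\<^sub>R u"]
    unfolding dist_real_def by simp_all
  moreover have False if "\<bar>b - A\<bar> < \<bar>A - B\<bar> / 2" "\<bar>b - B\<bar> < \<bar>A - B\<bar> / 2" for A B b :: real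
    using that by (auto simp: abs_if split: if_splits)
  ultimately show False by blast
qed

lemma mixed_derivatives_commute:
  fixes f :: "'a::euclidean_space \<Rightarrow> 'b::euclidean_space"
  assumes "open S" "smooth_on S f" "z \<in> S"
  shows "fd (\<lambda>y. fd f y u) z v = fd (\<lambda>y. fd f y v) z u"
proof (rule euclidean_eqI)
  fix i :: 'b assume "i \<in> Basis"
  have D: "fd (\<lambda>y. g y \<bullet> i) x w = fd g x w \<bullet> i" if "smooth_on S g" "x \<in> S" for g :: "'a \<Rightarrow> 'b" and x w
    by (rule fd_eqI) (use smooth_on_differentiable[OF that] in \<open>auto intro!: derivative_intros has_derivative_fd\<close>)
  have "fd (\<lambda>y. fd f y a) z b \<bullet> i = fd (\<lambda>y. fd (\<lambda>y. f y \<bullet> i) y a) z b" for a b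
  proof -
    have "fd (\<lambda>y. fd f y a) z b \<bullet> i = fd (\<lambda>y. fd f y a \<bullet> i) z b"
      using D[OF smooth_on_fd[OF assms(2)] assms(3)] by simp
    also have "\<dots> = fd (\<lambda>y. fd (\<lambda>y. f y \<bullet> i) y a) z b"
      by (rule fd_cong_open[OF assms(1,3)]) (simp add: D[OF assms(2)])
    finally show ?thesis .
  qed
  then show "fd (\<lambda>y. fd f y u) z v \<bullet> i = fd (\<lambda>y. fd f y v) z u \<bullet> i"
    using mixed_derivatives_commute_real[OF assms(1) smooth_on_inner[OF assms(1,2)] assms(3)] by simp
qed

section \<open>Charts, tangent vectors and pull-backs\<close>

lemma chart_inv_left:
  assumes "inj_on (snd \<kappa>) (fst \<kappa>)" "y \<in> fst \<kappa>"
  shows "chart_inv \<kappa> (snd \<kappa> y) = y"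
  using assms by (simp add: chart_inv_def)

lemma chart_inv_right:
  assumes "z \<in> snd \<kappa> ` fst \<kappa>"
  shows "chart_inv \<kappa> z \<in> fst \<kappa>" "snd \<kappa> (chart_inv \<kappa> z) = z"
  using assms by (auto simp: chart_inv_def inv_into_into f_inv_into_f)

lemma manifold_chart:
  assumes "smooth_manifold N" "\<kappa> \<in> atlas N"
  shows "inj_on (snd \<kappa>) (fst \<kappa>)" "open (snd \<kappa> ` fst \<kappa>)" "fst \<kappa> \<subseteq> pts N"
  using assms unfolding smooth_manifold_def by auto

lemma manifold_transition:
  assumes "smooth_manifold N" "\<kappa> \<in> atlas N" "\<mu> \<in> atlas N"
  shows "open (snd \<kappa> ` (fst \<kappa> \<inter> fst \<mu>))"
    "smooth_on (snd \<kappa> ` (fst \<kappa> \<inter> fst \<mu>)) (snd \<mu> \<circ> chart_inv \<kappa>)"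
  using assms unfolding smooth_manifold_def by auto

lemma manifold_chart_exists:
  assumes "smooth_manifold N" "x \<in> pts N"
  obtains \<kappa> where "\<kappa> \<in> atlas N" "x \<in> fst \<kappa>"
  using assms unfolding smooth_manifold_def by auto

lemma open_in_chart_domain:
  assumes "smooth_manifold N" "\<kappa> \<in> atlas N"
  shows "open_in N (fst \<kappa>)"
  using manifold_chart[OF assms] manifold_transition(1)[OF assms(1) _ assms(2)]
  unfolding open_in_def by (auto simp: Int_commute)

lemma smooth_near_differentiable:
  assumes "smooth_near N x f" "\<kappa> \<in> atlas N" "x \<in> fst \<kappa>"
  shows "(f \<circ> chart_inv \<kappa>) differentiable (at (snd \<kappa> x))"
proof -
  obtain S where "x \<in> S" "smooth_on (snd \<kappa> ` (S \<inter> fst \<kappa>)) (f \<circ> chart_inv \<kappa>)"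
    using assms unfolding smooth_near_def smooth_fun_on_def by blast
  then show ?thesis using assms(3) by (intro smooth_on_differentiable) auto
qed

lemma tvec_tlin:
  assumes "\<kappa> \<in> atlas N" "x \<in> fst \<kappa>"
  shows "tvec N \<kappa> x (a *\<^sub>R v + b *\<^sub>R w) = tlin a (tvec N \<kappa> x v) b (tvec N \<kappa> x w)"
proof
  fix f
  show "tvec N \<kappa> x (a *\<^sub>R v + b *\<^sub>R w) f = tlin a (tvec N \<kappa> x v) b (tvec N \<kappa> x w) f"
  proof (cases "smooth_near N x f")
    case True
    from linear_fd[OF smooth_near_differentiable[OF True assms]] True show ?thesis
      by (simp add: tvec_def tlin_def linear_add linear_scale)
  qed (simp add: tvec_def tlin_def)
qed

lemma tvec_in_tangent:
  assumes "\<kappa> \<in> atlas N" "x \<in> fst \<kappa>"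
  shows "tvec N \<kappa> x v \<in> tangent N x"
  using assms unfolding tangent_def by blast

lemma covector_linear_tvec:
  assumes "\<alpha> \<in> covectors N x" "\<kappa> \<in> atlas N" "x \<in> fst \<kappa>"
  shows "linear (\<lambda>v. \<alpha> (tvec N \<kappa> x v))"
proof -
  have *: "\<alpha> (tvec N \<kappa> x (a *\<^sub>R v + b *\<^sub>R w)) = a *\<^sub>R \<alpha> (tvec N \<kappa> x v) + b *\<^sub>R \<alpha> (tvec N \<kappa> x w)" for a b v w
    using assms(1) tvec_in_tangent[OF assms(2,3)]
    by (simp add: covectors_def tvec_tlin[OF assms(2,3)] scaleR_conv_of_real)
  show ?thesis
    by (rule linearI) (use *[of 1 _ 1 _] *[of _ _ 0 0] in auto)
qed

lemma push_tlin: "push P f x (tlin a V b W) = tlin a (push P f x V) b (push P f x W)"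
  by (auto simp: push_def tlin_def)

lemma sum_euclidean_linear:
  fixes h :: "'a::euclidean_space \<Rightarrow> 'b::real_vector"
  assumes "linear h"
  shows "h v = (\<Sum>i\<in>Basis. (v \<bullet> i) *\<^sub>R h i)"
proof -
  have "h v = h (\<Sum>i\<in>Basis. (v \<bullet> i) *\<^sub>R i)" by (simp add: euclidean_representation)
  also have "\<dots> = (\<Sum>i\<in>Basis. (v \<bullet> i) *\<^sub>R h i)" using assms by (simp add: linear_sum linear_scale)
  finally show ?thesis .
qed

text \<open>\<open>F\<close> is the expression of \<open>f\<close> in the charts \<open>\<kappa>\<close> and \<open>K\<close> over the open set \<open>Z\<close> of coordinates.\<close>

definition represents ::
    "('p, 'v::euclidean_space) chart \<Rightarrow> ('q, 'w::euclidean_space) chart \<Rightarrow> ('p \<Rightarrow> 'q) \<Rightarrow>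
     'v set \<Rightarrow> ('v \<Rightarrow> 'w) \<Rightarrow> bool" where
  "represents \<kappa> K f Z F \<longleftrightarrow> open Z \<and> Z \<subseteq> snd \<kappa> ` fst \<kappa> \<and> smooth_on Z F \<and>
     (\<forall>z\<in>Z. f (chart_inv \<kappa> z) \<in> fst K \<and> snd K (f (chart_inv \<kappa> z)) = F z)"

text \<open>The source has to be a manifold, since smoothness near a point is tested in all charts of the source.
Of the target only the one chart \<open>K\<close> enters, so that the maps into X and Y can be treated directly through
their trivialisations.\<close>

locale local_representation =
  fixes N :: "('p, 'v::euclidean_space) mfd" and P :: "('q, 'w::euclidean_space) mfd"
    and \<kappa> K f Z F
  assumes N: "smooth_manifold N" and \<kappa>: "\<kappa> \<in> atlas N" and K: "K \<in> atlas P"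
    and K_inj: "inj_on (snd K) (fst K)"
    and rep: "represents \<kappa> K f Z F"
begin

lemma Z: "open Z" "Z \<subseteq> snd \<kappa> ` fst \<kappa>" "smooth_on Z F"
  and Zf: "\<And>z. z \<in> Z \<Longrightarrow> f (chart_inv \<kappa> z) \<in> fst K"
  and ZF: "\<And>z. z \<in> Z \<Longrightarrow> chart_inv K (F z) = f (chart_inv \<kappa> z)"
proof -
  show "open Z" "Z \<subseteq> snd \<kappa> ` fst \<kappa>" "smooth_on Z F"
    "\<And>z. z \<in> Z \<Longrightarrow> f (chart_inv \<kappa> z) \<in> fst K"
    using rep unfolding represents_def by blast+
  fix z assume "z \<in> Z"
  then have "f (chart_inv \<kappa> z) \<in> fst K" "snd K (f (chart_inv \<kappa> z)) = F z"
    using rep unfolding represents_def by blast+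
  then show "chart_inv K (F z) = f (chart_inv \<kappa> z)" using chart_inv_left[OF K_inj] by metis
qed

lemma \<kappa>_inv: "y \<in> fst \<kappa> \<Longrightarrow> chart_inv \<kappa> (snd \<kappa> y) = y"
  by (rule chart_inv_left[OF manifold_chart(1)[OF N \<kappa>]])

lemma f_mem: assumes "x \<in> fst \<kappa>" "snd \<kappa> x \<in> Z" shows "f x \<in> fst K" "snd K (f x) = F (snd \<kappa> x)"
  using assms rep \<kappa>_inv unfolding represents_def by metis+

text \<open>In another chart of the source the composite is obtained by a transition function of the source,
followed by \<open>F\<close> and the expression of \<open>g\<close> in \<open>K\<close>.\<close>

lemma smooth_near_compose:
  assumes x: "x \<in> fst \<kappa>" "snd \<kappa> x \<in> Z" and g: "smooth_near P (f x) g"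
  shows "smooth_near N x (g \<circ> f)"
proof -
  obtain T where T: "open_in P T" "f x \<in> T" "smooth_fun_on P T g"
    using g unfolding smooth_near_def by blast
  define O1 where "O1 = snd K ` (T \<inter> fst K)"
  have O1: "open O1" "smooth_on O1 (g \<circ> chart_inv K)"
    using T K unfolding O1_def open_in_def smooth_fun_on_def by blast+
  define Z' where "Z' = Z \<inter> F -` O1"
  have Z': "open Z'" "Z' \<subseteq> Z"
    using continuous_open_preimage[OF smooth_on_continuous[OF Z(3)] Z(1) O1(1)]
    unfolding Z'_def by auto
  define S where "S = chart_inv \<kappa> ` Z'"
  have S: "S \<subseteq> fst \<kappa>"
    unfolding S_def
  proof (rule image_subsetI)
    fix z assume "z \<in> Z'"
    then show "chart_inv \<kappa> z \<in> fst \<kappa>" using Z(2) Z'(2) by (intro chart_inv_right(1)) auto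
  qed
  have xS: "x \<in> S"
  proof -
    have "F (snd \<kappa> x) \<in> O1" unfolding O1_def using f_mem[OF x] T(2) by (metis IntI image_eqI)
    then have "snd \<kappa> x \<in> Z'" using x unfolding Z'_def by auto
    then show ?thesis unfolding S_def using \<kappa>_inv[OF x(1)] by (metis image_eqI)
  qed
  have S_iff: "y \<in> S \<longleftrightarrow> snd \<kappa> y \<in> Z'" if "y \<in> fst \<kappa>" for y
  proof
    assume "y \<in> S"
    then obtain z where z: "z \<in> Z'" "y = chart_inv \<kappa> z" unfolding S_def by auto
    then have "z \<in> snd \<kappa> ` fst \<kappa>" using Z(2) Z'(2) by auto
    from chart_inv_right(2)[OF this] z show "snd \<kappa> y \<in> Z'" by simp
  next
    assume "snd \<kappa> y \<in> Z'"
    then show "y \<in> S" unfolding S_def using \<kappa>_inv[OF that] by (metis image_eqI)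
  qed
  have *: "open (snd \<mu> ` (S \<inter> fst \<mu>)) \<and> smooth_on (snd \<mu> ` (S \<inter> fst \<mu>)) (g \<circ> f \<circ> chart_inv \<mu>)"
    if \<mu>: "\<mu> \<in> atlas N" for \<mu>
  proof -
    define A where "A = snd \<mu> ` (fst \<mu> \<inter> fst \<kappa>)"
    define t where "t = snd \<kappa> \<circ> chart_inv \<mu>"
    have A: "open A" "smooth_on A t" unfolding A_def t_def using manifold_transition[OF N \<mu> \<kappa>] by auto
    have inv: "chart_inv \<mu> (snd \<mu> y) = y" if "y \<in> fst \<mu>" for y
      by (rule chart_inv_left[OF manifold_chart(1)[OF N \<mu>] that])
    have B: "snd \<mu> ` (S \<inter> fst \<mu>) = A \<inter> t -` Z'"
    proof (intro set_eqI iffI)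
      fix z assume "z \<in> snd \<mu> ` (S \<inter> fst \<mu>)"
      then show "z \<in> A \<inter> t -` Z'" using S S_iff inv unfolding A_def t_def by auto
    next
      fix z assume z: "z \<in> A \<inter> t -` Z'"
      then obtain y where "y \<in> fst \<mu>" "y \<in> fst \<kappa>" "z = snd \<mu> y" unfolding A_def by auto
      then show "z \<in> snd \<mu> ` (S \<inter> fst \<mu>)" using z S_iff[of y] inv unfolding t_def by auto
    qed
    have op: "open (A \<inter> t -` Z')"
      using continuous_open_preimage[OF smooth_on_continuous[OF A(2)] A(1) Z'(1)] .
    have "smooth_on (A \<inter> t -` Z') ((g \<circ> chart_inv K) \<circ> (F \<circ> t))"
    proof (rule smooth_on_compose[OF op O1])
      show "smooth_on (A \<inter> t -` Z') (F \<circ> t)"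
        by (rule smooth_on_compose[OF op Z'(1)])
          (use smooth_on_subset[OF Z(3) Z'(2)] smooth_on_subset[OF A(2)] in auto)
      show "(F \<circ> t) ` (A \<inter> t -` Z') \<subseteq> O1" unfolding Z'_def by auto
    qed
    also have "?this = smooth_on (A \<inter> t -` Z') (g \<circ> f \<circ> chart_inv \<mu>)"
    proof (rule smooth_on_cong[OF op])
      fix z assume z: "z \<in> A \<inter> t -` Z'"
      then obtain y where y: "y \<in> fst \<mu>" "y \<in> fst \<kappa>" "z = snd \<mu> y" unfolding A_def by auto
      then have "t z = snd \<kappa> y" "chart_inv \<mu> z = y" by (simp_all add: t_def inv)
      moreover have "snd \<kappa> y \<in> Z" using z Z'(2) calculation by auto
      ultimately show "((g \<circ> chart_inv K) \<circ> (F \<circ> t)) z = (g \<circ> f \<circ> chart_inv \<mu>) z"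
        using ZF[of "snd \<kappa> y"] \<kappa>_inv[OF y(2)] by simp
    qed
    finally show ?thesis unfolding B using op by blast
  qed
  have "open_in N S" using S manifold_chart(3)[OF N \<kappa>] * unfolding open_in_def by blast
  moreover have "smooth_fun_on N S (g \<circ> f)" using * unfolding smooth_fun_on_def by blast
  ultimately show ?thesis using xS unfolding smooth_near_def by blast
qed

lemma push_tvec:
  assumes x: "x \<in> fst \<kappa>" "snd \<kappa> x \<in> Z"
  shows "push P f x (tvec N \<kappa> x v) = tvec P K (f x) (fd F (snd \<kappa> x) v)"
proof
  fix g
  show "push P f x (tvec N \<kappa> x v) g = tvec P K (f x) (fd F (snd \<kappa> x) v) g"
  proof (cases "smooth_near P (f x) g")
    case True
    have "fd (g \<circ> f \<circ> chart_inv \<kappa>) (snd \<kappa> x) v = fd ((g \<circ> chart_inv K) \<circ> F) (snd \<kappa> x) v"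
      by (rule fd_cong_open[OF Z(1) x(2)]) (simp add: ZF)
    also have "\<dots> = fd (g \<circ> chart_inv K) (F (snd \<kappa> x)) (fd F (snd \<kappa> x) v)"
      using smooth_near_differentiable[OF True K f_mem(1)[OF x]] f_mem(2)[OF x]
      by (intro fd_compose smooth_on_differentiable[OF Z(3) x(2)]) simp
    finally show ?thesis using True smooth_near_compose[OF x True] f_mem(2)[OF x]
      by (simp add: push_def tvec_def)
  qed (simp add: push_def tvec_def)
qed

text \<open>Naturality of the exterior derivative.  In coordinates the pull-back of \<open>\<eta>\<close> has the coefficient
\<open>\<Sum>i. (dF(v))\<^sub>i \<eta>\<^sub>i(F z)\<close> in the direction \<open>v\<close>.  The product rule gives \<open>d\<eta>\<close> on the images of the two vectors, and a
term with second derivatives of \<open>F\<close> that vanishes after antisymmetrisation.\<close>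

lemma pullback_ext_deriv:
  assumes x: "x \<in> fst \<kappa>" "snd \<kappa> x \<in> Z"
    and K_open: "open (snd K ` fst K)"
    and lin: "\<And>q. q \<in> fst K \<Longrightarrow> linear (\<lambda>w. \<eta> q (tvec P K q w))"
    and d: "has_ext_deriv P \<eta> (f x) \<zeta>"
  shows "local_form N \<kappa> (pullback N P f \<eta>) v differentiable (at (snd \<kappa> x))"
    "fd (local_form N \<kappa> (pullback N P f \<eta>) w) (snd \<kappa> x) v
       - fd (local_form N \<kappa> (pullback N P f \<eta>) v) (snd \<kappa> x) w
     = \<zeta> (push P f x (tvec N \<kappa> x v)) (push P f x (tvec N \<kappa> x w))"
proof -
  define L where "L = local_form P K \<eta>"
  define z where "z = snd \<kappa> x"
  define D2 where "D2 a b = fd (\<lambda>y. fd F y a) z b" for a b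
  have zZ: "z \<in> Z" and Fz: "F z = snd K (f x)" "f x \<in> fst K" using x f_mem[OF x] by (auto simp: z_def)
  have dL: "L a differentiable (at (F z))" for a
    using d K Fz unfolding has_ext_deriv_def L_def by auto
  have eq: "fd (L b) (F z) a - fd (L a) (F z) b = \<zeta> (tvec P K (f x) a) (tvec P K (f x) b)" for a b
    using d K Fz unfolding has_ext_deriv_def L_def by auto
  have Lsum: "L a z' = (\<Sum>i\<in>Basis. (a \<bullet> i) *\<^sub>R L i z')" if "z' \<in> snd K ` fst K" for a z'
    unfolding L_def local_form_def
    by (rule sum_euclidean_linear[OF lin]) (rule chart_inv_right(1)[OF that])
  have fdL: "fd (L a) (F z) b = (\<Sum>i\<in>Basis. (a \<bullet> i) *\<^sub>R fd (L i) (F z) b)" for a b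
  proof -
    have "fd (L a) (F z) b = fd (\<lambda>z'. \<Sum>i\<in>Basis. (a \<bullet> i) *\<^sub>R L i z') (F z) b"
      by (rule fd_cong_open[OF K_open]) (use Fz Lsum in auto)
    also have "\<dots> = (\<Sum>i\<in>Basis. (a \<bullet> i) *\<^sub>R fd (L i) (F z) b)"
      by (rule fd_eqI) (intro derivative_intros has_derivative_fd dL)
    finally show ?thesis .
  qed
  have pb: "local_form N \<kappa> (pullback N P f \<eta>) a z' = (\<Sum>i\<in>Basis. (fd F z' a \<bullet> i) *\<^sub>R L i (F z'))"
    if "z' \<in> Z" for a z'
  proof -
    define y where "y = chart_inv \<kappa> z'"
    have y: "y \<in> fst \<kappa>" "snd \<kappa> y = z'" using chart_inv_right[of z' \<kappa>] Z(2) that unfolding y_def by auto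
    then have yZ: "snd \<kappa> y \<in> Z" using that by simp
    have "local_form N \<kappa> (pullback N P f \<eta>) a z' = \<eta> (f y) (push P f y (tvec N \<kappa> y a))"
      unfolding local_form_def pullback_def lift_def y_def[symmetric]
      using tvec_in_tangent[OF \<kappa> y(1)] by simp
    also have "\<dots> = \<eta> (f y) (tvec P K (f y) (fd F z' a))"
      using push_tvec[OF y(1) yZ] y(2) by simp
    also have "\<dots> = L (fd F z' a) (F z')"
      using ZF[OF that] unfolding L_def local_form_def y_def by simp
    also have "\<dots> = (\<Sum>i\<in>Basis. (fd F z' a \<bullet> i) *\<^sub>R L i (F z'))"
      using f_mem[OF y(1) yZ] y(2) by (intro Lsum) (metis image_eqI)
    finally show ?thesis .
  qed
  have F: "(F has_derivative fd F z) (at z)"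
    using smooth_on_differentiable[OF Z(3) zZ] by (rule has_derivative_fd)
  have D: "((\<lambda>z'. \<Sum>i\<in>Basis. (fd F z' a \<bullet> i) *\<^sub>R L i (F z')) has_derivative
     (\<lambda>b. \<Sum>i\<in>Basis. (fd F z a \<bullet> i) *\<^sub>R fd (L i) (F z) (fd F z b) + (D2 a b \<bullet> i) *\<^sub>R L i (F z))) (at z)" for a
  proof -
    have "((\<lambda>z'. fd F z' a) has_derivative D2 a) (at z)"
      unfolding D2_def using smooth_on_differentiable[OF smooth_on_fd[OF Z(3)] zZ] by (rule has_derivative_fd)
    moreover have "((\<lambda>z'. L i (F z')) has_derivative (\<lambda>b. fd (L i) (F z) (fd F z b))) (at z)" for i
      using has_derivative_compose[OF F has_derivative_fd[OF dL]] .
    ultimately show ?thesis by (intro derivative_intros)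
  qed
  have D': "(local_form N \<kappa> (pullback N P f \<eta>) a has_derivative
     (\<lambda>b. \<Sum>i\<in>Basis. (fd F z a \<bullet> i) *\<^sub>R fd (L i) (F z) (fd F z b) + (D2 a b \<bullet> i) *\<^sub>R L i (F z))) (at z)" for a
    by (rule has_derivative_transform_within_open[OF D Z(1) zZ]) (simp add: pb)
  then show "local_form N \<kappa> (pullback N P f \<eta>) v differentiable (at (snd \<kappa> x))"
    unfolding z_def differentiable_def by blast
  have D2: "D2 a b = D2 b a" for a b
    unfolding D2_def by (rule mixed_derivatives_commute[OF Z(1,3) zZ])
  have "fd (local_form N \<kappa> (pullback N P f \<eta>) a) z b
    = fd (L (fd F z a)) (F z) (fd F z b) + (\<Sum>i\<in>Basis. (D2 a b \<bullet> i) *\<^sub>R L i (F z))" for a b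
    unfolding fd_eqI[OF D'] fdL[of "fd F z a"] sum.distrib ..
  then have "fd (local_form N \<kappa> (pullback N P f \<eta>) w) z v - fd (local_form N \<kappa> (pullback N P f \<eta>) v) z w
    = fd (L (fd F z w)) (F z) (fd F z v) - fd (L (fd F z v)) (F z) (fd F z w)"
    by (simp add: D2[of v w])
  also have "\<dots> = \<zeta> (push P f x (tvec N \<kappa> x v)) (push P f x (tvec N \<kappa> x w))"
    unfolding push_tvec[OF x] z_def[symmetric] by (rule eq)
  finally show "fd (local_form N \<kappa> (pullback N P f \<eta>) w) (snd \<kappa> x) v
       - fd (local_form N \<kappa> (pullback N P f \<eta>) v) (snd \<kappa> x) w
     = \<zeta> (push P f x (tvec N \<kappa> x v)) (push P f x (tvec N \<kappa> x w))" by (simp add: z_def)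
qed

end

lemma push_id_tvec:
  "push N id x (tvec N \<kappa> x v) = tvec N \<kappa> x v"
  by (auto simp: push_def tvec_def)

lemma tvec_change_chart:
  assumes "smooth_manifold N" "\<kappa> \<in> atlas N" "\<mu> \<in> atlas N" "x \<in> fst \<kappa>" "x \<in> fst \<mu>"
  shows "tvec N \<kappa> x v = tvec N \<mu> x (fd (snd \<mu> \<circ> chart_inv \<kappa>) (snd \<kappa> x) v)"
proof -
  interpret local_representation N N \<kappa> \<mu> id "snd \<kappa> ` (fst \<kappa> \<inter> fst \<mu>)" "snd \<mu> \<circ> chart_inv \<kappa>"
  proof
    show "represents \<kappa> \<mu> id (snd \<kappa> ` (fst \<kappa> \<inter> fst \<mu>)) (snd \<mu> \<circ> chart_inv \<kappa>)"
      using manifold_transition[OF assms(1-3)] chart_inv_left[OF manifold_chart(1)[OF assms(1,2)]]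
      unfolding represents_def by auto
  qed (use assms manifold_chart(1)[OF assms(1,3)] in auto)
  show ?thesis using push_tvec[of x v] assms(4,5) by (simp add: push_id_tvec)
qed

lemma tangent_eq_range:
  assumes "smooth_manifold N" "\<kappa> \<in> atlas N" "x \<in> fst \<kappa>"
  shows "tangent N x = range (tvec N \<kappa> x)"
proof
  show "tangent N x \<subseteq> range (tvec N \<kappa> x)"
    using tvec_change_chart[OF assms(1) _ assms(2) _ assms(3)] unfolding tangent_def by auto
qed (use tvec_in_tangent[OF assms(2,3)] in auto)

lemma tlin_in_tangent:
  assumes "smooth_manifold N" "x \<in> pts N" "V \<in> tangent N x" "W \<in> tangent N x"
  shows "tlin a V b W \<in> tangent N x"
proof -
  obtain \<kappa> where \<kappa>: "\<kappa> \<in> atlas N" "x \<in> fst \<kappa>" using manifold_chart_exists[OF assms(1,2)] .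
  show ?thesis using assms(3,4) unfolding tangent_eq_range[OF assms(1) \<kappa>]
    by (auto simp: tvec_tlin[OF \<kappa>, symmetric])
qed

section \<open>Coframes adapted to a flag structure\<close>

lemma cov_ext_cscale:
  assumes "\<alpha> \<in> covectors N x" "Z \<in> ctangent N x"
  shows "cov_ext \<alpha> (cscale z Z) = z * cov_ext \<alpha> Z"
proof -
  have "\<alpha> (tlin a (fst Z) b (snd Z)) = of_real a * \<alpha> (fst Z) + of_real b * \<alpha> (snd Z)"
    "\<alpha> (tlin a (snd Z) b (fst Z)) = of_real a * \<alpha> (snd Z) + of_real b * \<alpha> (fst Z)" for a b
    using assms unfolding covectors_def ctangent_def by auto
  then show ?thesis by (simp add: cov_ext_def cscale_def complex_eq_iff algebra_simps)
qed

lemma cov_ext_cadd: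
  assumes "\<alpha> \<in> covectors N x" "Z \<in> ctangent N x" "Z' \<in> ctangent N x"
  shows "cov_ext \<alpha> (cadd Z Z') = cov_ext \<alpha> Z + cov_ext \<alpha> Z'"
proof -
  have "\<alpha> (tlin 1 (fst Z) 1 (fst Z')) = \<alpha> (fst Z) + \<alpha> (fst Z')"
    "\<alpha> (tlin 1 (snd Z) 1 (snd Z')) = \<alpha> (snd Z) + \<alpha> (snd Z')"
    using assms unfolding covectors_def ctangent_def by auto
  then show ?thesis by (simp add: cov_ext_def cadd_def algebra_simps)
qed

lemma cscale_cscale: "cscale z (cscale w A) = cscale (z * w) A"
  by (auto simp: cscale_def tlin_def algebra_simps)

lemma cscale_one: "cscale 1 A = A"
  by (simp add: cscale_def tlin_def)

lemma line_mem: "Z \<in> {cscale z Z | z. True}"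
  by (rule CollectI, rule exI[of _ 1]) (simp add: cscale_one)

lemma cscale_zero: "cscale 0 A = czero"
  by (simp add: cscale_def tlin_def czero_def)

lemma line_rescale:
  assumes "w \<noteq> 0"
  shows "{cscale z (cscale w Z) | z. True} = {cscale z Z | z. True}"
proof (intro set_eqI iffI)
  fix X assume "X \<in> {cscale z Z | z. True}"
  then obtain z where "X = cscale z Z" by blast
  then have "X = cscale (z / w) (cscale w Z)" using assms by (simp add: cscale_cscale)
  then show "X \<in> {cscale z (cscale w Z) | z. True}" by blast
qed (auto simp: cscale_cscale)

lemma czero_line_mem: "czero \<in> {cscale z Z | z. True}"
  by (rule CollectI, rule exI[of _ 0]) (simp add: cscale_zero)

lemma cadd_czero: "cadd A czero = A" "cadd czero A = A"
  by (simp_all add: cadd_def tlin_def czero_def)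

lemma ctangent_closed:
  assumes "smooth_manifold N" "x \<in> pts N"
  shows "A \<in> ctangent N x \<Longrightarrow> cscale z A \<in> ctangent N x"
    "A \<in> ctangent N x \<Longrightarrow> B \<in> ctangent N x \<Longrightarrow> cadd A B \<in> ctangent N x"
  using assms tlin_in_tangent[OF assms(1,2)] by (auto simp: ctangent_def cscale_def cadd_def)

lemma zero_in_tangent:
  assumes "smooth_manifold N" "x \<in> pts N"
  shows "(\<lambda>f. 0) \<in> tangent N x"
proof -
  obtain \<kappa> where \<kappa>: "\<kappa> \<in> atlas N" "x \<in> fst \<kappa>" using manifold_chart_exists[OF assms] .
  have "tlin 0 V 0 V = (\<lambda>f. 0)" for V :: "'a tan" by (simp add: tlin_def)
  then show ?thesis using tlin_in_tangent[OF assms] tvec_in_tangent[OF \<kappa>] by metis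
qed

lemma covector_zero:
  assumes "smooth_manifold N" "x \<in> pts N" "\<alpha> \<in> covectors N x"
  shows "\<alpha> (\<lambda>f. 0) = 0"
proof -
  have "\<alpha> (tlin 0 (\<lambda>f. 0) 0 (\<lambda>f. 0)) = 0"
    using assms(3) zero_in_tangent[OF assms(1,2)] unfolding covectors_def by auto
  then show ?thesis by (simp add: tlin_def)
qed

lemma line_subbundle_fibre:
  assumes "smooth_manifold N" "complex_line_subbundle N T" "y \<in> pts N"
  obtains A where "A \<in> ctangent N y" "T y = {cscale z A | z. True}"
proof -
  obtain S A B where S: "y \<in> S" "smooth_vfield_on N S A" "smooth_vfield_on N S B"
    and T: "\<forall>y\<in>S. (A y, B y) \<noteq> czero \<and> T y = {cscale z (A y, B y) | z. True}"
    using bspec[OF assms(2)[unfolded complex_line_subbundle_def] assms(3)] by (elim exE conjE) (rule that)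
  have Ty: "T y = {cscale z (A y, B y) | z. True}" using bspec[OF T S(1)] by (rule conjunct2)
  obtain \<kappa> where \<kappa>: "\<kappa> \<in> atlas N" "y \<in> fst \<kappa>" using manifold_chart_exists[OF assms(1,3)] .
  have "V y \<in> tangent N y" if V: "smooth_vfield_on N S V" for V
  proof -
    obtain a where "\<forall>y\<in>S \<inter> fst \<kappa>. V y = tvec N \<kappa> y (a (snd \<kappa> y))"
      using V \<kappa>(1) unfolding smooth_vfield_on_def by fast
    then show ?thesis using S(1) \<kappa>(2) tvec_in_tangent[OF \<kappa>] by simp
  qed
  then have "(A y, B y) \<in> ctangent N y" using S by (simp add: ctangent_def)
  then show thesis using Ty by (rule that)
qed

locale flag_manifold =
  fixes M :: "('m, 'v::euclidean_space) mfd" and T1 T2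
  assumes M: "smooth_manifold M" and flag: "flag_structure M T1 T2"
begin

lemma lines: "complex_line_subbundle M T1" "complex_line_subbundle M T2"
  using flag unfolding flag_structure_def by auto

lemma contact_covector_nonzero:
  assumes "y \<in> pts M" "\<alpha> \<in> covectors M y" "cov_kernel M y \<alpha> = cplane T1 T2 y"
  obtains U where "U \<in> tangent M y" "\<alpha> U \<noteq> 0"
proof -
  obtain S \<theta> \<zeta> U V W where S: "smooth_form_on M S \<theta>" "y \<in> S" "cov_kernel M y (\<theta> y) = cplane T1 T2 y"
    "U \<in> tangent M y" "V \<in> tangent M y" "W \<in> tangent M y" "(\<theta> y \<^bold>\<and>\<^sub>2 \<zeta>) U V W \<noteq> 0"
    using flag assms(1) unfolding flag_structure_def by metis
  have "\<theta> y U \<noteq> 0 \<or> \<theta> y V \<noteq> 0 \<or> \<theta> y W \<noteq> 0" using S(7) unfolding wedge12_def by auto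
  then obtain X where X: "X \<in> tangent M y" "\<theta> y X \<noteq> 0" using S(4-6) by blast
  let ?Z = "(X, \<lambda>f. 0)"
  have Z: "?Z \<in> ctangent M y" using X zero_in_tangent[OF M assms(1)] by (simp add: ctangent_def)
  have cov: "\<theta> y \<in> covectors M y" using S(1,2) unfolding smooth_form_on_def by blast
  have "cov_ext (\<theta> y) ?Z \<noteq> 0" using X(2) covector_zero[OF M assms(1) cov] by (simp add: cov_ext_def)
  then have "?Z \<notin> cov_kernel M y (\<theta> y)" by (simp add: cov_kernel_def)
  then have "?Z \<notin> cov_kernel M y \<alpha>" unfolding assms(3) S(3) .
  then have "\<alpha> X \<noteq> 0" using Z covector_zero[OF M assms(1,2)] by (simp add: cov_kernel_def cov_ext_def)
  then show thesis using that X(1) by blast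
qed

text \<open>For a vector \<open>U\<close> with \<open>\<alpha>(U) \<noteq> 0\<close>, the vector \<open>V - (\<alpha>(V) / \<alpha>(U)) U\<close> lies in the common kernel.\<close>

lemma contact_covectors_proportional:
  assumes y: "y \<in> pts M" and \<alpha>: "\<alpha> \<in> covectors M y" "cov_kernel M y \<alpha> = cplane T1 T2 y"
    and \<beta>: "\<beta> \<in> covectors M y" "cov_kernel M y \<beta> = cplane T1 T2 y"
  obtains l where "l \<noteq> 0" "\<beta> = (\<lambda>V. l * \<alpha> V)"
proof -
  obtain U where U: "U \<in> tangent M y" "\<alpha> U \<noteq> 0" using contact_covector_nonzero[OF y \<alpha>] .
  have e: "cov_ext \<gamma> (X, \<lambda>f. 0) = \<gamma> X" if "\<gamma> \<in> covectors M y" for \<gamma> X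
    using covector_zero[OF M y that] by (simp add: cov_ext_def)
  have c: "(X, \<lambda>f. 0) \<in> ctangent M y" if "X \<in> tangent M y" for X
    using that zero_in_tangent[OF M y] by (simp add: ctangent_def)
  define l where "l = \<beta> U / \<alpha> U"
  have *: "\<beta> V = l * \<alpha> V" if V: "V \<in> tangent M y" for V
  proof -
    let ?Z = "cadd (V, \<lambda>f. 0) (cscale (- \<alpha> V / \<alpha> U) (U, \<lambda>f. 0))"
    have Z: "?Z \<in> ctangent M y" by (intro ctangent_closed[OF M y] c U V)
    have ext: "cov_ext \<gamma> ?Z = \<gamma> V - \<alpha> V / \<alpha> U * \<gamma> U" if "\<gamma> \<in> covectors M y" for \<gamma>
      using that c[OF U(1)] c[OF V] ctangent_closed(1)[OF M y]
      by (simp add: cov_ext_cadd cov_ext_cscale e[OF that])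
    have "cov_ext \<alpha> ?Z = 0" using ext[OF \<alpha>(1)] U(2) by simp
    then have "?Z \<in> cov_kernel M y \<beta>" using Z unfolding \<beta>(2) \<alpha>(2)[symmetric] by (simp add: cov_kernel_def)
    then have "\<beta> V - \<alpha> V / \<alpha> U * \<beta> U = 0" using ext[OF \<beta>(1)] by (simp add: cov_kernel_def)
    then show ?thesis unfolding l_def by (simp add: field_simps)
  qed
  have "\<beta> = (\<lambda>V. l * \<alpha> V)"
  proof
    fix V show "\<beta> V = l * \<alpha> V"
    proof (cases "V \<in> tangent M y")
      case False then show ?thesis using \<alpha>(1) \<beta>(1) by (simp add: covectors_def)
    qed (rule *)
  qed
  moreover obtain W where "\<beta> W \<noteq> 0" using contact_covector_nonzero[OF y \<beta>] .
  ultimately have "l \<noteq> 0" by auto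
  then show thesis using that \<open>\<beta> = (\<lambda>V. l * \<alpha> V)\<close> by blast
qed

definition adapted_coframe :: "'m \<Rightarrow> 'm cov \<Rightarrow> 'm cov \<Rightarrow> 'm cov \<Rightarrow> bool" where
  "adapted_coframe y \<alpha> \<alpha>1 \<alpha>2 \<longleftrightarrow> y \<in> pts M \<and> \<alpha> \<in> covectors M y \<and> cov_kernel M y \<alpha> = cplane T1 T2 y \<and>
     \<alpha>1 \<in> adapted_covectors M T1 T2 y \<and> \<alpha>2 \<in> adapted_covectors M T2 T1 y"

text \<open>The vectors \<open>Z1\<close> and \<open>Z2\<close> are normalised generators of the two lines; \<open>Z0\<close> is a vector outside the contact
plane, corrected by multiples of \<open>Z1\<close> and \<open>Z2\<close>.\<close>

lemma dual_frame:
  assumes "adapted_coframe y \<alpha> \<alpha>1 \<alpha>2"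
  obtains Z0 Z1 Z2 where "Z0 \<in> ctangent M y" "Z1 \<in> ctangent M y" "Z2 \<in> ctangent M y"
    "T1 y = {cscale z Z1 | z. True}" "T2 y = {cscale z Z2 | z. True}"
    "cov_ext \<alpha> Z0 = 1" "cov_ext \<alpha> Z1 = 0" "cov_ext \<alpha> Z2 = 0"
    "cov_ext \<alpha>1 Z0 = 0" "cov_ext \<alpha>1 Z1 = 1" "cov_ext \<alpha>1 Z2 = 0"
    "cov_ext \<alpha>2 Z0 = 0" "cov_ext \<alpha>2 Z1 = 0" "cov_ext \<alpha>2 Z2 = 1"
proof -
  have y: "y \<in> pts M" and \<alpha>: "\<alpha> \<in> covectors M y" "cov_kernel M y \<alpha> = cplane T1 T2 y"
    and \<alpha>1: "\<alpha>1 \<in> adapted_covectors M T1 T2 y" and \<alpha>2: "\<alpha>2 \<in> adapted_covectors M T2 T1 y"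
    using assms unfolding adapted_coframe_def by auto
  have unit: "\<exists>Z. Z \<in> ctangent M y \<and> A y = {cscale z Z | z. True} \<and> cov_ext \<beta> Z = 1"
    if A: "complex_line_subbundle M A" and \<beta>: "\<beta> \<in> adapted_covectors M A B y" for A B \<beta>
  proof -
    obtain C where C: "C \<in> ctangent M y" "A y = {cscale z C | z. True}"
      using line_subbundle_fibre[OF M A y] .
    have cov: "\<beta> \<in> covectors M y" using \<beta> by (simp add: adapted_covectors_def)
    obtain w where "cov_ext \<beta> (cscale w C) \<noteq> 0" using \<beta> C(2) unfolding adapted_covectors_def by auto
    then have ne: "cov_ext \<beta> C \<noteq> 0" using cov_ext_cscale[OF cov C(1)] by simp
    let ?Z = "cscale (1 / cov_ext \<beta> C) C"
    have "A y = {cscale z ?Z | z. True}" using ne C(2) by (subst line_rescale) auto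
    moreover have "cov_ext \<beta> ?Z = 1" using ne cov_ext_cscale[OF cov C(1)] by simp
    ultimately show ?thesis using ctangent_closed(1)[OF M y C(1)] by blast
  qed
  obtain Z1 where Z1: "Z1 \<in> ctangent M y" "T1 y = {cscale z Z1 | z. True}" "cov_ext \<alpha>1 Z1 = 1"
    using unit[OF lines(1) \<alpha>1] by blast
  obtain Z2 where Z2: "Z2 \<in> ctangent M y" "T2 y = {cscale z Z2 | z. True}" "cov_ext \<alpha>2 Z2 = 1"
    using unit[OF lines(2) \<alpha>2] by blast
  have mem: "Z1 \<in> T1 y" "Z2 \<in> T2 y" "czero \<in> T1 y" "czero \<in> T2 y"
    unfolding Z1(2) Z2(2) by (rule line_mem czero_line_mem)+
  have cov1: "\<alpha>1 \<in> covectors M y" "cov_ext \<alpha>1 Z2 = 0" and cov2: "\<alpha>2 \<in> covectors M y" "cov_ext \<alpha>2 Z1 = 0"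
    using \<alpha>1 \<alpha>2 mem by (auto simp: adapted_covectors_def)
  have "cadd Z1 czero \<in> cplane T1 T2 y" "cadd czero Z2 \<in> cplane T1 T2 y"
    using mem unfolding cplane_def by blast+
  then have "Z1 \<in> cov_kernel M y \<alpha>" "Z2 \<in> cov_kernel M y \<alpha>" by (simp_all add: \<alpha>(2) cadd_czero)
  then have \<alpha>Z: "cov_ext \<alpha> Z1 = 0" "cov_ext \<alpha> Z2 = 0" by (simp_all add: cov_kernel_def)
  obtain U where U: "U \<in> tangent M y" "\<alpha> U \<noteq> 0" using contact_covector_nonzero[OF y \<alpha>] .
  let ?U = "(U, \<lambda>f. 0)"
  have Uc: "?U \<in> ctangent M y" using U zero_in_tangent[OF M y] by (simp add: ctangent_def)
  have ext_U: "cov_ext \<gamma> ?U = \<gamma> U" if "\<gamma> \<in> covectors M y" for \<gamma>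
    using covector_zero[OF M y that] by (simp add: cov_ext_def)
  define Z0 where "Z0 = cadd (cscale (1 / \<alpha> U) ?U)
    (cadd (cscale (- \<alpha>1 U / \<alpha> U) Z1) (cscale (- \<alpha>2 U / \<alpha> U) Z2))"
  have Z0: "Z0 \<in> ctangent M y" unfolding Z0_def
    by (intro Uc Z1(1) Z2(1) ctangent_closed[OF M y])
  have ext_Z0: "cov_ext \<gamma> Z0 = \<gamma> U / \<alpha> U - \<alpha>1 U / \<alpha> U * cov_ext \<gamma> Z1 - \<alpha>2 U / \<alpha> U * cov_ext \<gamma> Z2"
    if "\<gamma> \<in> covectors M y" for \<gamma>
    unfolding Z0_def using that Uc Z1(1) Z2(1) ctangent_closed[OF M y]
    by (simp add: cov_ext_cadd cov_ext_cscale ext_U)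
  show thesis
    using that[OF Z0 Z1(1) Z2(1) Z1(2) Z2(2)] ext_Z0 \<alpha>(1) cov1 cov2 \<alpha>Z U(2) Z1(3) Z2(3) by simp
qed

text \<open>As the contact plane is the sum of the lines spanned by \<open>Z1\<close> and \<open>Z2\<close>, the dual frame spans the
complexified tangent space, and the coefficients are the values on the frame.\<close>

lemma covector_expansion:
  assumes co: "adapted_coframe y \<alpha> \<alpha>1 \<alpha>2" and \<beta>: "\<beta> \<in> covectors M y"
  obtains b b1 b2 where "\<beta> = (\<lambda>V. b * \<alpha> V + b1 * \<alpha>1 V + b2 * \<alpha>2 V)"
    "\<beta> \<in> adapted_covectors M T1 T2 y \<longrightarrow> b1 \<noteq> 0 \<and> b2 = 0"
    "\<beta> \<in> adapted_covectors M T2 T1 y \<longrightarrow> b1 = 0 \<and> b2 \<noteq> 0"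
proof -
  have y: "y \<in> pts M" and \<alpha>: "\<alpha> \<in> covectors M y" "cov_kernel M y \<alpha> = cplane T1 T2 y"
    and \<alpha>1: "\<alpha>1 \<in> covectors M y" and \<alpha>2: "\<alpha>2 \<in> covectors M y"
    using co unfolding adapted_coframe_def adapted_covectors_def by auto
  obtain Z0 Z1 Z2 where Z: "Z0 \<in> ctangent M y" "Z1 \<in> ctangent M y" "Z2 \<in> ctangent M y"
    "T1 y = {cscale z Z1 | z. True}" "T2 y = {cscale z Z2 | z. True}"
    "cov_ext \<alpha> Z0 = 1" "cov_ext \<alpha> Z1 = 0" "cov_ext \<alpha> Z2 = 0"
    "cov_ext \<alpha>1 Z0 = 0" "cov_ext \<alpha>1 Z1 = 1" "cov_ext \<alpha>1 Z2 = 0"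
    "cov_ext \<alpha>2 Z0 = 0" "cov_ext \<alpha>2 Z1 = 0" "cov_ext \<alpha>2 Z2 = 1"
    using dual_frame[OF co] .
  have *: "\<beta> V = cov_ext \<beta> Z0 * \<alpha> V + cov_ext \<beta> Z1 * \<alpha>1 V + cov_ext \<beta> Z2 * \<alpha>2 V"
    if V: "V \<in> tangent M y" for V
  proof -
    let ?V = "(V, \<lambda>f. 0)"
    have Vc: "?V \<in> ctangent M y" using V zero_in_tangent[OF M y] by (simp add: ctangent_def)
    have ext_V: "cov_ext \<gamma> ?V = \<gamma> V" if "\<gamma> \<in> covectors M y" for \<gamma>
      using covector_zero[OF M y that] by (simp add: cov_ext_def)
    let ?W = "cadd ?V (cscale (- \<alpha> V) Z0)"
    have W: "?W \<in> ctangent M y" by (intro Vc Z(1) ctangent_closed[OF M y])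
    have ext_W: "cov_ext \<gamma> ?W = \<gamma> V - \<alpha> V * cov_ext \<gamma> Z0" if "\<gamma> \<in> covectors M y" for \<gamma>
      using that Vc Z(1) ctangent_closed[OF M y] by (simp add: cov_ext_cadd cov_ext_cscale ext_V)
    have "?W \<in> cov_kernel M y \<alpha>" using W ext_W[OF \<alpha>(1)] Z(6) by (simp add: cov_kernel_def)
    then obtain p q where pq: "?W = cadd (cscale p Z1) (cscale q Z2)"
      unfolding \<alpha>(2) cplane_def Z(4,5) by auto
    have "cov_ext \<gamma> ?W = p * cov_ext \<gamma> Z1 + q * cov_ext \<gamma> Z2" if "\<gamma> \<in> covectors M y" for \<gamma>
      unfolding pq using that Z(2,3) ctangent_closed[OF M y] by (simp add: cov_ext_cadd cov_ext_cscale)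
    then have e: "\<gamma> V = \<alpha> V * cov_ext \<gamma> Z0 + p * cov_ext \<gamma> Z1 + q * cov_ext \<gamma> Z2" if "\<gamma> \<in> covectors M y" for \<gamma>
      using that ext_W[OF that] by (simp add: algebra_simps)
    have "\<alpha>1 V = p" "\<alpha>2 V = q" using e[OF \<alpha>1] e[OF \<alpha>2] Z by simp_all
    then show ?thesis using e[OF \<beta>] by (simp add: mult.commute)
  qed
  have "\<beta> = (\<lambda>V. cov_ext \<beta> Z0 * \<alpha> V + cov_ext \<beta> Z1 * \<alpha>1 V + cov_ext \<beta> Z2 * \<alpha>2 V)"
  proof
    fix V show "\<beta> V = cov_ext \<beta> Z0 * \<alpha> V + cov_ext \<beta> Z1 * \<alpha>1 V + cov_ext \<beta> Z2 * \<alpha>2 V"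
    proof (cases "V \<in> tangent M y")
      case False then show ?thesis using \<alpha>(1) \<alpha>1 \<alpha>2 \<beta> by (simp add: covectors_def)
    qed (rule *)
  qed
  moreover have mem: "Z1 \<in> T1 y" "Z2 \<in> T2 y"
    unfolding Z(4,5) by (rule line_mem)+
  have "cov_ext \<beta> Z1 \<noteq> 0 \<and> cov_ext \<beta> Z2 = 0" if "\<beta> \<in> adapted_covectors M T1 T2 y"
    using that mem(2) cov_ext_cscale[OF \<beta> Z(2)] Z(4) unfolding adapted_covectors_def by auto
  moreover have "cov_ext \<beta> Z1 = 0 \<and> cov_ext \<beta> Z2 \<noteq> 0" if "\<beta> \<in> adapted_covectors M T2 T1 y"
    using that mem(1) cov_ext_cscale[OF \<beta> Z(3)] Z(5) unfolding adapted_covectors_def by auto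
  ultimately show thesis using that by blast
qed

text \<open>The volume form takes the value 1 on the dual frame.  Its complex trilinear extension is a combination of
values on real vectors, so one of these is nonzero.  Wedging a 2-form with a covector of the coframe and
dividing by this value then isolates a coefficient.\<close>

lemma coframe_volume_nonzero:
  assumes "adapted_coframe y \<alpha> \<alpha>1 \<alpha>2"
  obtains U V W where "U \<in> tangent M y" "V \<in> tangent M y" "W \<in> tangent M y"
    "(\<alpha> \<^bold>\<and>\<^sub>2 (\<alpha>1 \<^bold>\<and> \<alpha>2)) U V W \<noteq> 0"
proof (rule ccontr)
  assume no: "\<not> thesis"
  note witness = that
  have 0: "(\<alpha> \<^bold>\<and>\<^sub>2 (\<alpha>1 \<^bold>\<and> \<alpha>2)) U V W = 0"
    if "U \<in> tangent M y" "V \<in> tangent M y" "W \<in> tangent M y" for U V W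
    using witness that no by blast
  obtain Z0 Z1 Z2 where Z: "Z0 \<in> ctangent M y" "Z1 \<in> ctangent M y" "Z2 \<in> ctangent M y"
    "T1 y = {cscale z Z1 | z. True}" "T2 y = {cscale z Z2 | z. True}"
    "cov_ext \<alpha> Z0 = 1" "cov_ext \<alpha> Z1 = 0" "cov_ext \<alpha> Z2 = 0"
    "cov_ext \<alpha>1 Z0 = 0" "cov_ext \<alpha>1 Z1 = 1" "cov_ext \<alpha>1 Z2 = 0"
    "cov_ext \<alpha>2 Z0 = 0" "cov_ext \<alpha>2 Z1 = 0" "cov_ext \<alpha>2 Z2 = 1"
    using dual_frame[OF assms] .
  obtain U V W U' V' W' where UVW: "Z0 = (U, U')" "Z1 = (V, V')" "Z2 = (W, W')" by (metis surj_pair)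
  have t: "U \<in> tangent M y" "V \<in> tangent M y" "W \<in> tangent M y"
    "U' \<in> tangent M y" "V' \<in> tangent M y" "W' \<in> tangent M y"
    using Z(1-3) by (simp_all add: UVW ctangent_def)
  define D where "D = (\<alpha> \<^bold>\<and>\<^sub>2 (\<alpha>1 \<^bold>\<and> \<alpha>2))"
  have "D U V W + \<i> * (D U' V W + D U V' W + D U V W') - (D U' V' W + D U' V W' + D U V' W') - \<i> * D U' V' W'
    = cov_ext \<alpha> Z0 * (cov_ext \<alpha>1 Z1 * cov_ext \<alpha>2 Z2 - cov_ext \<alpha>1 Z2 * cov_ext \<alpha>2 Z1)
    - cov_ext \<alpha> Z1 * (cov_ext \<alpha>1 Z0 * cov_ext \<alpha>2 Z2 - cov_ext \<alpha>1 Z2 * cov_ext \<alpha>2 Z0)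
    + cov_ext \<alpha> Z2 * (cov_ext \<alpha>1 Z0 * cov_ext \<alpha>2 Z1 - cov_ext \<alpha>1 Z1 * cov_ext \<alpha>2 Z0)"
    unfolding D_def UVW cov_ext_def wedge12_def wedge_def fst_conv snd_conv using i_squared by algebra
  also have "\<dots> = 1" using Z by simp
  finally show False using 0 t by (simp add: D_def)
qed

end

section \<open>Bundles of coframes as fibre bundles\<close>

text \<open>The common shape of the charts of E over M, of Y over E and of X over M: the base coordinates of a
point of the total space are those of its projection, and the image of a chart is a product.  The
consequences drawn from this are that the projection maps tangent vectors to tangent vectors, and that
lifted covectors are linear along each chart.\<close>

locale fibre_charts =
  fixes N :: "('b, 'v::euclidean_space) mfd" and P :: "('b \<times> 'c, 'v \<times> 'w::euclidean_space) mfd"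
  assumes base_inj: "\<kappa> \<in> atlas N \<Longrightarrow> inj_on (snd \<kappa>) (fst \<kappa>)"
    and total_chart: "L \<in> atlas P \<Longrightarrow> \<exists>\<kappa> S Q. \<kappa> \<in> atlas N \<and> open_in N S \<and> S \<subseteq> fst \<kappa> \<and> open Q \<and>
      fst L = {p \<in> pts P. fst p \<in> S} \<and> (\<forall>p\<in>fst L. fst (snd L p) = snd \<kappa> (fst p)) \<and>
      inj_on (snd L) (fst L) \<and> snd L ` fst L = (snd \<kappa> ` S) \<times> Q"
begin

lemma total_chartE:
  assumes "L \<in> atlas P"
  obtains \<kappa> S Q where "\<kappa> \<in> atlas N" "open_in N S" "S \<subseteq> fst \<kappa>" "open Q"
    "fst L = {p \<in> pts P. fst p \<in> S}" "\<forall>p\<in>fst L. fst (snd L p) = snd \<kappa> (fst p)"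
    "inj_on (snd L) (fst L)" "snd L ` fst L = (snd \<kappa> ` S) \<times> Q"
    "open (snd \<kappa> ` S)"
proof -
  obtain \<kappa> S Q where *: "\<kappa> \<in> atlas N" "open_in N S" "S \<subseteq> fst \<kappa>" "open Q"
    "fst L = {p \<in> pts P. fst p \<in> S}" "\<forall>p\<in>fst L. fst (snd L p) = snd \<kappa> (fst p)"
    "inj_on (snd L) (fst L)" "snd L ` fst L = (snd \<kappa> ` S) \<times> Q"
    using total_chart[OF assms] by (elim exE conjE) (rule that)
  have "S \<inter> fst \<kappa> = S" using *(3) by blast
  then have "open (snd \<kappa> ` S)" using *(1,2) unfolding open_in_def by metis
  then show thesis using * by (intro that) auto
qed

lemma total_inj: "L \<in> atlas P \<Longrightarrow> inj_on (snd L) (fst L)"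
  by (rule total_chartE)

lemma total_chart_domain: "L \<in> atlas P \<Longrightarrow> fst L \<subseteq> pts P"
  using total_chart by fast

lemma total_open: assumes "L \<in> atlas P" shows "open (snd L ` fst L)"
proof -
  obtain \<kappa> S Q where *: "\<kappa> \<in> atlas N" "open_in N S" "S \<subseteq> fst \<kappa>" "open Q"
    "fst L = {p \<in> pts P. fst p \<in> S}" "\<forall>p\<in>fst L. fst (snd L p) = snd \<kappa> (fst p)"
    "inj_on (snd L) (fst L)" "snd L ` fst L = (snd \<kappa> ` S) \<times> Q" "open (snd \<kappa> ` S)"
    using total_chartE[OF assms] .
  show ?thesis unfolding *(8) by (rule open_Times[OF *(9,4)])
qed

lemma total_chart_restrict:
  assumes L: "L \<in> atlas P" and S0: "open_in N S0"
  obtains \<kappa> A Q where "\<kappa> \<in> atlas N" "open A" "open Q"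
    "snd L ` ({p \<in> pts P. fst p \<in> S0} \<inter> fst L) = A \<times> Q" "A \<subseteq> snd \<kappa> ` (S0 \<inter> fst \<kappa>)"
    "\<forall>z q. (z, q) \<in> A \<times> Q \<longrightarrow> fst (chart_inv L (z, q)) = chart_inv \<kappa> z"
proof -
  obtain \<kappa> S Q where *: "\<kappa> \<in> atlas N" "open_in N S" "S \<subseteq> fst \<kappa>" "open Q"
    "fst L = {p \<in> pts P. fst p \<in> S}" "\<forall>p\<in>fst L. fst (snd L p) = snd \<kappa> (fst p)"
    "inj_on (snd L) (fst L)" "snd L ` fst L = (snd \<kappa> ` S) \<times> Q" "open (snd \<kappa> ` S)"
    using total_chartE[OF L] .
  have inj: "inj_on (snd \<kappa>) (fst \<kappa>)" using base_inj *(1) .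
  define A where "A = snd \<kappa> ` (S0 \<inter> fst \<kappa>) \<inter> snd \<kappa> ` S"
  have A: "open A" unfolding A_def using *(1,9) S0 by (intro open_Int) (auto simp: open_in_def)
  have A_iff: "snd \<kappa> y \<in> A \<longleftrightarrow> y \<in> S0 \<inter> S" if "y \<in> fst \<kappa>" for y
    using inj that *(3) unfolding A_def inj_on_def by blast
  have img: "snd L ` ({p \<in> pts P. fst p \<in> S0} \<inter> fst L) = A \<times> Q"
  proof (intro set_eqI iffI)
    fix w assume "w \<in> snd L ` ({p \<in> pts P. fst p \<in> S0} \<inter> fst L)"
    then obtain p where p: "p \<in> fst L" "fst p \<in> S0" "w = snd L p" by auto
    then have "w \<in> snd \<kappa> ` S \<times> Q" using *(8) by auto
    moreover have "fst p \<in> S" "fst p \<in> fst \<kappa>" using p(1) *(3,5) by auto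
    then have "fst w \<in> A" using p(2) A_iff[of "fst p"] unfolding p(3) bspec[OF *(6) p(1)] by simp
    ultimately have "fst w \<in> A" "w \<in> snd \<kappa> ` S \<times> Q" by blast+
    then have "fst w \<in> A" "snd w \<in> Q" by (auto simp: mem_Times_iff)
    then show "w \<in> A \<times> Q" by (simp add: mem_Times_iff)
  next
    fix w assume w: "w \<in> A \<times> Q"
    then have "w \<in> snd L ` fst L" unfolding *(8) A_def by auto
    then obtain p where p: "p \<in> fst L" "w = snd L p" by auto
    have "fst p \<in> fst \<kappa>" using p(1) *(3,5) by auto
    moreover have "snd \<kappa> (fst p) \<in> A" using w unfolding bspec[OF *(6) p(1), symmetric] p(2) by auto
    ultimately have "fst p \<in> S0" using A_iff[of "fst p"] by simp
    then show "w \<in> snd L ` ({p \<in> pts P. fst p \<in> S0} \<inter> fst L)" using p *(5) by auto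
  qed
  have inv: "fst (chart_inv L (z, q)) = chart_inv \<kappa> z" if "(z, q) \<in> A \<times> Q" for z q
  proof -
    have "(z, q) \<in> snd L ` fst L" using that unfolding *(8) A_def by auto
    then obtain p where p: "p \<in> fst L" "(z, q) = snd L p" by auto
    have "chart_inv L (z, q) = p" unfolding p(2) using chart_inv_left[OF *(7) p(1)] .
    moreover have "chart_inv \<kappa> z = fst p"
      using bspec[OF *(6) p(1)] p *(3,5) chart_inv_left[OF inj, of "fst p"] by (metis (mono_tags, lifting) fst_conv mem_Collect_eq subsetD)
    ultimately show ?thesis by simp
  qed
  have "A \<subseteq> snd \<kappa> ` (S0 \<inter> fst \<kappa>)" unfolding A_def by blast
  then show thesis using that[OF *(1) A *(4) img] inv by blast
qed

text \<open>In each chart of the total space, \<open>g \<circ> fst\<close> is the expression of \<open>g\<close> in a base chart, composed with the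
linear projection.\<close>

lemma smooth_near_fst:
  assumes p: "p \<in> pts P" and g: "smooth_near N (fst p) g"
  shows "smooth_near P p (g \<circ> fst)"
proof -
  obtain S0 where S0: "open_in N S0" "fst p \<in> S0" "smooth_fun_on N S0 g"
    using g unfolding smooth_near_def by blast
  let ?S = "{p \<in> pts P. fst p \<in> S0}"
  have *: "open (snd L ` (?S \<inter> fst L)) \<and> smooth_on (snd L ` (?S \<inter> fst L)) (g \<circ> fst \<circ> chart_inv L)"
    if L: "L \<in> atlas P" for L
  proof -
    obtain \<kappa> A Q where A: "\<kappa> \<in> atlas N" "open A" "open Q" "snd L ` (?S \<inter> fst L) = A \<times> Q"
      "A \<subseteq> snd \<kappa> ` (S0 \<inter> fst \<kappa>)" "\<forall>z q. (z, q) \<in> A \<times> Q \<longrightarrow> fst (chart_inv L (z, q)) = chart_inv \<kappa> z"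
      using total_chart_restrict[OF L S0(1)] .
    have op: "open (A \<times> Q)" using A(2,3) by (rule open_Times)
    have "smooth_on A (g \<circ> chart_inv \<kappa>)"
      using S0(3) A(1,5) smooth_on_subset unfolding smooth_fun_on_def by blast
    then have "smooth_on (A \<times> Q) ((g \<circ> chart_inv \<kappa>) \<circ> fst)"
      by (rule smooth_on_compose[OF op A(2) _ smooth_on_bounded_linear[OF bounded_linear_fst]]) auto
    also have "?this = smooth_on (A \<times> Q) (g \<circ> fst \<circ> chart_inv L)"
      by (rule smooth_on_cong[OF op]) (use A(6) in auto)
    finally show ?thesis unfolding A(4) using op by blast
  qed
  have "open_in P ?S" using * unfolding open_in_def by blast
  moreover have "smooth_fun_on P ?S (g \<circ> fst)" using * unfolding smooth_fun_on_def by blast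
  ultimately show ?thesis using S0(2) p unfolding smooth_near_def by blast
qed

lemma push_fst_tvec:
  assumes L: "L \<in> atlas P" and p: "p \<in> fst L"
  obtains \<kappa> where "\<kappa> \<in> atlas N" "fst p \<in> fst \<kappa>"
    "\<forall>w. push N fst p (tvec P L p w) = tvec N \<kappa> (fst p) (fst w)"
proof -
  obtain \<kappa> S Q where *: "\<kappa> \<in> atlas N" "open_in N S" "S \<subseteq> fst \<kappa>" "open Q"
    "fst L = {p \<in> pts P. fst p \<in> S}" "\<forall>p\<in>fst L. fst (snd L p) = snd \<kappa> (fst p)"
    "inj_on (snd L) (fst L)" "snd L ` fst L = (snd \<kappa> ` S) \<times> Q" "open (snd \<kappa> ` S)"
    using total_chartE[OF L] .
  have px: "p \<in> pts P" "fst p \<in> fst \<kappa>" using p *(3,5) by auto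
  have "push N fst p (tvec P L p w) g = tvec N \<kappa> (fst p) (fst w) g" for w g
  proof (cases "smooth_near N (fst p) g")
    case True
    have op: "open (snd L ` fst L)" using total_open[OF L] .
    have "fd (g \<circ> fst \<circ> chart_inv L) (snd L p) w = fd ((g \<circ> chart_inv \<kappa>) \<circ> fst) (snd L p) w"
    proof (rule fd_cong_open[OF op])
      fix z assume "z \<in> snd L ` fst L"
      then obtain r where r: "r \<in> fst L" "z = snd L r" by auto
      then have "fst r \<in> fst \<kappa>" using *(3,5) by auto
      then have "chart_inv \<kappa> (fst z) = fst r"
        using chart_inv_left[OF base_inj[OF *(1)]] bspec[OF *(6) r(1)] r(2) by simp
      then show "(g \<circ> fst \<circ> chart_inv L) z = ((g \<circ> chart_inv \<kappa>) \<circ> fst) z"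
        using chart_inv_left[OF *(7) r(1)] r(2) by simp
    qed (use p in simp)
    also have "\<dots> = fd (g \<circ> chart_inv \<kappa>) (fst (snd L p)) (fd fst (snd L p) w)"
      using smooth_near_differentiable[OF True *(1) px(2)] bspec[OF *(6) p]
      by (intro fd_compose bounded_linear_imp_differentiable[OF bounded_linear_fst]) simp
    also have "fd fst (snd L p) w = fst w"
      by (rule fd_eqI) (rule bounded_linear_imp_has_derivative[OF bounded_linear_fst])
    finally show ?thesis unfolding bspec[OF *(6) p] push_def tvec_def
      using True smooth_near_fst[OF px(1) True] by (simp only: if_True)
  qed (simp add: push_def tvec_def)
  then show thesis using that *(1) px(2) by blast
qed

lemma push_fst_tangent:
  assumes "V \<in> tangent P p"
  shows "push N fst p V \<in> tangent N (fst p)"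
proof -
  obtain L w where L: "L \<in> atlas P" "p \<in> fst L" "V = tvec P L p w"
    using assms unfolding tangent_def by blast
  obtain \<kappa> where "\<kappa> \<in> atlas N" "fst p \<in> fst \<kappa>"
    "\<forall>w. push N fst p (tvec P L p w) = tvec N \<kappa> (fst p) (fst w)"
    using push_fst_tvec[OF L(1,2)] .
  then show ?thesis using L(3) tvec_in_tangent by metis
qed

lemma lift_fst_linear:
  assumes "\<And>\<kappa>. \<kappa> \<in> atlas N \<Longrightarrow> fst p \<in> fst \<kappa> \<Longrightarrow> linear (\<lambda>v. \<alpha> (tvec N \<kappa> (fst p) v))"
    and "L \<in> atlas P" "p \<in> fst L"
  shows "linear (\<lambda>w. lift P N fst p \<alpha> (tvec P L p w))"
proof -
  obtain \<kappa> where \<kappa>: "\<kappa> \<in> atlas N" "fst p \<in> fst \<kappa>"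
    "\<forall>w. push N fst p (tvec P L p w) = tvec N \<kappa> (fst p) (fst w)"
    using push_fst_tvec[OF assms(2,3)] .
  have "lift P N fst p \<alpha> (tvec P L p w) = \<alpha> (tvec N \<kappa> (fst p) (fst w))" for w
    using tvec_in_tangent[OF assms(2,3)] by (simp add: lift_def spec[OF \<kappa>(3)])
  then show ?thesis
    using linear_compose[OF linear_fst assms(1)[OF \<kappa>(1,2)]] by (simp add: comp_def)
qed

end

context flag_manifold
begin

lemma contact_scale:
  assumes "\<alpha> \<in> covectors M x" "cov_kernel M x \<alpha> = cplane T1 T2 x" "l \<noteq> 0"
  shows "(\<lambda>V. l * \<alpha> V) \<in> covectors M x" "cov_kernel M x (\<lambda>V. l * \<alpha> V) = cplane T1 T2 x"
proof -
  show "(\<lambda>V. l * \<alpha> V) \<in> covectors M x" using assms(1) by (simp add: covectors_def algebra_simps)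
  have "cov_ext (\<lambda>V. l * \<alpha> V) Z = l * cov_ext \<alpha> Z" for Z by (simp add: cov_ext_def algebra_simps)
  then show "cov_kernel M x (\<lambda>V. l * \<alpha> V) = cplane T1 T2 x"
    using assms(2,3) by (simp add: cov_kernel_def)
qed

text \<open>Two covectors with the same kernel are proportional, so the fibre coordinate in the definition of the
charts exists; it is unique because contact covectors do not vanish.\<close>

lemma E_chart:
  assumes "L \<in> atlas (bundleE M T1 T2)"
  obtains \<kappa> S \<theta>0 where "\<kappa> \<in> atlas M" "open_in M S" "S \<subseteq> fst \<kappa>" "smooth_form_on M S \<theta>0"
    "\<forall>x\<in>S. (x, \<theta>0 x) \<in> Epts M T1 T2"
    "fst L = {p \<in> Epts M T1 T2. fst p \<in> S}"
    "fst L = {(x, \<lambda>V. l * \<theta>0 x V) | x l. x \<in> S \<and> l \<noteq> 0}"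
    "\<forall>x\<in>S. \<forall>l. snd L (x, \<lambda>V. l * \<theta>0 x V) = (snd \<kappa> x, l)"
    "inj_on (snd L) (fst L)"
proof -
  obtain \<kappa> S \<theta>0 where
    L: "L = ({(x, \<alpha>) \<in> Epts M T1 T2. x \<in> S}, \<lambda>(x, \<alpha>). (snd \<kappa> x, THE l. \<alpha> = (\<lambda>V. l * \<theta>0 x V)))"
    and \<kappa>: "\<kappa> \<in> atlas M" "open_in M S" "S \<subseteq> fst \<kappa>" "smooth_form_on M S \<theta>0"
    and E': "\<forall>x\<in>S. (x, \<theta>0 x) \<in> Epts M T1 T2"
    using assms unfolding bundleE_def mfd.simps mem_Collect_eq by (elim exE conjE) (rule that)
  have E: "(x, \<theta>0 x) \<in> Epts M T1 T2" if "x \<in> S" for x using E' that by blast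
  have coord: "snd L (x, \<lambda>V. l * \<theta>0 x V) = (snd \<kappa> x, l)" if x: "x \<in> S" for x l
  proof -
    obtain U where "\<theta>0 x U \<noteq> 0" using contact_covector_nonzero[of x "\<theta>0 x"] E[OF x] unfolding Epts_def by auto
    then have "l' = l" if "(\<lambda>V. l * \<theta>0 x V) = (\<lambda>V. l' * \<theta>0 x V)" for l'
      using fun_cong[OF that, of U] by simp
    then have "(THE l'. (\<lambda>V. l * \<theta>0 x V) = (\<lambda>V. l' * \<theta>0 x V)) = l" by (intro the_equality) blast+
    then show ?thesis unfolding L by simp
  qed
  have dom: "fst L = {(x, \<lambda>V. l * \<theta>0 x V) | x l. x \<in> S \<and> l \<noteq> 0}"
  proof (intro set_eqI iffI)
    fix p assume "p \<in> fst L"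
    then obtain x \<alpha> where p: "p = (x, \<alpha>)" "x \<in> S" "(x, \<alpha>) \<in> Epts M T1 T2" unfolding L by auto
    obtain l where "l \<noteq> 0" "\<alpha> = (\<lambda>V. l * \<theta>0 x V)"
      using contact_covectors_proportional[of x "\<theta>0 x" \<alpha>] p(3) E[OF p(2)] unfolding Epts_def by auto
    then show "p \<in> {(x, \<lambda>V. l * \<theta>0 x V) | x l. x \<in> S \<and> l \<noteq> 0}" using p by blast
  next
    fix p assume "p \<in> {(x, \<lambda>V. l * \<theta>0 x V) | x l. x \<in> S \<and> l \<noteq> 0}"
    then obtain x l where p: "p = (x, \<lambda>V. l * \<theta>0 x V)" "x \<in> S" "l \<noteq> 0" by blast
    then show "p \<in> fst L" using E[OF p(2)] contact_scale[of "\<theta>0 x" x l] unfolding L Epts_def by auto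
  qed
  have inj: "inj_on (snd L) (fst L)"
  proof (rule inj_onI)
    fix p p' assume "p \<in> fst L" "p' \<in> fst L" "snd L p = snd L p'"
    then obtain x l x' l' where "p = (x, \<lambda>V. l * \<theta>0 x V)" "x \<in> S" "p' = (x', \<lambda>V. l' * \<theta>0 x' V)" "x' \<in> S"
      "snd \<kappa> x = snd \<kappa> x'" "l = l'"
      unfolding dom using coord by auto
    moreover from this have "x = x'" using inj_onD[OF manifold_chart(1)[OF M \<kappa>(1)]] \<kappa>(3) by blast
    ultimately show "p = p'" by simp
  qed
  have dom': "fst L = {p \<in> Epts M T1 T2. fst p \<in> S}" unfolding L by auto
  show thesis using that[OF \<kappa> E' dom' dom _ inj] coord by blast
qed

lemma fibre_charts_E: "fibre_charts M (bundleE M T1 T2)"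
proof
  show "inj_on (snd \<kappa>) (fst \<kappa>)" if "\<kappa> \<in> atlas M" for \<kappa> using manifold_chart(1)[OF M that] .
next
  fix L assume "L \<in> atlas (bundleE M T1 T2)"
  then obtain \<kappa> S \<theta>0 where \<kappa>: "\<kappa> \<in> atlas M" "open_in M S" "S \<subseteq> fst \<kappa>" "smooth_form_on M S \<theta>0"
    "\<forall>x\<in>S. (x, \<theta>0 x) \<in> Epts M T1 T2"
    and dom': "fst L = {p \<in> Epts M T1 T2. fst p \<in> S}"
    and dom: "fst L = {(x, \<lambda>V. l * \<theta>0 x V) | x l. x \<in> S \<and> l \<noteq> 0}"
    and coord: "\<forall>x\<in>S. \<forall>l. snd L (x, \<lambda>V. l * \<theta>0 x V) = (snd \<kappa> x, l)"
    and inj: "inj_on (snd L) (fst L)"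
    by (rule E_chart)
  have img: "snd L ` fst L = (snd \<kappa> ` S) \<times> (UNIV - {0::complex})"
  proof (intro set_eqI iffI)
    fix q assume "q \<in> snd L ` fst L"
    then show "q \<in> (snd \<kappa> ` S) \<times> (UNIV - {0::complex})" unfolding dom using coord by auto
  next
    fix q assume "q \<in> (snd \<kappa> ` S) \<times> (UNIV - {0::complex})"
    then obtain x l where x: "x \<in> S" "l \<noteq> 0" "q = (snd \<kappa> x, l)" by auto
    then have "snd L (x, \<lambda>V. l * \<theta>0 x V) = q" "(x, \<lambda>V. l * \<theta>0 x V) \<in> fst L"
      unfolding dom using coord by auto
    then show "q \<in> snd L ` fst L" by (metis image_eqI)
  qed
  have "open (UNIV - {0::complex})" by (simp add: open_delete)
  moreover have "fst L = {p \<in> pts (bundleE M T1 T2). fst p \<in> S}" unfolding dom' bundleE_def by simp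
  moreover have "\<forall>p\<in>fst L. fst (snd L p) = snd \<kappa> (fst p)" unfolding dom using coord by auto
  ultimately show "\<exists>\<kappa> S Q. \<kappa> \<in> atlas M \<and> open_in M S \<and> S \<subseteq> fst \<kappa> \<and> open Q \<and>
      fst L = {p \<in> pts (bundleE M T1 T2). fst p \<in> S} \<and> (\<forall>p\<in>fst L. fst (snd L p) = snd \<kappa> (fst p)) \<and>
      inj_on (snd L) (fst L) \<and> snd L ` fst L = (snd \<kappa> ` S) \<times> Q"
    using \<kappa>(1-3) inj img by blast
qed

lemma adapted_covector_scale:
  assumes "\<alpha> \<in> adapted_covectors M A B x" "a \<noteq> 0"
  shows "(\<lambda>V. a * \<alpha> V) \<in> adapted_covectors M A B x"
proof -
  have "cov_ext (\<lambda>V. a * \<alpha> V) Z = a * cov_ext \<alpha> Z" for Z by (simp add: cov_ext_def algebra_simps)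
  moreover have "(\<lambda>V. a * \<alpha> V) \<in> covectors M x" using assms(1) by (simp add: adapted_covectors_def covectors_def algebra_simps)
  ultimately show ?thesis using assms by (auto simp: adapted_covectors_def)
qed

lemma adapted_expansion:
  assumes co: "adapted_coframe y \<alpha> \<alpha>1 \<alpha>2"
  shows "\<beta> \<in> adapted_covectors M T1 T2 y \<Longrightarrow>
      (\<And>b a. \<beta> = (\<lambda>V. b * \<alpha> V + a * \<alpha>1 V) \<Longrightarrow> a \<noteq> 0 \<Longrightarrow> thesis) \<Longrightarrow> thesis"
    and "\<beta> \<in> adapted_covectors M T2 T1 y \<Longrightarrow>
      (\<And>b a. \<beta> = (\<lambda>V. b * \<alpha> V + a * \<alpha>2 V) \<Longrightarrow> a \<noteq> 0 \<Longrightarrow> thesis) \<Longrightarrow> thesis"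
proof -
  assume \<beta>: "\<beta> \<in> adapted_covectors M T1 T2 y"
    and that: "\<And>b a. \<beta> = (\<lambda>V. b * \<alpha> V + a * \<alpha>1 V) \<Longrightarrow> a \<noteq> 0 \<Longrightarrow> thesis"
  then have cov: "\<beta> \<in> covectors M y" by (simp add: adapted_covectors_def)
  obtain b b1 b2 where "\<beta> = (\<lambda>V. b * \<alpha> V + b1 * \<alpha>1 V + b2 * \<alpha>2 V)"
    "\<beta> \<in> adapted_covectors M T1 T2 y \<longrightarrow> b1 \<noteq> 0 \<and> b2 = 0"
    "\<beta> \<in> adapted_covectors M T2 T1 y \<longrightarrow> b1 = 0 \<and> b2 \<noteq> 0"
    using covector_expansion[OF co cov] .
  then show thesis using \<beta> by (intro that[of b b1]) simp_all
next
  assume \<beta>: "\<beta> \<in> adapted_covectors M T2 T1 y"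
    and that: "\<And>b a. \<beta> = (\<lambda>V. b * \<alpha> V + a * \<alpha>2 V) \<Longrightarrow> a \<noteq> 0 \<Longrightarrow> thesis"
  then have cov: "\<beta> \<in> covectors M y" by (simp add: adapted_covectors_def)
  obtain b b1 b2 where "\<beta> = (\<lambda>V. b * \<alpha> V + b1 * \<alpha>1 V + b2 * \<alpha>2 V)"
    "\<beta> \<in> adapted_covectors M T1 T2 y \<longrightarrow> b1 \<noteq> 0 \<and> b2 = 0"
    "\<beta> \<in> adapted_covectors M T2 T1 y \<longrightarrow> b1 = 0 \<and> b2 \<noteq> 0"
    using covector_expansion[OF co cov] .
  then show thesis using \<beta> by (intro that[of b b2]) simp_all
qed

lemma has_ext_deriv_unique:
  assumes "has_ext_deriv M \<eta> x \<zeta>" "has_ext_deriv M \<eta> x \<zeta>'" "x \<in> pts M"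
    "V \<in> tangent M x" "W \<in> tangent M x"
  shows "\<zeta> V W = \<zeta>' V W"
proof -
  obtain \<kappa> where \<kappa>: "\<kappa> \<in> atlas M" "x \<in> fst \<kappa>" using manifold_chart_exists[OF M assms(3)] .
  then obtain v w where "V = tvec M \<kappa> x v" "W = tvec M \<kappa> x w"
    using assms(4,5) tangent_eq_range[OF M] by blast
  then show ?thesis using assms(1,2) \<kappa> unfolding has_ext_deriv_def by metis
qed

end

locale contact_manifold = flag_manifold +
  fixes \<theta>
  assumes \<theta>: "contact_form M T1 T2 \<theta>"
begin

lemma \<theta>_fibre: assumes "x \<in> pts M" shows "\<theta> x \<in> covectors M x" "cov_kernel M x (\<theta> x) = cplane T1 T2 x"
  using \<theta> assms unfolding contact_form_def bundleE_def Epts_def by auto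

lemma Xpts_coframe: "(x, \<alpha>1, \<alpha>2) \<in> Xpts M T1 T2 \<theta> \<Longrightarrow> adapted_coframe x (\<theta> x) \<alpha>1 \<alpha>2"
  using \<theta>_fibre unfolding Xpts_def adapted_coframe_def by auto

text \<open>A priori \<open>\<beta>1 = a \<alpha>1 + b \<theta>\<close> and \<open>\<beta>2 = a' \<alpha>2 + c \<theta>\<close>.  The two coframes have the same product
\<open>\<alpha>1 \<and> \<alpha>2 = \<beta>1 \<and> \<beta>2 = d\<theta>\<close>, and comparison of the coefficients gives \<open>a a' = 1\<close> and \<open>b = c = 0\<close>.\<close>

lemma Xpts_fibre:
  assumes p: "(x, \<alpha>1, \<alpha>2) \<in> Xpts M T1 T2 \<theta>" and q: "(x, \<beta>1, \<beta>2) \<in> Xpts M T1 T2 \<theta>"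
  obtains a where "a \<noteq> 0" "\<beta>1 = (\<lambda>V. a * \<alpha>1 V)" "\<beta>2 = (\<lambda>V. inverse a * \<alpha>2 V)"
proof -
  note co = Xpts_coframe[OF p]
  have x: "x \<in> pts M" and \<beta>: "\<beta>1 \<in> adapted_covectors M T1 T2 x" "\<beta>2 \<in> adapted_covectors M T2 T1 x"
    and d: "has_ext_deriv M \<theta> x (\<alpha>1 \<^bold>\<and> \<alpha>2)" "has_ext_deriv M \<theta> x (\<beta>1 \<^bold>\<and> \<beta>2)"
    using p q unfolding Xpts_def by auto
  obtain b a where b1: "\<beta>1 = (\<lambda>V. b * \<theta> x V + a * \<alpha>1 V)" "a \<noteq> 0"
    using adapted_expansion(1)[OF co \<beta>(1)] .
  obtain c a' where b2: "\<beta>2 = (\<lambda>V. c * \<theta> x V + a' * \<alpha>2 V)" "a' \<noteq> 0"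
    using adapted_expansion(2)[OF co \<beta>(2)] .
  obtain U V W where t: "U \<in> tangent M x" "V \<in> tangent M x" "W \<in> tangent M x"
    and vol: "(\<theta> x \<^bold>\<and>\<^sub>2 (\<alpha>1 \<^bold>\<and> \<alpha>2)) U V W \<noteq> 0"
    using coframe_volume_nonzero[OF co] .
  have eq: "(\<alpha>1 \<^bold>\<and> \<alpha>2) V W = (\<beta>1 \<^bold>\<and> \<beta>2) V W" if "V \<in> tangent M x" "W \<in> tangent M x" for V W
    using has_ext_deriv_unique[OF d x that] .
  note e = eq[OF t(1,2), unfolded b1 b2] eq[OF t(1,3), unfolded b1 b2] eq[OF t(2,3), unfolded b1 b2]
  have "(a * a' - 1) * (\<theta> x \<^bold>\<and>\<^sub>2 (\<alpha>1 \<^bold>\<and> \<alpha>2)) U V W = 0"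
    using e unfolding wedge12_def wedge_def by algebra
  then have aa: "a * a' = 1" using vol by simp
  have "(a * c) * (\<theta> x \<^bold>\<and>\<^sub>2 (\<alpha>1 \<^bold>\<and> \<alpha>2)) U V W = 0"
    using e aa unfolding wedge12_def wedge_def by algebra
  then have "c = 0" using vol b1(2) by simp
  have "(a' * b) * (\<theta> x \<^bold>\<and>\<^sub>2 (\<alpha>1 \<^bold>\<and> \<alpha>2)) U V W = 0"
    using e aa unfolding wedge12_def wedge_def by algebra
  then have "b = 0" using vol b2(2) by simp
  have "a' = inverse a" using aa b1(2) by (simp add: field_simps)
  then show thesis using that b1 b2 \<open>b = 0\<close> \<open>c = 0\<close> by simp
qed

lemma Xpts_move:
  assumes "(x, \<alpha>1, \<alpha>2) \<in> Xpts M T1 T2 \<theta>" "a \<noteq> 0"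
  shows "(x, \<lambda>V. a * \<alpha>1 V, \<lambda>V. inverse a * \<alpha>2 V) \<in> Xpts M T1 T2 \<theta>"
proof -
  have "(\<lambda>V. a * \<alpha>1 V) \<^bold>\<and> (\<lambda>V. inverse a * \<alpha>2 V) = \<alpha>1 \<^bold>\<and> \<alpha>2"
    using assms(2) by (intro ext) (simp add: wedge_def field_simps)
  then show ?thesis
    using assms adapted_covector_scale[of \<alpha>1 T1 T2 x a] adapted_covector_scale[of \<alpha>2 T2 T1 x "inverse a"]
    unfolding Xpts_def by auto
qed

lemma X_chart_coord:
  assumes "(x, \<alpha>1, \<alpha>2) \<in> Xpts M T1 T2 \<theta>" "a \<noteq> 0"
  shows "(THE b. b \<noteq> 0 \<and> (\<lambda>V. a * \<alpha>1 V) = (\<lambda>V. b * \<alpha>1 V) \<and>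
    (\<lambda>V. inverse a * \<alpha>2 V) = (\<lambda>V. inverse b * \<alpha>2 V)) = a"
proof (rule the_equality)
  obtain Z where Z: "cov_ext \<alpha>1 Z \<noteq> 0"
    using assms(1) unfolding Xpts_def adapted_covectors_def by auto
  fix b assume "b \<noteq> 0 \<and> (\<lambda>V. a * \<alpha>1 V) = (\<lambda>V. b * \<alpha>1 V) \<and>
    (\<lambda>V. inverse a * \<alpha>2 V) = (\<lambda>V. inverse b * \<alpha>2 V)"
  then have e: "a * \<alpha>1 V = b * \<alpha>1 V" for V by meson
  have "a * cov_ext \<alpha>1 Z = b * cov_ext \<alpha>1 Z"
    using e[of "fst Z"] e[of "snd Z"] unfolding cov_ext_def by algebra
  then show "b = a" using Z by simp
qed (use assms(2) in simp)

lemma X_chart: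
  assumes "L \<in> atlas (bundleX M T1 T2 \<theta>)"
  obtains \<kappa> S \<eta>1 \<eta>2 where "\<kappa> \<in> atlas M" "open_in M S" "S \<subseteq> fst \<kappa>"
    "\<forall>x\<in>S. (x, \<eta>1 x, \<eta>2 x) \<in> Xpts M T1 T2 \<theta>"
    "fst L = {p \<in> Xpts M T1 T2 \<theta>. fst p \<in> S}"
    "fst L = {(x, \<lambda>V. a * \<eta>1 x V, \<lambda>V. inverse a * \<eta>2 x V) | x a. x \<in> S \<and> a \<noteq> 0}"
    "\<forall>x\<in>S. \<forall>a. a \<noteq> 0 \<longrightarrow> snd L (x, \<lambda>V. a * \<eta>1 x V, \<lambda>V. inverse a * \<eta>2 x V) = (snd \<kappa> x, a)"
    "inj_on (snd L) (fst L)"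
proof -
  obtain \<kappa> S \<eta>1 \<eta>2 where
    L: "L = ({(x, \<alpha>1, \<alpha>2) \<in> Xpts M T1 T2 \<theta>. x \<in> S}, \<lambda>(x, \<alpha>1, \<alpha>2). (snd \<kappa> x,
      THE a. a \<noteq> 0 \<and> \<alpha>1 = (\<lambda>V. a * \<eta>1 x V) \<and> \<alpha>2 = (\<lambda>V. inverse a * \<eta>2 x V)))"
    and \<kappa>: "\<kappa> \<in> atlas M" "open_in M S" "S \<subseteq> fst \<kappa>"
    and E': "smooth_form_on M S \<eta>1" "smooth_form_on M S \<eta>2" "\<forall>x\<in>S. (x, \<eta>1 x, \<eta>2 x) \<in> Xpts M T1 T2 \<theta>"
    using assms unfolding bundleX_def mfd.simps mem_Collect_eq by (elim exE conjE) (rule that)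
  have E: "(x, \<eta>1 x, \<eta>2 x) \<in> Xpts M T1 T2 \<theta>" if "x \<in> S" for x using E' that by blast
  have coord: "snd L (x, \<lambda>V. a * \<eta>1 x V, \<lambda>V. inverse a * \<eta>2 x V) = (snd \<kappa> x, a)" if x: "x \<in> S" "a \<noteq> 0" for x a
    using X_chart_coord[OF E[OF x(1)] x(2)] unfolding L by simp
  have dom: "fst L = {(x, \<lambda>V. a * \<eta>1 x V, \<lambda>V. inverse a * \<eta>2 x V) | x a. x \<in> S \<and> a \<noteq> 0}"
  proof (intro set_eqI iffI)
    fix p assume "p \<in> fst L"
    then obtain x \<alpha>1 \<alpha>2 where p: "p = (x, \<alpha>1, \<alpha>2)" "x \<in> S" "(x, \<alpha>1, \<alpha>2) \<in> Xpts M T1 T2 \<theta>" unfolding L by auto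
    obtain a where "a \<noteq> 0" "\<alpha>1 = (\<lambda>V. a * \<eta>1 x V)" "\<alpha>2 = (\<lambda>V. inverse a * \<eta>2 x V)"
      using Xpts_fibre[OF E[OF p(2)] p(3)] .
    then show "p \<in> {(x, \<lambda>V. a * \<eta>1 x V, \<lambda>V. inverse a * \<eta>2 x V) | x a. x \<in> S \<and> a \<noteq> 0}" using p by blast
  next
    fix p assume "p \<in> {(x, \<lambda>V. a * \<eta>1 x V, \<lambda>V. inverse a * \<eta>2 x V) | x a. x \<in> S \<and> a \<noteq> 0}"
    then obtain x a where p: "p = (x, \<lambda>V. a * \<eta>1 x V, \<lambda>V. inverse a * \<eta>2 x V)" "x \<in> S" "a \<noteq> 0" by blast
    then show "p \<in> fst L" using Xpts_move[OF E[OF p(2)] p(3)] unfolding L by auto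
  qed
  have inj: "inj_on (snd L) (fst L)"
  proof (rule inj_onI)
    fix p p' assume pp: "p \<in> fst L" "p' \<in> fst L" "snd L p = snd L p'"
    obtain x a where p: "p = (x, \<lambda>V. a * \<eta>1 x V, \<lambda>V. inverse a * \<eta>2 x V)" "x \<in> S" "a \<noteq> 0"
      using pp(1) unfolding dom by blast
    obtain x' a' where p': "p' = (x', \<lambda>V. a' * \<eta>1 x' V, \<lambda>V. inverse a' * \<eta>2 x' V)" "x' \<in> S" "a' \<noteq> 0"
      using pp(2) unfolding dom by blast
    have "snd \<kappa> x = snd \<kappa> x'" "a = a'"
      using pp(3) unfolding p(1) p'(1) coord[OF p(2,3)] coord[OF p'(2,3)] by simp_all
    moreover from this have "x = x'"
      using inj_onD[OF manifold_chart(1)[OF M \<kappa>(1)]] \<kappa>(3) p(2) p'(2) by blast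
    ultimately show "p = p'" using p p' by simp
  qed
  have dom': "fst L = {p \<in> Xpts M T1 T2 \<theta>. fst p \<in> S}" unfolding L by auto
  show thesis using that[OF \<kappa> E'(3) dom' dom _ inj] coord by blast
qed

lemma fibre_charts_X: "fibre_charts M (bundleX M T1 T2 \<theta>)"
proof
  show "inj_on (snd \<kappa>) (fst \<kappa>)" if "\<kappa> \<in> atlas M" for \<kappa> using manifold_chart(1)[OF M that] .
next
  fix L assume "L \<in> atlas (bundleX M T1 T2 \<theta>)"
  then obtain \<kappa> S \<eta>1 \<eta>2 where \<kappa>: "\<kappa> \<in> atlas M" "open_in M S" "S \<subseteq> fst \<kappa>"
    "\<forall>x\<in>S. (x, \<eta>1 x, \<eta>2 x) \<in> Xpts M T1 T2 \<theta>"
    and dom': "fst L = {p \<in> Xpts M T1 T2 \<theta>. fst p \<in> S}"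
    and dom: "fst L = {(x, \<lambda>V. a * \<eta>1 x V, \<lambda>V. inverse a * \<eta>2 x V) | x a. x \<in> S \<and> a \<noteq> 0}"
    and coord: "\<forall>x\<in>S. \<forall>a. a \<noteq> 0 \<longrightarrow> snd L (x, \<lambda>V. a * \<eta>1 x V, \<lambda>V. inverse a * \<eta>2 x V) = (snd \<kappa> x, a)"
    and inj: "inj_on (snd L) (fst L)"
    by (rule X_chart)
  have img: "snd L ` fst L = (snd \<kappa> ` S) \<times> (UNIV - {0::complex})"
  proof (intro set_eqI iffI)
    fix q assume "q \<in> snd L ` fst L"
    then show "q \<in> (snd \<kappa> ` S) \<times> (UNIV - {0::complex})" unfolding dom using coord by auto
  next
    fix q assume "q \<in> (snd \<kappa> ` S) \<times> (UNIV - {0::complex})"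
    then obtain x l where x: "x \<in> S" "l \<noteq> 0" "q = (snd \<kappa> x, l)" by auto
    then have "snd L (x, \<lambda>V. l * \<eta>1 x V, \<lambda>V. inverse l * \<eta>2 x V) = q" "(x, \<lambda>V. l * \<eta>1 x V, \<lambda>V. inverse l * \<eta>2 x V) \<in> fst L"
      unfolding dom using coord by auto
    then show "q \<in> snd L ` fst L" by (metis image_eqI)
  qed
  have "open (UNIV - {0::complex})" by (simp add: open_delete)
  moreover have "fst L = {p \<in> pts (bundleX M T1 T2 \<theta>). fst p \<in> S}" unfolding dom' bundleX_def by simp
  moreover have "\<forall>p\<in>fst L. fst (snd L p) = snd \<kappa> (fst p)" unfolding dom using coord by auto
  ultimately show "\<exists>\<kappa> S Q. \<kappa> \<in> atlas M \<and> open_in M S \<and> S \<subseteq> fst \<kappa> \<and> open Q \<and>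
      fst L = {p \<in> pts (bundleX M T1 T2 \<theta>). fst p \<in> S} \<and> (\<forall>p\<in>fst L. fst (snd L p) = snd \<kappa> (fst p)) \<and>
      inj_on (snd L) (fst L) \<and> snd L ` fst L = (snd \<kappa> ` S) \<times> Q"
    using \<kappa>(1-3) inj img by blast
qed

end

section \<open>The charts of the coframe bundle Y\<close>

text \<open>Tangent vectors involve first derivatives only, so they transform by the derivative of the transition map
at the point.\<close>

lemma tvec_transition:
  assumes L: "L \<in> atlas P" "L' \<in> atlas P" "p \<in> fst L" "p \<in> fst L'"
    and inj: "inj_on (snd L) (fst L)" "inj_on (snd L') (fst L')"
    and O1: "open O1" "snd L p \<in> O1" "O1 \<subseteq> snd L ` (fst L \<inter> fst L')"
    and d: "(snd L' \<circ> chart_inv L) differentiable (at (snd L p))"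
  shows "tvec P L p w = tvec P L' p (fd (snd L' \<circ> chart_inv L) (snd L p) w)"
proof
  fix g
  let ?t = "snd L' \<circ> chart_inv L"
  have tp: "?t (snd L p) = snd L' p" using chart_inv_left[OF inj(1) L(3)] by simp
  show "tvec P L p w g = tvec P L' p (fd ?t (snd L p) w) g"
  proof (cases "smooth_near P p g")
    case True
    have "fd (g \<circ> chart_inv L) (snd L p) w = fd ((g \<circ> chart_inv L') \<circ> ?t) (snd L p) w"
    proof (rule fd_cong_open[OF O1(1,2)])
      fix z assume "z \<in> O1"
      then obtain q where q: "q \<in> fst L" "q \<in> fst L'" "z = snd L q" using O1(3) by auto
      then show "(g \<circ> chart_inv L) z = ((g \<circ> chart_inv L') \<circ> ?t) z"
        using chart_inv_left[OF inj(1) q(1)] chart_inv_left[OF inj(2) q(2)] by simp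
    qed
    also have "\<dots> = fd (g \<circ> chart_inv L') (?t (snd L p)) (fd ?t (snd L p) w)"
      by (rule fd_compose[OF d]) (unfold tp, rule smooth_near_differentiable[OF True L(2,4)])
    finally show ?thesis using True unfolding tvec_def tp by (simp only: if_True)
  qed (simp add: tvec_def)
qed

context flag_manifold
begin

text \<open>If \<open>\<theta>0 = c \<theta>0'\<close> then the transition map is \<open>(z, l) \<mapsto> (z', c l)\<close>, and near the point \<open>c\<close> is the quotient of the values
of the two sections on a fixed coordinate vector, so it is differentiable.  The tangent space of E
is therefore independent of the chart.\<close>

lemma E_tvec_subset:
  assumes L: "L \<in> atlas (bundleE M T1 T2)" "L' \<in> atlas (bundleE M T1 T2)" "\<epsilon> \<in> fst L" "\<epsilon> \<in> fst L'"
  shows "tvec (bundleE M T1 T2) L \<epsilon> w \<in> range (tvec (bundleE M T1 T2) L' \<epsilon>)"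
proof -
  obtain \<kappa> S \<theta>0 where 1: "\<kappa> \<in> atlas M" "open_in M S" "S \<subseteq> fst \<kappa>" "smooth_form_on M S \<theta>0"
    "\<forall>x\<in>S. (x, \<theta>0 x) \<in> Epts M T1 T2" "fst L = {p \<in> Epts M T1 T2. fst p \<in> S}"
    "fst L = {(x, \<lambda>V. l * \<theta>0 x V) | x l. x \<in> S \<and> l \<noteq> 0}"
    "\<forall>x\<in>S. \<forall>l. snd L (x, \<lambda>V. l * \<theta>0 x V) = (snd \<kappa> x, l)" "inj_on (snd L) (fst L)"
    using E_chart[OF L(1)] .
  obtain \<kappa>' S' \<theta>0' where 2: "\<kappa>' \<in> atlas M" "open_in M S'" "S' \<subseteq> fst \<kappa>'" "smooth_form_on M S' \<theta>0'"
    "\<forall>x\<in>S'. (x, \<theta>0' x) \<in> Epts M T1 T2" "fst L' = {p \<in> Epts M T1 T2. fst p \<in> S'}"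
    "fst L' = {(x, \<lambda>V. l * \<theta>0' x V) | x l. x \<in> S' \<and> l \<noteq> 0}"
    "\<forall>x\<in>S'. \<forall>l. snd L' (x, \<lambda>V. l * \<theta>0' x V) = (snd \<kappa>' x, l)" "inj_on (snd L') (fst L')"
    using E_chart[OF L(2)] .
  obtain x l0 where \<epsilon>: "\<epsilon> = (x, \<lambda>V. l0 * \<theta>0 x V)" "x \<in> S" "l0 \<noteq> 0" using L(3) unfolding 1(7) by blast
  have xS': "x \<in> S'" using L(4) unfolding 2(6) \<epsilon>(1) by simp
  have inv: "chart_inv \<kappa> (snd \<kappa> y) = y" if "y \<in> S" for y
    using chart_inv_left[OF manifold_chart(1)[OF M 1(1)]] 1(3) that by blast
  have fib: "y \<in> pts M" "\<theta>0 y \<in> covectors M y" "cov_kernel M y (\<theta>0 y) = cplane T1 T2 y" if "y \<in> S" for y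
    using 1(5) that unfolding Epts_def by auto
  have fib': "\<theta>0' y \<in> covectors M y" "cov_kernel M y (\<theta>0' y) = cplane T1 T2 y" if "y \<in> S'" for y
    using 2(5) that unfolding Epts_def by auto
  obtain U where "U \<in> tangent M x" "\<theta>0' x U \<noteq> 0"
    using contact_covector_nonzero[OF fib(1)[OF \<epsilon>(2)] fib'[OF xS']] .
  then obtain v where v: "\<theta>0' x (tvec M \<kappa> x v) \<noteq> 0"
    using tangent_eq_range[OF M 1(1) subsetD[OF 1(3) \<epsilon>(2)]] by auto
  define h h' where "h = local_form M \<kappa> \<theta>0 v" and "h' = local_form M \<kappa> \<theta>0' v"
  define A where "A = snd \<kappa> ` (S \<inter> fst \<kappa>) \<inter> snd \<kappa> ` (S' \<inter> fst \<kappa>)"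
  have sm: "smooth_on (snd \<kappa> ` (S \<inter> fst \<kappa>)) h" "smooth_on (snd \<kappa> ` (S' \<inter> fst \<kappa>)) h'"
    using 1(1,4) 2(4) unfolding smooth_form_on_def h_def h'_def by blast+
  have A: "open A" unfolding A_def using 1(1,2) 2(2) by (intro open_Int) (auto simp: open_in_def)
  have A_mem: "\<exists>y. y \<in> S \<and> y \<in> S' \<and> z = snd \<kappa> y" if z: "z \<in> A" for z
  proof -
    obtain y y' where y: "y \<in> S" "y' \<in> S'" "y \<in> fst \<kappa>" "y' \<in> fst \<kappa>" "z = snd \<kappa> y" "z = snd \<kappa> y'"
      using z unfolding A_def by blast
    then have "y = y'" using inj_onD[OF manifold_chart(1)[OF M 1(1)], of y y'] by simp
    then show ?thesis using y by blast
  qed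
  have xA: "snd \<kappa> x \<in> A" using \<epsilon>(2) xS' 1(3) unfolding A_def by blast
  define B where "B = A \<inter> h' -` (- {0})"
  have B: "open B"
    unfolding B_def
  proof (rule continuous_open_preimage)
    show "continuous_on A h'"
      by (rule continuous_on_subset[OF smooth_on_continuous[OF sm(2)]]) (simp add: A_def)
  qed (use A in auto)
  have xB: "snd \<kappa> x \<in> B" using xA v inv[OF \<epsilon>(2)] by (simp add: B_def h'_def local_form_def)
  define O1 where "O1 = B \<times> (UNIV - {0::complex})"
  have O1: "open O1" unfolding O1_def by (rule open_Times[OF B]) (simp add: open_delete)
  have Lp: "snd L \<epsilon> = (snd \<kappa> x, l0)" using 1(8) \<epsilon> by simp
  have O1p: "snd L \<epsilon> \<in> O1" using xB \<epsilon>(3) unfolding Lp O1_def by simp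
  let ?T = "\<lambda>p. ((snd \<kappa>' \<circ> chart_inv \<kappa>) (fst p), snd p * (h (fst p) / h' (fst p)))"
  have on_O1: "\<exists>q. q \<in> fst L \<and> q \<in> fst L' \<and> snd L q = p \<and> (snd L' \<circ> chart_inv L) p = ?T p" if p: "p \<in> O1" for p
  proof -
    obtain z l where zl: "p = (z, l)" "z \<in> A" "h' z \<noteq> 0" "l \<noteq> 0"
      using p unfolding O1_def B_def by auto
    obtain y where y: "y \<in> S" "y \<in> S'" "z = snd \<kappa> y" using A_mem[OF zl(2)] by blast
    let ?q = "(y, \<lambda>V. l * \<theta>0 y V)"
    obtain c where c: "\<theta>0 y = (\<lambda>V. c * \<theta>0' y V)" "c \<noteq> 0"
      using contact_covectors_proportional[OF fib(1)[OF y(1)] fib'[OF y(2)] fib(2,3)[OF y(1)]] by blast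
    have q: "?q \<in> fst L" "snd L ?q = p" unfolding 1(7) using 1(8) y zl by auto
    have q2: "?q = (y, \<lambda>V. (l * c) * \<theta>0' y V)" unfolding c(1) by (simp add: mult.assoc)
    have "?q \<in> fst L'" unfolding q2 2(7) using y(2) zl(4) c(2) by auto
    moreover have "snd L' ?q = (snd \<kappa>' y, l * c)" unfolding q2 using 2(8) y(2) by blast
    moreover have "h z = c * h' z" unfolding h_def h'_def local_form_def y(3) inv[OF y(1)] by (simp add: c(1))
    then have "c = h z / h' z" using zl(3) by simp
    moreover have "chart_inv L p = ?q" using chart_inv_left[OF 1(9) q(1)] q(2) by simp
    moreover have "chart_inv \<kappa> z = y" using inv[OF y(1)] y(3) by simp
    ultimately show ?thesis using q zl(1) by auto
  qed
  have sub: "O1 \<subseteq> snd L ` (fst L \<inter> fst L')" using on_O1 by blast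
  have dT: "?T differentiable (at (snd \<kappa> x, l0))"
  proof -
    have f: "fst differentiable (at (snd \<kappa> x, l0))" "snd differentiable (at (snd \<kappa> x, l0))"
      by (intro bounded_linear_imp_differentiable bounded_linear_fst bounded_linear_snd)+
    have comp: "(\<lambda>p. k (fst p)) differentiable (at (snd \<kappa> x, l0))" if "k differentiable (at (snd \<kappa> x))" for k :: "'v \<Rightarrow> 'k::real_normed_vector"
      using differentiable_compose[of k fst "(snd \<kappa> x, l0)" UNIV] that f(1) by simp
    have xm: "snd \<kappa> x \<in> snd \<kappa> ` (S \<inter> fst \<kappa>)" "snd \<kappa> x \<in> snd \<kappa> ` (S' \<inter> fst \<kappa>)" using xA unfolding A_def by blast+
    have "x \<in> fst \<kappa> \<inter> fst \<kappa>'" using \<epsilon>(2) xS' 1(3) 2(3) by blast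
    then have t: "(snd \<kappa>' \<circ> chart_inv \<kappa>) differentiable (at (snd \<kappa> x))"
      by (intro smooth_on_differentiable[OF manifold_transition(2)[OF M 1(1) 2(1)]] imageI)
    have hd: "h differentiable (at (snd \<kappa> x))" "h' differentiable (at (snd \<kappa> x))"
      using smooth_on_differentiable sm xm by blast+
    have "h' (fst (snd \<kappa> x, l0)) \<noteq> 0" using xB by (simp add: B_def)
    then show ?thesis
      by (intro differentiable_Pair differentiable_mult differentiable_divide comp t hd f) simp
  qed
  have "(snd L' \<circ> chart_inv L) differentiable (at (snd L \<epsilon>))"
    using differentiable_cong_open[OF O1 O1p, of "snd L' \<circ> chart_inv L" ?T] on_O1 dT unfolding Lp by blast
  from tvec_transition[OF L 1(9) 2(9) O1 O1p sub this] show ?thesis by blast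
qed

lemma E_tangent_eq_range:
  assumes "L \<in> atlas (bundleE M T1 T2)" "\<epsilon> \<in> fst L"
  shows "tangent (bundleE M T1 T2) \<epsilon> = range (tvec (bundleE M T1 T2) L \<epsilon>)"
proof
  show "tangent (bundleE M T1 T2) \<epsilon> \<subseteq> range (tvec (bundleE M T1 T2) L \<epsilon>)"
    using E_tvec_subset[OF _ assms(1) _ assms(2)] unfolding tangent_def by auto
qed (use tvec_in_tangent[OF assms] in auto)

end

lemma covectors_add:
  assumes "\<alpha> \<in> covectors N x" "\<beta> \<in> covectors N x"
  shows "(\<lambda>V. \<alpha> V + \<beta> V) \<in> covectors N x"
  using assms by (simp add: covectors_def algebra_simps)

lemma covectors_scale:
  assumes "\<alpha> \<in> covectors N x"
  shows "(\<lambda>V. c * \<alpha> V) \<in> covectors N x"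
  using assms by (simp add: covectors_def algebra_simps)

lemma lift_combination:
  "lift P N f p (\<lambda>V. a * \<alpha> V + b * \<beta> V) = (\<lambda>V. a * lift P N f p \<alpha> V + b * lift P N f p \<beta> V)"
  by (auto simp: lift_def)

locale E_point = flag_manifold +
  fixes L x \<alpha>
  assumes L: "L \<in> atlas (bundleE M T1 T2)" "(x, \<alpha>) \<in> fst L"
begin

abbreviation "E \<equiv> bundleE M T1 T2"
abbreviation "up \<equiv> lift E M fst (x, \<alpha>)"

lemma x_\<alpha>: "x \<in> pts M" "\<alpha> \<in> covectors M x" "cov_kernel M x \<alpha> = cplane T1 T2 x"
proof -
  obtain \<kappa> S \<theta>0 where 1: "\<kappa> \<in> atlas M" "open_in M S" "S \<subseteq> fst \<kappa>" "smooth_form_on M S \<theta>0"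
    "\<forall>x\<in>S. (x, \<theta>0 x) \<in> Epts M T1 T2" "fst L = {p \<in> Epts M T1 T2. fst p \<in> S}"
    "fst L = {(x, \<lambda>V. l * \<theta>0 x V) | x l. x \<in> S \<and> l \<noteq> 0}"
    "\<forall>x\<in>S. \<forall>l. snd L (x, \<lambda>V. l * \<theta>0 x V) = (snd \<kappa> x, l)" "inj_on (snd L) (fst L)"
    using E_chart[OF L(1)] .
  have "(x, \<alpha>) \<in> Epts M T1 T2" using L(2) unfolding 1(6) by blast
  then show "x \<in> pts M" "\<alpha> \<in> covectors M x" "cov_kernel M x \<alpha> = cplane T1 T2 x"
    unfolding Epts_def by auto
qed

lemma tangent_lift:
  assumes "V \<in> tangent M x"
  obtains V' where "V' \<in> tangent E (x, \<alpha>)" "\<forall>\<beta>. up \<beta> V' = \<beta> V"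
proof -
  obtain \<kappa> where \<kappa>: "\<kappa> \<in> atlas M" "fst (x, \<alpha>) \<in> fst \<kappa>"
    "\<forall>w. push M fst (x, \<alpha>) (tvec E L (x, \<alpha>) w) = tvec M \<kappa> (fst (x, \<alpha>)) (fst w)"
    using fibre_charts.push_fst_tvec[OF fibre_charts_E L] .
  obtain v where "V = tvec M \<kappa> x v" using tangent_eq_range[OF M \<kappa>(1)] \<kappa>(2) assms by auto
  then have "push M fst (x, \<alpha>) (tvec E L (x, \<alpha>) (v, 0)) = V" using spec[OF \<kappa>(3), of "(v, 0)"] by simp
  then show thesis
    using tvec_in_tangent[OF L] by (intro that[of "tvec E L (x, \<alpha>) (v, 0)"]) (simp_all add: lift_def)
qed

lemma up_covector:
  assumes "\<beta> \<in> covectors M x"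
  shows "up \<beta> \<in> covectors E (x, \<alpha>)"
proof -
  have t: "tlin a V b W \<in> tangent E (x, \<alpha>)" if "V \<in> tangent E (x, \<alpha>)" "W \<in> tangent E (x, \<alpha>)" for a V b W
    using that unfolding E_tangent_eq_range[OF L] by (auto simp: tvec_tlin[OF L, symmetric])
  have p: "push M fst (x, \<alpha>) V \<in> tangent M x" if "V \<in> tangent E (x, \<alpha>)" for V
    using fibre_charts.push_fst_tangent[OF fibre_charts_E that] by simp
  show ?thesis using assms t p unfolding covectors_def lift_def by (simp add: push_tlin)
qed

lemma tautE_up: "tautE M T1 T2 (x, \<alpha>) = up \<alpha>"
  by (simp add: tautE_def)

lemma E_ext_deriv_unique:
  assumes "has_ext_deriv E \<eta> (x, \<alpha>) \<zeta>" "has_ext_deriv E \<eta> (x, \<alpha>) \<zeta>'"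
    "V \<in> tangent E (x, \<alpha>)" "W \<in> tangent E (x, \<alpha>)"
  shows "\<zeta> V W = \<zeta>' V W"
proof -
  obtain v w where "V = tvec E L (x, \<alpha>) v" "W = tvec E L (x, \<alpha>) w"
    using assms(3,4) unfolding E_tangent_eq_range[OF L] by blast
  moreover have "\<zeta> (tvec E L (x, \<alpha>) v) (tvec E L (x, \<alpha>) w) = \<zeta>' (tvec E L (x, \<alpha>) v) (tvec E L (x, \<alpha>) w)"
    using assms(1,2) L unfolding has_ext_deriv_def by metis
  ultimately show ?thesis by simp
qed

lemma Ypts_D:
  assumes "((x, \<alpha>), w, w1, w2, f) \<in> Ypts M T1 T2"
  obtains \<alpha>1 \<alpha>2 where "w = up \<alpha>" "w1 = up \<alpha>1" "w2 = up \<alpha>2" "adapted_coframe x \<alpha> \<alpha>1 \<alpha>2"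
    "f \<in> covectors E (x, \<alpha>)"
    "has_ext_deriv E (tautE M T1 T2) (x, \<alpha>) (\<lambda>V W. (w \<^bold>\<and> f) V W + (w1 \<^bold>\<and> w2) V W)"
  using assms x_\<alpha> tautE_up unfolding Ypts_def adapted_coframe_def by auto

text \<open>The covectors \<open>w1\<close> and \<open>w2\<close> come from M, which gives their shape with coefficients \<open>a\<close>, \<open>b\<close>, \<open>a'\<close>, \<open>c\<close>.  Both
coframes express the same 2-form \<open>d\<omega>\<close>.  Wedging with \<open>\<omega>\<close> shows \<open>a a' = 1\<close>; what remains says that \<open>\<omega> \<and> h = 0\<close> for
the difference \<open>h\<close> between \<open>f\<close> and its expected value without the \<open>\<omega>\<close>-term, so \<open>h\<close> is a multiple of \<open>\<omega>\<close>.\<close>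

lemma Ypts_fibre:
  assumes p: "((x, \<alpha>), w, \<eta>1, \<eta>2, \<xi>) \<in> Ypts M T1 T2" and q: "((x, \<alpha>), w', w1, w2, f) \<in> Ypts M T1 T2"
  obtains a b c t where "a \<noteq> 0" "w' = w" "w1 = (\<lambda>V. a * \<eta>1 V + b * w V)"
    "w2 = (\<lambda>V. inverse a * \<eta>2 V + c * w V)"
    "f = (\<lambda>V. \<xi> V + a * c * \<eta>1 V - inverse a * b * \<eta>2 V + t * w V)"
proof -
  obtain \<alpha>1 \<alpha>2 where P: "w = up \<alpha>" "\<eta>1 = up \<alpha>1" "\<eta>2 = up \<alpha>2" "adapted_coframe x \<alpha> \<alpha>1 \<alpha>2"
    "\<xi> \<in> covectors E (x, \<alpha>)"
    "has_ext_deriv E (tautE M T1 T2) (x, \<alpha>) (\<lambda>V W. (w \<^bold>\<and> \<xi>) V W + (\<eta>1 \<^bold>\<and> \<eta>2) V W)"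
    using Ypts_D[OF p] .
  obtain \<beta>1 \<beta>2 where Q: "w' = up \<alpha>" "w1 = up \<beta>1" "w2 = up \<beta>2" "adapted_coframe x \<alpha> \<beta>1 \<beta>2"
    "f \<in> covectors E (x, \<alpha>)"
    "has_ext_deriv E (tautE M T1 T2) (x, \<alpha>) (\<lambda>V W. (w' \<^bold>\<and> f) V W + (w1 \<^bold>\<and> w2) V W)"
    using Ypts_D[OF q] .
  have \<beta>: "\<beta>1 \<in> adapted_covectors M T1 T2 x" "\<beta>2 \<in> adapted_covectors M T2 T1 x"
    using Q(4) unfolding adapted_coframe_def by auto
  obtain b a where b1: "\<beta>1 = (\<lambda>V. b * \<alpha> V + a * \<alpha>1 V)" "a \<noteq> 0"
    using adapted_expansion(1)[OF P(4) \<beta>(1)] .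
  obtain c a' where b2: "\<beta>2 = (\<lambda>V. c * \<alpha> V + a' * \<alpha>2 V)" "a' \<noteq> 0"
    using adapted_expansion(2)[OF P(4) \<beta>(2)] .
  have w1: "w1 = (\<lambda>V. b * w V + a * \<eta>1 V)" and w2: "w2 = (\<lambda>V. c * w V + a' * \<eta>2 V)"
    unfolding Q P b1 b2 lift_combination by rule+
  have eq: "(w \<^bold>\<and> \<xi>) V W + (\<eta>1 \<^bold>\<and> \<eta>2) V W = (w \<^bold>\<and> f) V W + (w1 \<^bold>\<and> w2) V W"
    if "V \<in> tangent E (x, \<alpha>)" "W \<in> tangent E (x, \<alpha>)" for V W
    using E_ext_deriv_unique[OF P(6) Q(6) that] P(1) Q(1) by simp
  obtain U V W where t: "U \<in> tangent M x" "V \<in> tangent M x" "W \<in> tangent M x"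
    and vol: "(\<alpha> \<^bold>\<and>\<^sub>2 (\<alpha>1 \<^bold>\<and> \<alpha>2)) U V W \<noteq> 0"
    using coframe_volume_nonzero[OF P(4)] .
  obtain U' where U': "U' \<in> tangent E (x, \<alpha>)" "\<forall>\<beta>. up \<beta> U' = \<beta> U" using tangent_lift[OF t(1)] .
  obtain V' where V': "V' \<in> tangent E (x, \<alpha>)" "\<forall>\<beta>. up \<beta> V' = \<beta> V" using tangent_lift[OF t(2)] .
  obtain W' where W': "W' \<in> tangent E (x, \<alpha>)" "\<forall>\<beta>. up \<beta> W' = \<beta> W" using tangent_lift[OF t(3)] .
  have vol': "(w \<^bold>\<and>\<^sub>2 (\<eta>1 \<^bold>\<and> \<eta>2)) U' V' W' \<noteq> 0"
    using vol U'(2) V'(2) W'(2) unfolding P(1-3) wedge12_def wedge_def by simp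
  note e = eq[OF U'(1) V'(1), unfolded w1 w2] eq[OF U'(1) W'(1), unfolded w1 w2] eq[OF V'(1) W'(1), unfolded w1 w2]
  have "(a * a' - 1) * (w \<^bold>\<and>\<^sub>2 (\<eta>1 \<^bold>\<and> \<eta>2)) U' V' W' = 0"
    using e unfolding wedge12_def wedge_def by algebra
  then have aa: "a * a' = 1" using vol' by simp
  then have a': "a' = inverse a" using b1(2) by (simp add: field_simps)
  define h where "h V = f V - \<xi> V - a * c * \<eta>1 V + a' * b * \<eta>2 V" for V
  have wh: "w V * h W = w W * h V" if "V \<in> tangent E (x, \<alpha>)" "W \<in> tangent E (x, \<alpha>)" for V W
    using eq[OF that] aa unfolding h_def w1 w2 wedge_def by algebra
  obtain Y where Y: "Y \<in> tangent M x" "\<alpha> Y \<noteq> 0" using contact_covector_nonzero[OF x_\<alpha>] .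
  obtain Y' where Y': "Y' \<in> tangent E (x, \<alpha>)" "\<forall>\<beta>. up \<beta> Y' = \<beta> Y" using tangent_lift[OF Y(1)] .
  have wY: "w Y' \<noteq> 0" using Y(2) Y'(2) unfolding P(1) by simp
  define t where "t = h Y' / w Y'"
  have zero: "\<gamma> V = 0" if "\<gamma> \<in> covectors E (x, \<alpha>)" "V \<notin> tangent E (x, \<alpha>)" for \<gamma> V
    using that unfolding covectors_def by blast
  have up0: "up \<beta> V = 0" if "V \<notin> tangent E (x, \<alpha>)" for \<beta> V
    using that by (simp add: lift_def)
  have ht: "h V = t * w V" for V
  proof (cases "V \<in> tangent E (x, \<alpha>)")
    case True
    then show ?thesis using wh[OF Y'(1) True] wY unfolding t_def by (simp add: field_simps)
  next
    case False
    then show ?thesis unfolding h_def by (simp add: zero[OF P(5)] zero[OF Q(5)] P(1-3) up0)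
  qed
  have f: "f = (\<lambda>V. \<xi> V + a * c * \<eta>1 V - inverse a * b * \<eta>2 V + t * w V)"
  proof
    fix V show "f V = \<xi> V + a * c * \<eta>1 V - inverse a * b * \<eta>2 V + t * w V"
      using ht[of V] unfolding h_def a' by (simp add: algebra_simps)
  qed
  show thesis
    by (rule that[OF b1(2) _ _ _ f]) (use P(1) Q(1) w1 w2 a' in \<open>simp_all add: add.commute\<close>)
qed

text \<open>The correction terms in the last covector compensate exactly for the change of \<open>\<omega>\<^sup>1 \<and> \<omega>\<^sup>2\<close>.\<close>

lemma Ypts_move:
  assumes p: "((x, \<alpha>), w, \<eta>1, \<eta>2, \<xi>) \<in> Ypts M T1 T2" and a: "a \<noteq> 0"
  shows "((x, \<alpha>), w, \<lambda>V. a * \<eta>1 V + b * w V, \<lambda>V. inverse a * \<eta>2 V + c * w V,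
    \<lambda>V. \<xi> V + a * c * \<eta>1 V - inverse a * b * \<eta>2 V + t * w V) \<in> Ypts M T1 T2"
proof -
  obtain \<alpha>1 \<alpha>2 where P: "w = up \<alpha>" "\<eta>1 = up \<alpha>1" "\<eta>2 = up \<alpha>2" "adapted_coframe x \<alpha> \<alpha>1 \<alpha>2"
    "\<xi> \<in> covectors E (x, \<alpha>)"
    "has_ext_deriv E (tautE M T1 T2) (x, \<alpha>) (\<lambda>V W. (w \<^bold>\<and> \<xi>) V W + (\<eta>1 \<^bold>\<and> \<eta>2) V W)"
    using Ypts_D[OF p] .
  have cov: "\<alpha> \<in> covectors M x" "\<alpha>1 \<in> adapted_covectors M T1 T2 x" "\<alpha>2 \<in> adapted_covectors M T2 T1 x"
    "\<alpha>1 \<in> covectors M x" "\<alpha>2 \<in> covectors M x"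
    using P(4) unfolding adapted_coframe_def adapted_covectors_def by auto
  obtain Z0 Z1 Z2 where Z: "Z0 \<in> ctangent M x" "Z1 \<in> ctangent M x" "Z2 \<in> ctangent M x"
    "T1 x = {cscale z Z1 | z. True}" "T2 x = {cscale z Z2 | z. True}"
    "cov_ext \<alpha> Z0 = 1" "cov_ext \<alpha> Z1 = 0" "cov_ext \<alpha> Z2 = 0"
    "cov_ext \<alpha>1 Z0 = 0" "cov_ext \<alpha>1 Z1 = 1" "cov_ext \<alpha>1 Z2 = 0"
    "cov_ext \<alpha>2 Z0 = 0" "cov_ext \<alpha>2 Z1 = 0" "cov_ext \<alpha>2 Z2 = 1"
    using dual_frame[OF P(4)] .
  have T: "cov_ext \<alpha> Z = 0" if "Z \<in> T1 x \<or> Z \<in> T2 x" for Z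
    using that Z(2,3,7,8) unfolding Z(4,5) by (auto simp: cov_ext_cscale[OF cov(1)])
  have adapted: "(\<lambda>V. a * \<beta> V + b * \<alpha> V) \<in> adapted_covectors M A B x"
    if \<beta>: "\<beta> \<in> adapted_covectors M A B x" and AB: "A = T1 \<and> B = T2 \<or> A = T2 \<and> B = T1" and a: "a \<noteq> 0" for a b \<beta> A B
  proof -
    have "cov_ext (\<lambda>V. a * \<beta> V + b * \<alpha> V) Z = a * cov_ext \<beta> Z + b * cov_ext \<alpha> Z" for Z
      by (simp add: cov_ext_def algebra_simps)
    moreover have "\<beta> \<in> covectors M x" using \<beta> unfolding adapted_covectors_def by blast
    then have "(\<lambda>V. a * \<beta> V + b * \<alpha> V) \<in> covectors M x"
      by (intro covectors_add covectors_scale cov(1))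
    moreover obtain Z where "Z \<in> A x" "cov_ext \<beta> Z \<noteq> 0" using \<beta> unfolding adapted_covectors_def by blast
    then have "\<exists>Z\<in>A x. a * cov_ext \<beta> Z + b * cov_ext \<alpha> Z \<noteq> 0" using AB a T[of Z] by (intro bexI[of _ Z]) auto
    moreover have "\<forall>Z\<in>B x. a * cov_ext \<beta> Z + b * cov_ext \<alpha> Z = 0"
      using \<beta> AB T unfolding adapted_covectors_def by auto
    ultimately show ?thesis unfolding adapted_covectors_def by simp
  qed
  have w1: "(\<lambda>V. a * \<eta>1 V + b * w V) \<in> up ` adapted_covectors M T1 T2 x"
  proof -
    have "(\<lambda>V. a * \<eta>1 V + b * w V) = up (\<lambda>V. a * \<alpha>1 V + b * \<alpha> V)" unfolding P(1-3) lift_combination ..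
    then show ?thesis using imageI[OF adapted[OF cov(2) _ a, of b]] by simp
  qed
  have w2: "(\<lambda>V. inverse a * \<eta>2 V + c * w V) \<in> up ` adapted_covectors M T2 T1 x"
  proof -
    have "(\<lambda>V. inverse a * \<eta>2 V + c * w V) = up (\<lambda>V. inverse a * \<alpha>2 V + c * \<alpha> V)"
      unfolding P(1-3) lift_combination ..
    then show ?thesis using imageI[OF adapted[OF cov(3) _ , of "inverse a" c]] a by simp
  qed
  let ?f = "\<lambda>V. \<xi> V + a * c * \<eta>1 V - inverse a * b * \<eta>2 V + t * w V"
  have "(\<lambda>V. ((\<xi> V + (a * c) * \<eta>1 V) + (- inverse a * b) * \<eta>2 V) + t * w V) \<in> covectors E (x, \<alpha>)"
    unfolding P(1-3) by (intro covectors_add covectors_scale P(5) up_covector cov)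
  then have f: "?f \<in> covectors E (x, \<alpha>)" by simp
  have "(w \<^bold>\<and> \<xi>) V W + (\<eta>1 \<^bold>\<and> \<eta>2) V W = (w \<^bold>\<and> ?f) V W +
     ((\<lambda>V. a * \<eta>1 V + b * w V) \<^bold>\<and> (\<lambda>V. inverse a * \<eta>2 V + c * w V)) V W" for V W
    using right_inverse[OF a] unfolding wedge_def by algebra
  then have d: "has_ext_deriv E (tautE M T1 T2) (x, \<alpha>) (\<lambda>V W. (w \<^bold>\<and> ?f) V W +
     ((\<lambda>V. a * \<eta>1 V + b * w V) \<^bold>\<and> (\<lambda>V. inverse a * \<eta>2 V + c * w V)) V W)"
    using P(6) by simp
  show ?thesis using p w1 w2 f d unfolding Ypts_def by simp
qed

lemma Ycoord_eq:
  assumes p: "((x, \<alpha>), w, \<eta>1, \<eta>2, \<xi>) \<in> Ypts M T1 T2" and a: "a \<noteq> 0"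
  shows "Ycoord w \<eta>1 \<eta>2 \<xi> (\<lambda>V. a * \<eta>1 V + b * w V) (\<lambda>V. inverse a * \<eta>2 V + c * w V)
    (\<lambda>V. \<xi> V + a * c * \<eta>1 V - inverse a * b * \<eta>2 V + t * w V) = (a, b, c, t)"
  unfolding Ycoord_def
proof (rule the_equality)
  obtain \<alpha>1 \<alpha>2 where P: "w = up \<alpha>" "\<eta>1 = up \<alpha>1" "\<eta>2 = up \<alpha>2" "adapted_coframe x \<alpha> \<alpha>1 \<alpha>2"
    "\<xi> \<in> covectors E (x, \<alpha>)"
    "has_ext_deriv E (tautE M T1 T2) (x, \<alpha>) (\<lambda>V W. (w \<^bold>\<and> \<xi>) V W + (\<eta>1 \<^bold>\<and> \<eta>2) V W)"
    using Ypts_D[OF p] .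
  fix q assume q: "case q of (a', b', c', t') \<Rightarrow> a' \<noteq> 0 \<and>
     (\<lambda>V. a * \<eta>1 V + b * w V) = (\<lambda>V. a' * \<eta>1 V + b' * w V) \<and>
     (\<lambda>V. inverse a * \<eta>2 V + c * w V) = (\<lambda>V. inverse a' * \<eta>2 V + c' * w V) \<and>
     (\<lambda>V. \<xi> V + a * c * \<eta>1 V - inverse a * b * \<eta>2 V + t * w V)
     = (\<lambda>V. \<xi> V + a' * c' * \<eta>1 V - inverse a' * b' * \<eta>2 V + t' * w V)"
  obtain a' b' c' t' where q': "q = (a', b', c', t')" by (metis surj_pair)
  have e: "a * \<eta>1 V + b * w V = a' * \<eta>1 V + b' * w V"
    "inverse a * \<eta>2 V + c * w V = inverse a' * \<eta>2 V + c' * w V"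
    "\<xi> V + a * c * \<eta>1 V - inverse a * b * \<eta>2 V + t * w V
      = \<xi> V + a' * c' * \<eta>1 V - inverse a' * b' * \<eta>2 V + t' * w V" for V
    using q unfolding q' by (simp_all add: fun_eq_iff)
  obtain U V W where t: "U \<in> tangent M x" "V \<in> tangent M x" "W \<in> tangent M x"
    and vol: "(\<alpha> \<^bold>\<and>\<^sub>2 (\<alpha>1 \<^bold>\<and> \<alpha>2)) U V W \<noteq> 0"
    using coframe_volume_nonzero[OF P(4)] .
  obtain U' where U': "U' \<in> tangent E (x, \<alpha>)" "\<forall>\<beta>. up \<beta> U' = \<beta> U" using tangent_lift[OF t(1)] .
  obtain V' where V': "V' \<in> tangent E (x, \<alpha>)" "\<forall>\<beta>. up \<beta> V' = \<beta> V" using tangent_lift[OF t(2)] .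
  obtain W' where W': "W' \<in> tangent E (x, \<alpha>)" "\<forall>\<beta>. up \<beta> W' = \<beta> W" using tangent_lift[OF t(3)] .
  have vol': "(w \<^bold>\<and>\<^sub>2 (\<eta>1 \<^bold>\<and> \<eta>2)) U' V' W' \<noteq> 0"
    using vol U'(2) V'(2) W'(2) unfolding P(1-3) wedge12_def wedge_def by simp
  have "(a - a') * (w \<^bold>\<and>\<^sub>2 (\<eta>1 \<^bold>\<and> \<eta>2)) U' V' W' = 0"
    using e(1)[of U'] e(1)[of V'] e(1)[of W'] unfolding wedge12_def wedge_def by algebra
  then have a': "a' = a" using vol' by simp
  obtain Y where Y: "Y \<in> tangent M x" "\<alpha> Y \<noteq> 0" using contact_covector_nonzero[OF x_\<alpha>] .
  obtain Y' where Y': "Y' \<in> tangent E (x, \<alpha>)" "\<forall>\<beta>. up \<beta> Y' = \<beta> Y" using tangent_lift[OF Y(1)] .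
  have wY: "w Y' \<noteq> 0" using Y(2) Y'(2) unfolding P(1) by simp
  have "b' = b" using e(1)[of Y'] wY unfolding a' by simp
  moreover have "c' = c" using e(2)[of Y'] wY unfolding a' by simp
  moreover have "t' = t" using e(3)[of Y'] wY unfolding a' calculation by simp
  ultimately show "q = (a, b, c, t)" using q' a' by simp
qed (use a in simp)

end

context flag_manifold
begin

text \<open>The point over \<open>\<epsilon>\<close> with fibre coordinates \<open>(a, b, c, t)\<close> relative to the section \<open>(\<eta>1, \<eta>2, \<xi>)\<close>.\<close>

definition Y_point where
  "Y_point \<eta>1 \<eta>2 \<xi> \<epsilon> a b c t = (\<epsilon>, tautE M T1 T2 \<epsilon>, \<lambda>V. a * \<eta>1 \<epsilon> V + b * tautE M T1 T2 \<epsilon> V,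
      \<lambda>V. inverse a * \<eta>2 \<epsilon> V + c * tautE M T1 T2 \<epsilon> V,
      \<lambda>V. \<xi> \<epsilon> V + a * c * \<eta>1 \<epsilon> V - inverse a * b * \<eta>2 \<epsilon> V + t * tautE M T1 T2 \<epsilon> V)"

lemma Y_chart:
  assumes "K \<in> atlas (bundleY M T1 T2)"
  obtains \<kappa> S \<eta>1 \<eta>2 \<xi> where "\<kappa> \<in> atlas (bundleE M T1 T2)" "open_in (bundleE M T1 T2) S" "S \<subseteq> fst \<kappa>"
    "fst K = {p \<in> Ypts M T1 T2. fst p \<in> S}"
    "fst K = {Y_point \<eta>1 \<eta>2 \<xi> \<epsilon> a b c t | \<epsilon> a b c t. \<epsilon> \<in> S \<and> a \<noteq> 0}"
    "\<forall>\<epsilon>\<in>S. \<forall>a b c t. a \<noteq> 0 \<longrightarrow> snd K (Y_point \<eta>1 \<eta>2 \<xi> \<epsilon> a b c t) = (snd \<kappa> \<epsilon>, a, b, c, t)"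
proof -
  obtain \<kappa> S \<eta>1 \<eta>2 \<xi> where
    K: "K = ({(\<epsilon>, w, w1, w2, f) \<in> Ypts M T1 T2. \<epsilon> \<in> S}, \<lambda>(\<epsilon>, w, w1, w2, f).
       (snd \<kappa> \<epsilon>, Ycoord (tautE M T1 T2 \<epsilon>) (\<eta>1 \<epsilon>) (\<eta>2 \<epsilon>) (\<xi> \<epsilon>) w1 w2 f))"
    and \<kappa>: "\<kappa> \<in> atlas (bundleE M T1 T2)" "open_in (bundleE M T1 T2) S" "S \<subseteq> fst \<kappa>"
    and sm: "smooth_form_on (bundleE M T1 T2) S \<eta>1" "smooth_form_on (bundleE M T1 T2) S \<eta>2"
       "smooth_form_on (bundleE M T1 T2) S \<xi>"
    and E': "\<forall>\<epsilon>\<in>S. (\<epsilon>, tautE M T1 T2 \<epsilon>, \<eta>1 \<epsilon>, \<eta>2 \<epsilon>, \<xi> \<epsilon>) \<in> Ypts M T1 T2"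
    using assms unfolding bundleY_def mfd.simps mem_Collect_eq by (elim exE conjE) (rule that)
  let ?pt = "Y_point \<eta>1 \<eta>2 \<xi>"
  have pointE: "E_point M T1 T2 \<kappa> x \<alpha>" if "(x, \<alpha>) \<in> S" for x \<alpha>
    using \<kappa> that by unfold_locales auto
  have coord: "snd K (?pt \<epsilon> a b c t) = (snd \<kappa> \<epsilon>, a, b, c, t)" if \<epsilon>: "\<epsilon> \<in> S" "a \<noteq> 0" for \<epsilon> a b c t
  proof -
    obtain x \<alpha> where x: "\<epsilon> = (x, \<alpha>)" by (metis surj_pair)
    interpret E_point M T1 T2 \<kappa> x \<alpha> using pointE \<epsilon>(1) unfolding x .
    show ?thesis
      using Ycoord_eq[OF bspec[OF E' \<epsilon>(1), unfolded x] \<epsilon>(2), of b c t] unfolding K Y_point_def x by simp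
  qed
  have dom: "fst K = {?pt \<epsilon> a b c t | \<epsilon> a b c t. \<epsilon> \<in> S \<and> a \<noteq> 0}"
  proof (intro set_eqI iffI)
    fix p assume "p \<in> fst K"
    then obtain x \<alpha> w w1 w2 f where p: "p = ((x, \<alpha>), w, w1, w2, f)" "(x, \<alpha>) \<in> S"
      "((x, \<alpha>), w, w1, w2, f) \<in> Ypts M T1 T2" unfolding K by auto
    interpret E_point M T1 T2 \<kappa> x \<alpha> using pointE p(2) .
    obtain a b c t where "a \<noteq> 0" "w = tautE M T1 T2 (x, \<alpha>)" "w1 = (\<lambda>V. a * \<eta>1 (x, \<alpha>) V + b * tautE M T1 T2 (x, \<alpha>) V)"
      "w2 = (\<lambda>V. inverse a * \<eta>2 (x, \<alpha>) V + c * tautE M T1 T2 (x, \<alpha>) V)"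
      "f = (\<lambda>V. \<xi> (x, \<alpha>) V + a * c * \<eta>1 (x, \<alpha>) V - inverse a * b * \<eta>2 (x, \<alpha>) V + t * tautE M T1 T2 (x, \<alpha>) V)"
      using Ypts_fibre[OF bspec[OF E' p(2)] p(3)] .
    then have "p = ?pt (x, \<alpha>) a b c t" unfolding p(1) Y_point_def by simp
    then show "p \<in> {?pt \<epsilon> a b c t | \<epsilon> a b c t. \<epsilon> \<in> S \<and> a \<noteq> 0}" using p(2) \<open>a \<noteq> 0\<close> by blast
  next
    fix p assume "p \<in> {?pt \<epsilon> a b c t | \<epsilon> a b c t. \<epsilon> \<in> S \<and> a \<noteq> 0}"
    then obtain x \<alpha> a b c t where p: "p = ?pt (x, \<alpha>) a b c t" "(x, \<alpha>) \<in> S" "a \<noteq> 0" by auto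
    interpret E_point M T1 T2 \<kappa> x \<alpha> using pointE p(2) .
    show "p \<in> fst K" using Ypts_move[OF bspec[OF E' p(2)] p(3), of b c t] p(2) unfolding p(1) Y_point_def K by simp
  qed
  have dom': "fst K = {p \<in> Ypts M T1 T2. fst p \<in> S}" unfolding K by auto
  show thesis
    by (rule that[OF \<kappa> dom' dom]) (use coord in blast)
qed

lemma fibre_charts_Y: "fibre_charts (bundleE M T1 T2) (bundleY M T1 T2)"
proof
  show E_inj: "inj_on (snd \<kappa>) (fst \<kappa>)" if "\<kappa> \<in> atlas (bundleE M T1 T2)" for \<kappa>
    using fibre_charts.total_inj[OF fibre_charts_E that] .
  fix K assume "K \<in> atlas (bundleY M T1 T2)"
  then obtain \<kappa> S \<eta>1 \<eta>2 \<xi> where \<kappa>: "\<kappa> \<in> atlas (bundleE M T1 T2)" "open_in (bundleE M T1 T2) S" "S \<subseteq> fst \<kappa>"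
    and dom': "fst K = {p \<in> Ypts M T1 T2. fst p \<in> S}"
    and dom: "fst K = {Y_point \<eta>1 \<eta>2 \<xi> \<epsilon> a b c t | \<epsilon> a b c t. \<epsilon> \<in> S \<and> a \<noteq> 0}"
    and coord: "\<forall>\<epsilon>\<in>S. \<forall>a b c t. a \<noteq> 0 \<longrightarrow> snd K (Y_point \<eta>1 \<eta>2 \<xi> \<epsilon> a b c t) = (snd \<kappa> \<epsilon>, a, b, c, t)"
    by (rule Y_chart)
  let ?pt = "Y_point \<eta>1 \<eta>2 \<xi>"
  have c: "snd K (?pt \<epsilon> a b c t) = (snd \<kappa> \<epsilon>, a, b, c, t)" if "\<epsilon> \<in> S" "a \<noteq> 0" for \<epsilon> a b c t
    using coord that by blast
  have mem: "?pt \<epsilon> a b c t \<in> fst K" if "\<epsilon> \<in> S" "a \<noteq> 0" for \<epsilon> a b c t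
    unfolding dom using that by blast
  have memE: "\<exists>\<epsilon> a b c t. p = ?pt \<epsilon> a b c t \<and> \<epsilon> \<in> S \<and> a \<noteq> 0" if "p \<in> fst K" for p
    using that unfolding dom by blast
  have inj: "inj_on (snd K) (fst K)"
  proof (rule inj_onI)
    fix p p' assume pp: "p \<in> fst K" "p' \<in> fst K" "snd K p = snd K p'"
    obtain \<epsilon> a b c' t where p: "p = ?pt \<epsilon> a b c' t" "\<epsilon> \<in> S" "a \<noteq> 0" using memE[OF pp(1)] by blast
    obtain \<epsilon>' a' b' c'' t' where p': "p' = ?pt \<epsilon>' a' b' c'' t'" "\<epsilon>' \<in> S" "a' \<noteq> 0" using memE[OF pp(2)] by blast
    have "(snd \<kappa> \<epsilon>, a, b, c', t) = (snd \<kappa> \<epsilon>', a', b', c'', t')"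
      using pp(3) unfolding p(1) p'(1) c[OF p(2,3)] c[OF p'(2,3)] .
    moreover from this have "\<epsilon> = \<epsilon>'"
      using inj_onD[OF E_inj[OF \<kappa>(1)], of \<epsilon> \<epsilon>'] \<kappa>(3) p(2) p'(2) by auto
    ultimately show "p = p'" unfolding p(1) p'(1) by simp
  qed
  let ?Q = "(UNIV - {0::complex}) \<times> (UNIV :: (complex \<times> complex \<times> complex) set)"
  have img: "snd K ` fst K = (snd \<kappa> ` S) \<times> ?Q"
  proof (intro set_eqI iffI)
    fix q assume "q \<in> snd K ` fst K"
    then obtain \<epsilon> a b c' t where "q = snd K (?pt \<epsilon> a b c' t)" "\<epsilon> \<in> S" "a \<noteq> 0" using memE by blast
    then show "q \<in> (snd \<kappa> ` S) \<times> ?Q" using c by simp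
  next
    fix q assume "q \<in> (snd \<kappa> ` S) \<times> ?Q"
    moreover obtain z a b c' t where q: "q = (z, a, b, c', t)" by (metis surj_pair)
    ultimately have "z \<in> snd \<kappa> ` S" "a \<noteq> 0" by simp_all
    then obtain \<epsilon> where *: "\<epsilon> \<in> S" "a \<noteq> 0" "q = (snd \<kappa> \<epsilon>, a, b, c', t)" using q by blast
    then have "q = snd K (?pt \<epsilon> a b c' t)" using c by simp
    then show "q \<in> snd K ` fst K" using mem[OF *(1,2)] by blast
  qed
  have "open ?Q" by (intro open_Times) (auto simp: open_delete)
  moreover have "fst K = {p \<in> pts (bundleY M T1 T2). fst p \<in> S}" unfolding dom' bundleY_def by simp
  moreover have "\<forall>p\<in>fst K. fst (snd K p) = snd \<kappa> (fst p)"
  proof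
    fix p assume "p \<in> fst K"
    then obtain \<epsilon> a b c' t where p: "p = ?pt \<epsilon> a b c' t" "\<epsilon> \<in> S" "a \<noteq> 0" using memE by blast
    then show "fst (snd K p) = snd \<kappa> (fst p)" unfolding p(1) c[OF p(2,3)] by (simp add: Y_point_def)
  qed
  ultimately show "\<exists>\<kappa> S Q. \<kappa> \<in> atlas (bundleE M T1 T2) \<and> open_in (bundleE M T1 T2) S \<and> S \<subseteq> fst \<kappa> \<and> open Q \<and>
      fst K = {p \<in> pts (bundleY M T1 T2). fst p \<in> S} \<and> (\<forall>p\<in>fst K. fst (snd K p) = snd \<kappa> (fst p)) \<and>
      inj_on (snd K) (fst K) \<and> snd K ` fst K = (snd \<kappa> ` S) \<times> Q"
    using \<kappa> inj img by blast
qed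

end

section \<open>Pulling back along sections\<close>

lemma has_ext_deriv_cong:
  assumes N: "smooth_manifold N" and x: "x \<in> pts N"
    and \<eta>: "\<And>y. y \<in> pts N \<Longrightarrow> \<eta> y = \<eta>' y"
    and \<zeta>: "\<And>V W. V \<in> tangent N x \<Longrightarrow> W \<in> tangent N x \<Longrightarrow> \<zeta> V W = \<zeta>' V W"
    and d: "has_ext_deriv N \<eta> x \<zeta>"
  shows "has_ext_deriv N \<eta>' x \<zeta>'"
  unfolding has_ext_deriv_def
proof (intro ballI impI)
  fix \<kappa> assume \<kappa>: "\<kappa> \<in> atlas N" "x \<in> fst \<kappa>"
  have op: "open (snd \<kappa> ` fst \<kappa>)" "snd \<kappa> x \<in> snd \<kappa> ` fst \<kappa>" using manifold_chart(2)[OF N \<kappa>(1)] \<kappa>(2) by auto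
  have eq: "local_form N \<kappa> \<eta> v z = local_form N \<kappa> \<eta>' v z" if "z \<in> snd \<kappa> ` fst \<kappa>" for v z
    using \<eta>[OF subsetD[OF manifold_chart(3)[OF N \<kappa>(1)] chart_inv_right(1)[OF that]]]
    by (simp add: local_form_def)
  show "(\<forall>v. local_form N \<kappa> \<eta>' v differentiable (at (snd \<kappa> x))) \<and>
      (\<forall>v w. fd (local_form N \<kappa> \<eta>' w) (snd \<kappa> x) v - fd (local_form N \<kappa> \<eta>' v) (snd \<kappa> x) w
        = \<zeta>' (tvec N \<kappa> x v) (tvec N \<kappa> x w))"
  proof (intro conjI allI)
    fix v show "local_form N \<kappa> \<eta>' v differentiable (at (snd \<kappa> x))"
      using d \<kappa> differentiable_cong_open[OF op, of "local_form N \<kappa> \<eta> v" "local_form N \<kappa> \<eta>' v"] eq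
      unfolding has_ext_deriv_def by blast
  next
    fix v w
    have "fd (local_form N \<kappa> \<eta>' b) (snd \<kappa> x) a = fd (local_form N \<kappa> \<eta> b) (snd \<kappa> x) a" for a b
      by (rule fd_cong_open[OF op]) (simp add: eq)
    then show "fd (local_form N \<kappa> \<eta>' w) (snd \<kappa> x) v - fd (local_form N \<kappa> \<eta>' v) (snd \<kappa> x) w
        = \<zeta>' (tvec N \<kappa> x v) (tvec N \<kappa> x w)"
      using d \<kappa> \<zeta>[OF tvec_in_tangent[OF \<kappa>] tvec_in_tangent[OF \<kappa>]] unfolding has_ext_deriv_def by simp
  qed
qed

lemma has_ext_deriv_zero: "has_ext_deriv N (\<lambda>y V. 0) x (\<lambda>V W. 0)"
proof -
  have "local_form N \<kappa> (\<lambda>y V. 0) v = (\<lambda>z. 0)" for \<kappa> v by (simp add: local_form_def fun_eq_iff)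
  then show ?thesis unfolding has_ext_deriv_def by (simp add: frechet_derivative_const)
qed

lemma tvec_cong:
  assumes N: "smooth_manifold N" and \<kappa>: "\<kappa> \<in> atlas N" "x \<in> fst \<kappa>"
    and eq: "\<And>y. y \<in> pts N \<Longrightarrow> f y = g y"
  shows "tvec N \<kappa> x v f = tvec N \<kappa> x v g"
proof -
  have z: "(f \<circ> chart_inv \<mu>) z = (g \<circ> chart_inv \<mu>) z" if "\<mu> \<in> atlas N" "z \<in> snd \<mu> ` fst \<mu>" for \<mu> z
    using eq[OF subsetD[OF manifold_chart(3)[OF N that(1)] chart_inv_right(1)[OF that(2)]]] by simp
  have "smooth_on (snd \<mu> ` (S \<inter> fst \<mu>)) (f \<circ> chart_inv \<mu>) = smooth_on (snd \<mu> ` (S \<inter> fst \<mu>)) (g \<circ> chart_inv \<mu>)"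
    if S: "open_in N S" and \<mu>: "\<mu> \<in> atlas N" for S \<mu>
    by (rule smooth_on_cong) (use S \<mu> z[OF \<mu>] in \<open>auto simp: open_in_def\<close>)
  then have "smooth_fun_on N S f = smooth_fun_on N S g" if "open_in N S" for S
    using that unfolding smooth_fun_on_def by blast
  then have sn: "smooth_near N x f = smooth_near N x g" unfolding smooth_near_def by blast
  have "fd (f \<circ> chart_inv \<kappa>) (snd \<kappa> x) v = fd (g \<circ> chart_inv \<kappa>) (snd \<kappa> x) v"
    by (rule fd_cong_open[OF manifold_chart(2)[OF N \<kappa>(1)]]) (use \<kappa>(2) z[OF \<kappa>(1)] in auto)
  then show ?thesis unfolding tvec_def sn by simp
qed

text \<open>The form of smoothness of \<open>f\<close> at \<open>x\<close> under which exterior derivatives can be pulled back.\<close>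

definition has_representations ::
    "('p, 'v::euclidean_space) mfd \<Rightarrow> ('q, 'w::euclidean_space) mfd \<Rightarrow> ('p \<Rightarrow> 'q) \<Rightarrow> 'p \<Rightarrow> bool" where
  "has_representations N P f x \<longleftrightarrow> (\<forall>\<kappa>\<in>atlas N. x \<in> fst \<kappa> \<longrightarrow>
     (\<exists>K Z F. local_representation N P \<kappa> K f Z F \<and> snd \<kappa> x \<in> Z \<and> open (snd K ` fst K)))"

lemma pullback_eq_push: "V \<in> tangent N x \<Longrightarrow> pullback N P f \<eta> x V = \<eta> (f x) (push P f x V)"
  by (simp add: pullback_def lift_def)

lemma has_ext_deriv_pullback:
  assumes N: "smooth_manifold N" and rep: "has_representations N P f x"
    and lin: "\<And>K q. K \<in> atlas P \<Longrightarrow> q \<in> fst K \<Longrightarrow> linear (\<lambda>w. \<eta> q (tvec P K q w))"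
    and d: "has_ext_deriv P \<eta> (f x) \<zeta>"
  shows "has_ext_deriv N (pullback N P f \<eta>) x (\<lambda>V W. \<zeta> (push P f x V) (push P f x W))"
  unfolding has_ext_deriv_def
proof (intro ballI impI)
  fix \<kappa> assume \<kappa>x: "\<kappa> \<in> atlas N" "x \<in> fst \<kappa>"
  obtain K Z F where lr: "local_representation N P \<kappa> K f Z F" and *: "snd \<kappa> x \<in> Z" "open (snd K ` fst K)"
    using rep \<kappa>x unfolding has_representations_def by blast
  interpret local_representation N P \<kappa> K f Z F by (rule lr)
  show "(\<forall>v. local_form N \<kappa> (pullback N P f \<eta>) v differentiable (at (snd \<kappa> x))) \<and>
      (\<forall>v w. fd (local_form N \<kappa> (pullback N P f \<eta>) w) (snd \<kappa> x) v
        - fd (local_form N \<kappa> (pullback N P f \<eta>) v) (snd \<kappa> x) w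
        = \<zeta> (push P f x (tvec N \<kappa> x v)) (push P f x (tvec N \<kappa> x w)))"
    using pullback_ext_deriv[OF \<kappa>x(2) *(1,2) lin[OF K] d] by blast
qed

lemma push_in_tangent:
  assumes N: "smooth_manifold N" and rep: "has_representations N P f x"
    and V: "x \<in> pts N" "V \<in> tangent N x"
  shows "push P f x V \<in> tangent P (f x)"
proof -
  obtain \<kappa> where \<kappa>x: "\<kappa> \<in> atlas N" "x \<in> fst \<kappa>" using manifold_chart_exists[OF N V(1)] .
  obtain K Z F where lr: "local_representation N P \<kappa> K f Z F" and *: "snd \<kappa> x \<in> Z"
    using rep \<kappa>x unfolding has_representations_def by blast
  interpret local_representation N P \<kappa> K f Z F by (rule lr)
  obtain v where v: "V = tvec N \<kappa> x v" using V(2) unfolding tangent_eq_range[OF N \<kappa>x] by blast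
  show ?thesis unfolding v push_tvec[OF \<kappa>x(2) *] by (rule tvec_in_tangent[OF K f_mem(1)[OF \<kappa>x(2) *]])
qed

lemma pullback_covector:
  assumes N: "smooth_manifold N" and rep: "has_representations N P f x" and x: "x \<in> pts N"
    and \<eta>: "\<eta> (f x) \<in> covectors P (f x)"
  shows "pullback N P f \<eta> x \<in> covectors N x"
  using \<eta> push_in_tangent[OF N rep x] tlin_in_tangent[OF N x]
  unfolding covectors_def by (simp add: pullback_def lift_def push_tlin)

context flag_manifold
begin

lemma Y_form_linear:
  assumes K: "K \<in> atlas (bundleY M T1 T2)" "q \<in> fst K"
    and q: "q = (\<epsilon>, w, w1, w2, f)" and \<gamma>: "\<gamma> \<in> {w, w1, w2, f}"
  shows "linear (\<lambda>v. lift (bundleY M T1 T2) (bundleE M T1 T2) fst q \<gamma> (tvec (bundleY M T1 T2) K q v))"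
proof (rule fibre_charts.lift_fst_linear[OF fibre_charts_Y _ K])
  fix \<kappa> assume \<kappa>: "\<kappa> \<in> atlas (bundleE M T1 T2)" "fst q \<in> fst \<kappa>"
  obtain x \<alpha> where \<epsilon>: "\<epsilon> = (x, \<alpha>)" by (metis surj_pair)
  interpret E_point M T1 T2 \<kappa> x \<alpha> using \<kappa> unfolding q \<epsilon> by unfold_locales auto
  have "q \<in> Ypts M T1 T2"
    using subsetD[OF fibre_charts.total_chart_domain[OF fibre_charts_Y K(1)] K(2)] by (simp add: bundleY_def)
  then obtain \<alpha>1 \<alpha>2 where P: "w = up \<alpha>" "w1 = up \<alpha>1" "w2 = up \<alpha>2" "adapted_coframe x \<alpha> \<alpha>1 \<alpha>2"
    "f \<in> covectors E (x, \<alpha>)"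
    "has_ext_deriv E (tautE M T1 T2) (x, \<alpha>) (\<lambda>V W. (w \<^bold>\<and> f) V W + (w1 \<^bold>\<and> w2) V W)"
    unfolding q \<epsilon> by (rule Ypts_D)
  have "\<alpha> \<in> covectors M x" "\<alpha>1 \<in> covectors M x" "\<alpha>2 \<in> covectors M x"
    using P(4) unfolding adapted_coframe_def adapted_covectors_def by auto
  then have "\<gamma> \<in> covectors E (x, \<alpha>)" using \<gamma> up_covector P(5) unfolding P(1-3) by blast
  from covector_linear_tvec[OF this \<kappa>(1)] \<kappa>(2)
  show "linear (\<lambda>v. \<gamma> (tvec E \<kappa> (fst q) v))" unfolding q \<epsilon> by simp
qed

lemma Y_forms_linear:
  assumes K: "K \<in> atlas (bundleY M T1 T2)" "q \<in> fst K"
  shows "linear (\<lambda>v. Yomega1 M T1 T2 q (tvec (bundleY M T1 T2) K q v))"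
    "linear (\<lambda>v. Yomega2 M T1 T2 q (tvec (bundleY M T1 T2) K q v))"
    "linear (\<lambda>v. Yphi M T1 T2 q (tvec (bundleY M T1 T2) K q v))"
proof -
  obtain \<epsilon> w w1 w2 f where q: "q = (\<epsilon>, w, w1, w2, f)" by (metis surj_pair)
  show "linear (\<lambda>v. Yomega1 M T1 T2 q (tvec (bundleY M T1 T2) K q v))"
    "linear (\<lambda>v. Yomega2 M T1 T2 q (tvec (bundleY M T1 T2) K q v))"
    "linear (\<lambda>v. Yphi M T1 T2 q (tvec (bundleY M T1 T2) K q v))"
    using Y_form_linear[OF K q, of w1] Y_form_linear[OF K q, of w2] Y_form_linear[OF K q, of f]
    unfolding Yomega1_def Yomega2_def Yphi_def by (simp_all add: q)
qed

text \<open>A chart of Y around \<open>s x\<close> is needed.  It exists because the pull-back of the tautological form is the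
nonzero covector \<open>\<alpha>\<close>: the push-forward of a vector on which \<open>\<alpha>\<close> does not vanish must be a tangent vector of
Y, and such a vector belongs to a chart.\<close>

lemma Y_section_representations:
  assumes s: "Ysection M T1 T2 s" and x: "x \<in> pts M"
    and \<theta>: "\<alpha> \<in> covectors M x" "cov_kernel M x \<alpha> = cplane T1 T2 x"
    and pb: "pullback M (bundleY M T1 T2) s (Yomega M T1 T2) x = \<alpha>"
  shows "has_representations M (bundleY M T1 T2) s x"
  unfolding has_representations_def
proof (intro ballI impI)
  let ?Y = "bundleY M T1 T2"
  fix \<kappa> assume \<kappa>: "\<kappa> \<in> atlas M" "x \<in> fst \<kappa>"
  obtain U where U: "U \<in> tangent M x" "\<alpha> U \<noteq> 0" using contact_covector_nonzero[OF x \<theta>] .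
  then have "Yomega M T1 T2 (s x) (push ?Y s x U) \<noteq> 0"
    using pb pullback_eq_push[OF U(1), of ?Y s "Yomega M T1 T2"] by simp
  then have "push ?Y s x U \<in> tangent ?Y (s x)"
    unfolding Yomega_def lift_def by meson
  then obtain K where K: "K \<in> atlas ?Y" "s x \<in> fst K" unfolding tangent_def by blast
  let ?Z = "snd \<kappa> ` (fst \<kappa> \<inter> s -` fst K)" and ?F = "snd K \<circ> s \<circ> chart_inv \<kappa>"
  have sm: "open ?Z" "smooth_on ?Z ?F"
    using s \<kappa>(1) K(1) unfolding Ysection_def smooth_map_def by blast+
  have "represents \<kappa> K s ?Z ?F"
    unfolding represents_def using sm chart_inv_left[OF manifold_chart(1)[OF M \<kappa>(1)]] by auto
  then have "local_representation M ?Y \<kappa> K s ?Z ?F"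
    using fibre_charts.total_inj[OF fibre_charts_Y K(1)] M \<kappa>(1) K(1) by unfold_locales
  then show "\<exists>K Z F. local_representation M ?Y \<kappa> K s Z F \<and> snd \<kappa> x \<in> Z \<and> open (snd K ` fst K)"
    using fibre_charts.total_open[OF fibre_charts_Y K(1)] \<kappa>(2) K(2) by blast
qed

end

context contact_manifold
begin

text \<open>The section itself defines a chart of X, in which it is \<open>z \<mapsto> (z, 1)\<close>.\<close>

lemma X_section_representations:
  assumes X: "Xsection M T1 T2 \<theta> \<theta>1 \<theta>2" and x: "x \<in> pts M"
    and \<sigma>: "\<And>x. x \<in> pts M \<Longrightarrow> \<sigma> x = (x, \<theta>1 x, \<theta>2 x)"
  shows "has_representations M (bundleX M T1 T2 \<theta>) \<sigma> x"
  unfolding has_representations_def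
proof (intro ballI impI)
  let ?X = "bundleX M T1 T2 \<theta>"
  fix \<kappa> assume \<kappa>: "\<kappa> \<in> atlas M" "x \<in> fst \<kappa>"
  have pts: "(y, \<theta>1 y, \<theta>2 y) \<in> Xpts M T1 T2 \<theta>" if "y \<in> fst \<kappa>" for y
    using X that manifold_chart(3)[OF M \<kappa>(1)] unfolding Xsection_def bundleX_def by auto
  define K where "K = ({(x, \<alpha>1, \<alpha>2) \<in> Xpts M T1 T2 \<theta>. x \<in> fst \<kappa>}, \<lambda>(x, \<alpha>1, \<alpha>2). (snd \<kappa> x,
      THE a. a \<noteq> 0 \<and> \<alpha>1 = (\<lambda>V. a * \<theta>1 x V) \<and> \<alpha>2 = (\<lambda>V. inverse a * \<theta>2 x V)))"
  have restrict: "smooth_form_on M (fst \<kappa>) \<eta>" if \<eta>: "smooth_form_on M (pts M) \<eta>" for \<eta>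
    unfolding smooth_form_on_def
  proof (intro conjI ballI allI)
    show "\<eta> y \<in> covectors M y" if "y \<in> fst \<kappa>" for y
      using \<eta> that manifold_chart(3)[OF M \<kappa>(1)] unfolding smooth_form_on_def by blast
    fix \<mu> v assume "\<mu> \<in> atlas M"
    then have "smooth_on (snd \<mu> ` (pts M \<inter> fst \<mu>)) (local_form M \<mu> \<eta> v)"
      using \<eta> unfolding smooth_form_on_def by blast
    then show "smooth_on (snd \<mu> ` (fst \<kappa> \<inter> fst \<mu>)) (local_form M \<mu> \<eta> v)"
      by (rule smooth_on_subset) (use manifold_chart(3)[OF M \<kappa>(1)] in blast)
  qed
  have sf: "smooth_form_on M (fst \<kappa>) \<theta>1" "smooth_form_on M (fst \<kappa>) \<theta>2"
    using X restrict unfolding Xsection_def by blast+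
  have K: "K \<in> atlas ?X"
    unfolding bundleX_def mfd.simps mem_Collect_eq
    by (intro exI[of _ \<kappa>] exI[of _ "fst \<kappa>"] exI[of _ \<theta>1] exI[of _ \<theta>2] conjI K_def \<kappa>(1) sf subset_refl
        open_in_chart_domain[OF M \<kappa>(1)] ballI pts)
  have \<sigma>K: "\<sigma> y \<in> fst K \<and> snd K (\<sigma> y) = (snd \<kappa> y, 1)" if y: "y \<in> fst \<kappa>" for y
  proof -
    have "\<sigma> y = (y, \<theta>1 y, \<theta>2 y)" using \<sigma> y manifold_chart(3)[OF M \<kappa>(1)] by blast
    then show ?thesis using X_chart_coord[OF pts[OF y], of 1] pts[OF y] y unfolding K_def by simp
  qed
  have "represents \<kappa> K \<sigma> (snd \<kappa> ` fst \<kappa>) (\<lambda>z. (z, 1))"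
    unfolding represents_def
  proof (intro conjI ballI)
    fix z assume z: "z \<in> snd \<kappa> ` fst \<kappa>"
    show "\<sigma> (chart_inv \<kappa> z) \<in> fst K" "snd K (\<sigma> (chart_inv \<kappa> z)) = (z, 1)"
      using \<sigma>K[OF chart_inv_right(1)[OF z]] chart_inv_right(2)[OF z] by simp_all
  qed (use manifold_chart(2)[OF M \<kappa>(1)] smooth_on_slice in auto)
  then have "local_representation M ?X \<kappa> K \<sigma> (snd \<kappa> ` fst \<kappa>) (\<lambda>z. (z, 1))"
    using fibre_charts.total_inj[OF fibre_charts_X K] M \<kappa>(1) K by unfold_locales
  then show "\<exists>K Z F. local_representation M ?X \<kappa> K \<sigma> Z F \<and> snd \<kappa> x \<in> Z \<and> open (snd K ` fst K)"
    using fibre_charts.total_open[OF fibre_charts_X K] \<kappa>(2) by blast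
qed

lemma pullback_lift_section:
  assumes rep: "has_representations M (bundleX M T1 T2 \<theta>) \<sigma> x" and x: "x \<in> pts M"
    and \<sigma>: "\<And>x. x \<in> pts M \<Longrightarrow> fst (\<sigma> x) = x" and p: "\<sigma> x \<in> pts (bundleX M T1 T2 \<theta>)"
    and \<eta>: "\<eta> (\<sigma> x) = lift (bundleX M T1 T2 \<theta>) M fst (\<sigma> x) \<alpha>" and \<alpha>: "\<alpha> \<in> covectors M x"
  shows "pullback M (bundleX M T1 T2 \<theta>) \<sigma> \<eta> x = \<alpha>"
proof
  fix V
  let ?X = "bundleX M T1 T2 \<theta>"
  show "pullback M ?X \<sigma> \<eta> x V = \<alpha> V"
  proof (cases "V \<in> tangent M x")
    case True
    obtain \<kappa> where \<kappa>: "\<kappa> \<in> atlas M" "x \<in> fst \<kappa>" using manifold_chart_exists[OF M x] .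
    obtain v where v: "V = tvec M \<kappa> x v" using True unfolding tangent_eq_range[OF M \<kappa>] by blast
    have "push M fst (\<sigma> x) (push ?X \<sigma> x V) = V"
    proof
      fix g
      show "push M fst (\<sigma> x) (push ?X \<sigma> x V) g = V g"
      proof (cases "smooth_near M x g")
        case True
        have "V (g \<circ> fst \<circ> \<sigma>) = V g" unfolding v by (rule tvec_cong[OF M \<kappa>]) (simp add: \<sigma>)
        moreover have "smooth_near ?X (\<sigma> x) (g \<circ> fst)"
          using fibre_charts.smooth_near_fst[OF fibre_charts_X p, of g] True \<sigma>[OF x] by simp
        ultimately show ?thesis using True unfolding push_def \<sigma>[OF x] by (simp only: if_True)
      next
        case False
        then show ?thesis using \<sigma>[OF x] v by (simp add: push_def tvec_def)
      qed
    qed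
    then show ?thesis using True push_in_tangent[OF M rep x True]
      by (simp add: pullback_eq_push \<eta> lift_def)
  next
    case False
    then show ?thesis using \<alpha> by (simp add: pullback_def lift_def covectors_def)
  qed
qed

end

section \<open>Comparison of the two structure equations\<close>

context flag_manifold
begin

lemma two_form_coefficients:
  assumes co: "adapted_coframe x \<alpha> \<alpha>1 \<alpha>2"
    and eq: "\<And>V W. V \<in> tangent M x \<Longrightarrow> W \<in> tangent M x \<Longrightarrow>
      p * (\<alpha> \<^bold>\<and> \<alpha>1) V W + q * (\<alpha> \<^bold>\<and> \<alpha>2) V W + r * (\<alpha>1 \<^bold>\<and> \<alpha>2) V W = 0"
  shows "p = 0" "q = 0" "r = 0"
proof -
  obtain U V W where t: "U \<in> tangent M x" "V \<in> tangent M x" "W \<in> tangent M x"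
    and vol: "(\<alpha> \<^bold>\<and>\<^sub>2 (\<alpha>1 \<^bold>\<and> \<alpha>2)) U V W \<noteq> 0"
    using coframe_volume_nonzero[OF co] .
  note e = eq[OF t(1,2)] eq[OF t(1,3)] eq[OF t(2,3)]
  have "p * (\<alpha> \<^bold>\<and>\<^sub>2 (\<alpha>1 \<^bold>\<and> \<alpha>2)) U V W = 0" "q * (\<alpha> \<^bold>\<and>\<^sub>2 (\<alpha>1 \<^bold>\<and> \<alpha>2)) U V W = 0"
    "r * (\<alpha> \<^bold>\<and>\<^sub>2 (\<alpha>1 \<^bold>\<and> \<alpha>2)) U V W = 0"
    using e unfolding wedge12_def wedge_def by algebra+
  then show "p = 0" "q = 0" "r = 0" using vol by simp_all
qed

text \<open>Expand \<open>A - B\<close>, \<open>P1\<close> and \<open>P2\<close> in the coframe.  The first two equations say that \<open>A\<close> and \<open>B\<close> differ by a multiple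
\<open>d \<alpha>\<close>, and determine \<open>P1\<close> and \<open>P2\<close> modulo \<open>\<alpha>\<close>.  The third one is the pull-back of the equation for \<open>d\<phi>\<close>
to a section on which \<open>\<phi>\<close> vanishes, and determines their \<open>\<alpha>\<close>-coefficients.\<close>

lemma compare_structure_equations:
  assumes co: "adapted_coframe x \<alpha> \<alpha>1 \<alpha>2"
    and cov: "A \<in> covectors M x" "B \<in> covectors M x" "P1 \<in> covectors M x" "P2 \<in> covectors M x"
    and 1: "\<And>V W. V \<in> tangent M x \<Longrightarrow> W \<in> tangent M x \<Longrightarrow>
      (\<alpha>1 \<^bold>\<and> A) V W + (\<alpha> \<^bold>\<and> P1) V W = (\<alpha>1 \<^bold>\<and> B) V W + (\<alpha> \<^bold>\<and> (\<lambda>V. t12 * \<alpha>2 V)) V W"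
    and 2: "\<And>V W. V \<in> tangent M x \<Longrightarrow> W \<in> tangent M x \<Longrightarrow>
      - (\<alpha>2 \<^bold>\<and> A) V W + (\<alpha> \<^bold>\<and> P2) V W = - (\<alpha>2 \<^bold>\<and> B) V W + (\<alpha> \<^bold>\<and> (\<lambda>V. t21 * \<alpha>1 V)) V W"
    and 3: "\<And>V W. V \<in> tangent M x \<Longrightarrow> W \<in> tangent M x \<Longrightarrow>
      (\<alpha>1 \<^bold>\<and> P2) V W - (\<alpha>2 \<^bold>\<and> P1) V W + (\<alpha> \<^bold>\<and> (\<lambda>V. e2 * \<alpha>1 V - e1 * \<alpha>2 V + g * \<alpha> V)) V W = 0"
  obtains d where "A = (\<lambda>V. B V + d * \<alpha> V)"
    "P1 = (\<lambda>V. e1 * \<alpha> V + d * \<alpha>1 V + t12 * \<alpha>2 V)"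
    "P2 = (\<lambda>V. e2 * \<alpha> V + t21 * \<alpha>1 V - d * \<alpha>2 V)"
proof -
  have D: "(\<lambda>V. A V + (- 1) * B V) \<in> covectors M x" by (intro covectors_add covectors_scale cov)
  obtain d d1 d2 where d: "(\<lambda>V. A V + (- 1) * B V) = (\<lambda>V. d * \<alpha> V + d1 * \<alpha>1 V + d2 * \<alpha>2 V)"
    using covector_expansion[OF co D] by blast
  obtain p p1 p2 where p: "P1 = (\<lambda>V. p * \<alpha> V + p1 * \<alpha>1 V + p2 * \<alpha>2 V)"
    using covector_expansion[OF co cov(3)] by blast
  obtain q q1 q2 where q: "P2 = (\<lambda>V. q * \<alpha> V + q1 * \<alpha>1 V + q2 * \<alpha>2 V)"
    using covector_expansion[OF co cov(4)] by blast
  have A: "A = (\<lambda>V. B V + (d * \<alpha> V + d1 * \<alpha>1 V + d2 * \<alpha>2 V))"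
  proof
    fix V show "A V = B V + (d * \<alpha> V + d1 * \<alpha>1 V + d2 * \<alpha>2 V)"
      using fun_cong[OF d, of V] by (simp add: algebra_simps)
  qed
  have "(p1 - d) * (\<alpha> \<^bold>\<and> \<alpha>1) V W + (p2 - t12) * (\<alpha> \<^bold>\<and> \<alpha>2) V W + d2 * (\<alpha>1 \<^bold>\<and> \<alpha>2) V W = 0"
    if "V \<in> tangent M x" "W \<in> tangent M x" for V W
    using 1[OF that] unfolding A p wedge_def by algebra
  from two_form_coefficients[OF co this] have c1: "p1 = d" "p2 = t12" "d2 = 0" by simp_all
  have "(q1 - t21) * (\<alpha> \<^bold>\<and> \<alpha>1) V W + (q2 + d) * (\<alpha> \<^bold>\<and> \<alpha>2) V W + d1 * (\<alpha>1 \<^bold>\<and> \<alpha>2) V W = 0"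
    if "V \<in> tangent M x" "W \<in> tangent M x" for V W
    using 2[OF that] unfolding A q wedge_def by algebra
  from two_form_coefficients[OF co this] have "q1 - t21 = 0" "q2 + d = 0" "d1 = 0" by simp_all
  then have c2: "q1 = t21" "q2 = - d" "d1 = 0" by (simp_all add: eq_neg_iff_add_eq_0)
  have "(e2 - q) * (\<alpha> \<^bold>\<and> \<alpha>1) V W + (p - e1) * (\<alpha> \<^bold>\<and> \<alpha>2) V W + 0 * (\<alpha>1 \<^bold>\<and> \<alpha>2) V W = 0"
    if "V \<in> tangent M x" "W \<in> tangent M x" for V W
    using 3[OF that] unfolding p q c1 c2 wedge_def by algebra
  from two_form_coefficients(1,2)[OF co this] have c3: "p = e1" "q = e2" by simp_all
  show thesis by (rule that[of d]) (simp_all add: A p q c1 c2 c3)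
qed

text \<open>The identity \<open>d(c \<theta>) = dc \<and> \<theta> + c d\<theta>\<close>, wedged with \<open>\<theta>\<close> so that the term with \<open>dc\<close> disappears.\<close>

lemma ext_deriv_of_multiple:
  assumes x: "x \<in> pts M" and \<theta>: "\<theta> x \<in> covectors M x" "cov_kernel M x (\<theta> x) = cplane T1 T2 x"
    and mult: "\<And>y. y \<in> pts M \<Longrightarrow> A y = (\<lambda>V. B y V + c y * \<theta> y V)"
    and d: "has_ext_deriv M A x \<zeta>A" "has_ext_deriv M B x \<zeta>B" "has_ext_deriv M \<theta> x \<zeta>"
    and t: "U \<in> tangent M x" "V \<in> tangent M x" "W \<in> tangent M x"
  shows "(\<theta> x \<^bold>\<and>\<^sub>2 \<zeta>A) U V W - (\<theta> x \<^bold>\<and>\<^sub>2 \<zeta>B) U V W = c x * (\<theta> x \<^bold>\<and>\<^sub>2 \<zeta>) U V W"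
proof -
  obtain \<kappa> where \<kappa>: "\<kappa> \<in> atlas M" "x \<in> fst \<kappa>" using manifold_chart_exists[OF M x] .
  note tan = tangent_eq_range[OF M \<kappa>]
  obtain X where X: "X \<in> tangent M x" "\<theta> x X \<noteq> 0" using contact_covector_nonzero[OF x \<theta>] .
  obtain v0 where v0: "\<theta> x (tvec M \<kappa> x v0) \<noteq> 0" using X unfolding tan by blast
  obtain u v w where uvw: "U = tvec M \<kappa> x u" "V = tvec M \<kappa> x v" "W = tvec M \<kappa> x w"
    using t unfolding tan by blast
  define z where "z = snd \<kappa> x"
  define a b h where "a = local_form M \<kappa> A" and "b = local_form M \<kappa> B" and "h = local_form M \<kappa> \<theta>"
  have op: "open (snd \<kappa> ` fst \<kappa>)" "z \<in> snd \<kappa> ` fst \<kappa>"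
    using manifold_chart(2)[OF M \<kappa>(1)] \<kappa>(2) by (auto simp: z_def)
  have zx: "chart_inv \<kappa> z = x" unfolding z_def using chart_inv_left[OF manifold_chart(1)[OF M \<kappa>(1)] \<kappa>(2)] .
  have ab: "a v z' = b v z' + c (chart_inv \<kappa> z') * h v z'" if "z' \<in> snd \<kappa> ` fst \<kappa>" for v z'
    using mult[OF subsetD[OF manifold_chart(3)[OF M \<kappa>(1)] chart_inv_right(1)[OF that]]]
    unfolding a_def b_def h_def local_form_def by simp
  have da: "a v differentiable (at z)" and db: "b v differentiable (at z)" and dh: "h v differentiable (at z)" for v
    using d \<kappa> unfolding has_ext_deriv_def a_def b_def h_def z_def by blast+
  have hz: "h v z = \<theta> x (tvec M \<kappa> x v)" for v unfolding h_def local_form_def zx ..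
  define \<gamma> where "\<gamma> r = (fd (a v0) z r - fd (b v0) z r - c x * fd (h v0) z r) / h v0 z" for r
  \<comment> \<open>Differentiating \<open>(A - B)(v) \<theta>(v0) = (A - B)(v0) \<theta>(v)\<close>, in which \<open>c\<close> does not occur, replaces the
    differentiability of \<open>c\<close>.\<close>
  have key: "fd (a v) z r - fd (b v) z r = \<gamma> r * h v z + c x * fd (h v) z r" for v r
  proof -
    have "fd (\<lambda>y. (a v y - b v y) * h v0 y) z r = fd (\<lambda>y. (a v0 y - b v0 y) * h v y) z r"
      by (rule fd_cong_open[OF op]) (simp add: ab)
    moreover have "fd (\<lambda>y. (a p y - b p y) * h q y) z r
      = (a p z - b p z) * fd (h q) z r + (fd (a p) z r - fd (b p) z r) * h q z" for p q
      by (rule fd_eqI) (intro derivative_intros has_derivative_fd da db dh)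
    ultimately have "(a v z - b v z) * fd (h v0) z r + (fd (a v) z r - fd (b v) z r) * h v0 z
      = (a v0 z - b v0 z) * fd (h v) z r + (fd (a v0) z r - fd (b v0) z r) * h v z" by simp
    then have "c x * h v z * fd (h v0) z r + (fd (a v) z r - fd (b v) z r) * h v0 z
      = c x * h v0 z * fd (h v) z r + (fd (a v0) z r - fd (b v0) z r) * h v z"
      using ab[OF op(2)] zx by simp
    moreover have "h v0 z \<noteq> 0" using v0 hz by simp
    moreover have "\<gamma> r * h v0 z = fd (a v0) z r - fd (b v0) z r - c x * fd (h v0) z r"
      using calculation(2) by (simp add: \<gamma>_def)
    ultimately have "(fd (a v) z r - fd (b v) z r) * h v0 z = (\<gamma> r * h v z + c x * fd (h v) z r) * h v0 z"
      by algebra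
    then show ?thesis using \<open>h v0 z \<noteq> 0\<close> by simp
  qed
  have \<zeta>: "\<zeta>A (tvec M \<kappa> x v) (tvec M \<kappa> x w) = fd (a w) z v - fd (a v) z w"
    "\<zeta>B (tvec M \<kappa> x v) (tvec M \<kappa> x w) = fd (b w) z v - fd (b v) z w"
    "\<zeta> (tvec M \<kappa> x v) (tvec M \<kappa> x w) = fd (h w) z v - fd (h v) z w" for v w
    using d \<kappa> unfolding has_ext_deriv_def a_def b_def h_def z_def by simp_all
  show ?thesis
    unfolding uvw wedge12_def \<zeta> hz[symmetric]
    using key[of u v] key[of u w] key[of v u] key[of v w] key[of w u] key[of w v] by algebra
qed

end

context contact_manifold
begin

lemma X_forms_linear:
  assumes K: "K \<in> atlas (bundleX M T1 T2 \<theta>)" "q \<in> fst K"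
  shows "linear (\<lambda>v. Xtheta1 M T1 T2 \<theta> q (tvec (bundleX M T1 T2 \<theta>) K q v))"
    "linear (\<lambda>v. Xtheta2 M T1 T2 \<theta> q (tvec (bundleX M T1 T2 \<theta>) K q v))"
proof -
  obtain x \<alpha>1 \<alpha>2 where q: "q = (x, \<alpha>1, \<alpha>2)" by (metis surj_pair)
  have "q \<in> Xpts M T1 T2 \<theta>"
    using subsetD[OF fibre_charts.total_chart_domain[OF fibre_charts_X K(1)] K(2)] by (simp add: bundleX_def)
  then have "\<alpha>1 \<in> covectors M (fst q)" "\<alpha>2 \<in> covectors M (fst q)"
    unfolding q Xpts_def adapted_covectors_def by auto
  then have "linear (\<lambda>v. lift (bundleX M T1 T2 \<theta>) M fst q \<alpha>1 (tvec (bundleX M T1 T2 \<theta>) K q v))"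
    "linear (\<lambda>v. lift (bundleX M T1 T2 \<theta>) M fst q \<alpha>2 (tvec (bundleX M T1 T2 \<theta>) K q v))"
    by (auto intro!: fibre_charts.lift_fst_linear[OF fibre_charts_X _ K] covector_linear_tvec)
  then show "linear (\<lambda>v. Xtheta1 M T1 T2 \<theta> q (tvec (bundleX M T1 T2 \<theta>) K q v))"
    "linear (\<lambda>v. Xtheta2 M T1 T2 \<theta> q (tvec (bundleX M T1 T2 \<theta>) K q v))"
    unfolding Xtheta1_def Xtheta2_def by (simp_all add: q)
qed

end

lemma smooth_form_linear:
  assumes "smooth_form_on P (pts P) \<eta>" "fst K \<subseteq> pts P" "K \<in> atlas P" "q \<in> fst K"
  shows "linear (\<lambda>v. \<eta> q (tvec P K q v))"
  by (rule covector_linear_tvec[OF _ assms(3,4)]) (use assms in \<open>auto simp: smooth_form_on_def\<close>)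

locale pseudo_flag_section = contact_manifold +
  fixes \<theta>11 \<tau>1 \<tau>2 \<tau>12 \<tau>21 R W1 W2 R0 R1 R2 \<theta>1 \<theta>2 \<sigma>
  assumes forms: "pseudo_flag_forms M T1 T2 \<theta> \<theta>11 \<tau>1 \<tau>2"
    and funs: "pseudo_flag_functions M T1 T2 \<theta> \<theta>11 \<tau>1 \<tau>2 \<tau>12 \<tau>21 R W1 W2 R0 R1 R2"
    and sec: "Xsection M T1 T2 \<theta> \<theta>1 \<theta>2"
    and \<sigma>: "\<And>x. x \<in> pts M \<Longrightarrow> \<sigma> x = (x, \<theta>1 x, \<theta>2 x)"
begin

abbreviation "X \<equiv> bundleX M T1 T2 \<theta>"
abbreviation "b11 \<equiv> pullback M X \<sigma> \<theta>11"

lemma X_rep: "x \<in> pts M \<Longrightarrow> has_representations M X \<sigma> x"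
  using X_section_representations[OF sec] \<sigma> by blast

lemma \<sigma>_pts: "x \<in> pts M \<Longrightarrow> \<sigma> x \<in> pts X"
  using sec \<sigma> unfolding Xsection_def by simp

lemma coframe: "x \<in> pts M \<Longrightarrow> adapted_coframe x (\<theta> x) (\<theta>1 x) (\<theta>2 x)"
  using \<sigma>_pts \<sigma> Xpts_coframe unfolding bundleX_def by simp

lemma d\<theta>: "x \<in> pts M \<Longrightarrow> has_ext_deriv M \<theta> x (\<theta>1 x \<^bold>\<and> \<theta>2 x)"
  using \<sigma>_pts[of x] \<sigma>[of x] unfolding bundleX_def Xpts_def by simp

lemma section_covectors:
  assumes "x \<in> pts M"
  shows "\<theta> x \<in> covectors M x" "\<theta>1 x \<in> covectors M x" "\<theta>2 x \<in> covectors M x"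
  using coframe[OF assms] unfolding adapted_coframe_def adapted_covectors_def by auto

lemma pullback_coframe:
  assumes x: "x \<in> pts M"
  shows "pullback M X \<sigma> (Xtheta M T1 T2 \<theta>) x = \<theta> x"
    "pullback M X \<sigma> (Xtheta1 M T1 T2 \<theta>) x = \<theta>1 x"
    "pullback M X \<sigma> (Xtheta2 M T1 T2 \<theta>) x = \<theta>2 x"
proof -
  have f: "fst (\<sigma> y) = y" if "y \<in> pts M" for y using \<sigma>[OF that] by simp
  note pl = pullback_lift_section[OF X_rep[OF x] x f \<sigma>_pts[OF x]]
  show "pullback M X \<sigma> (Xtheta M T1 T2 \<theta>) x = \<theta> x"
    by (rule pl[OF _ _ section_covectors(1)[OF x]]) (simp_all add: Xtheta_def pullback_def \<sigma>[OF x])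
  show "pullback M X \<sigma> (Xtheta1 M T1 T2 \<theta>) x = \<theta>1 x"
    by (rule pl[OF _ _ section_covectors(2)[OF x]]) (simp_all add: Xtheta1_def \<sigma>[OF x])
  show "pullback M X \<sigma> (Xtheta2 M T1 T2 \<theta>) x = \<theta>2 x"
    by (rule pl[OF _ _ section_covectors(3)[OF x]]) (simp_all add: Xtheta2_def \<sigma>[OF x])
qed

lemma smooth_\<theta>11: "smooth_form_on X (pts X) \<theta>11"
  using forms unfolding pseudo_flag_forms_def Let_def by blast

lemma b11_covector: "x \<in> pts M \<Longrightarrow> b11 x \<in> covectors M x"
  using pullback_covector[OF M X_rep] smooth_\<theta>11 \<sigma>_pts unfolding smooth_form_on_def by blast

lemma X_structure_equations:
  assumes x: "x \<in> pts M"
  shows "has_ext_deriv M \<theta>1 x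
      (\<lambda>V W. (\<theta>1 x \<^bold>\<and> b11 x) V W + (\<theta> x \<^bold>\<and> (\<lambda>V. \<tau>12 (\<sigma> x) * \<theta>2 x V)) V W)"
    "has_ext_deriv M \<theta>2 x
      (\<lambda>V W. - (\<theta>2 x \<^bold>\<and> b11 x) V W + (\<theta> x \<^bold>\<and> (\<lambda>V. \<tau>21 (\<sigma> x) * \<theta>1 x V)) V W)"
    "has_ext_deriv M b11 x (\<lambda>V W. R (\<sigma> x) * (\<theta>1 x \<^bold>\<and> \<theta>2 x) V W
      + W1 (\<sigma> x) * (\<theta>1 x \<^bold>\<and> \<theta> x) V W + W2 (\<sigma> x) * (\<theta>2 x \<^bold>\<and> \<theta> x) V W)"
proof -
  let ?t = "Xtheta M T1 T2 \<theta>" and ?t1 = "Xtheta1 M T1 T2 \<theta>" and ?t2 = "Xtheta2 M T1 T2 \<theta>"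
  note p = \<sigma>_pts[OF x]
  have d1: "has_ext_deriv X ?t1 (\<sigma> x) (\<lambda>V W. (?t1 (\<sigma> x) \<^bold>\<and> \<theta>11 (\<sigma> x)) V W + (?t (\<sigma> x) \<^bold>\<and> \<tau>1 (\<sigma> x)) V W)"
    and d2: "has_ext_deriv X ?t2 (\<sigma> x) (\<lambda>V W. - (?t2 (\<sigma> x) \<^bold>\<and> \<theta>11 (\<sigma> x)) V W + (?t (\<sigma> x) \<^bold>\<and> \<tau>2 (\<sigma> x)) V W)"
    using forms p unfolding pseudo_flag_forms_def Let_def by blast+
  have tau: "\<forall>V\<in>tangent X (\<sigma> x). \<tau>1 (\<sigma> x) V = \<tau>12 (\<sigma> x) * ?t2 (\<sigma> x) V \<and> \<tau>2 (\<sigma> x) V = \<tau>21 (\<sigma> x) * ?t1 (\<sigma> x) V"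
    and d11: "has_ext_deriv X \<theta>11 (\<sigma> x) (\<lambda>V W. R (\<sigma> x) * (?t1 (\<sigma> x) \<^bold>\<and> ?t2 (\<sigma> x)) V W
      + W1 (\<sigma> x) * (?t1 (\<sigma> x) \<^bold>\<and> ?t (\<sigma> x)) V W + W2 (\<sigma> x) * (?t2 (\<sigma> x) \<^bold>\<and> ?t (\<sigma> x)) V W)"
    using funs p unfolding pseudo_flag_functions_def Let_def by blast+
  have push: "?t (\<sigma> x) (push X \<sigma> x V) = \<theta> x V" "?t1 (\<sigma> x) (push X \<sigma> x V) = \<theta>1 x V"
    "?t2 (\<sigma> x) (push X \<sigma> x V) = \<theta>2 x V" "\<theta>11 (\<sigma> x) (push X \<sigma> x V) = b11 x V"
    "\<tau>1 (\<sigma> x) (push X \<sigma> x V) = \<tau>12 (\<sigma> x) * \<theta>2 x V" "\<tau>2 (\<sigma> x) (push X \<sigma> x V) = \<tau>21 (\<sigma> x) * \<theta>1 x V"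
    if V: "V \<in> tangent M x" for V
    using pullback_coframe[OF x] pullback_eq_push[OF V, where P = X and f = \<sigma>]
      bspec[OF tau push_in_tangent[OF M X_rep[OF x] x V]] by metis+
  note dom = fibre_charts.total_chart_domain[OF fibre_charts_X]
  note pull = has_ext_deriv_pullback[OF M X_rep[OF x]]
  show "has_ext_deriv M \<theta>1 x
      (\<lambda>V W. (\<theta>1 x \<^bold>\<and> b11 x) V W + (\<theta> x \<^bold>\<and> (\<lambda>V. \<tau>12 (\<sigma> x) * \<theta>2 x V)) V W)"
    by (rule has_ext_deriv_cong[OF M x _ _ pull[OF X_forms_linear(1) d1]])
      (simp_all add: pullback_coframe wedge_def push)
  show "has_ext_deriv M \<theta>2 x
      (\<lambda>V W. - (\<theta>2 x \<^bold>\<and> b11 x) V W + (\<theta> x \<^bold>\<and> (\<lambda>V. \<tau>21 (\<sigma> x) * \<theta>1 x V)) V W)"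
    by (rule has_ext_deriv_cong[OF M x _ _ pull[OF X_forms_linear(2) d2]])
      (simp_all add: pullback_coframe wedge_def push)
  show "has_ext_deriv M b11 x (\<lambda>V W. R (\<sigma> x) * (\<theta>1 x \<^bold>\<and> \<theta>2 x) V W
      + W1 (\<sigma> x) * (\<theta>1 x \<^bold>\<and> \<theta> x) V W + W2 (\<sigma> x) * (\<theta>2 x \<^bold>\<and> \<theta> x) V W)"
    by (rule has_ext_deriv_cong[OF M x _ _ pull[OF smooth_form_linear[OF smooth_\<theta>11 dom] d11]])
      (simp_all add: wedge_def push)
qed

end

text \<open>The functions \<open>e1\<close>, \<open>e2\<close> stand for \<open>E\<^sup>1\<close>, \<open>E\<^sup>2\<close> along \<open>\<sigma>\<close>.  They enter as the
coefficients of \<open>s\<^sup>*\<psi>\<close>.\<close>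

locale adapted_section = pseudo_flag_section +
  fixes \<omega>11 \<phi>1 \<phi>2 \<psi> s e1 e2 G
  assumes canonical: "canonical_forms M T1 T2 \<omega>11 \<phi>1 \<phi>2 \<psi>"
    and s: "Ysection M T1 T2 s"
    and s_omega: "\<And>x. x \<in> pts M \<Longrightarrow> pullback M (bundleY M T1 T2) s (Yomega M T1 T2) x = \<theta> x"
    and s_omega1: "\<And>x. x \<in> pts M \<Longrightarrow> pullback M (bundleY M T1 T2) s (Yomega1 M T1 T2) x = \<theta>1 x"
    and s_omega2: "\<And>x. x \<in> pts M \<Longrightarrow> pullback M (bundleY M T1 T2) s (Yomega2 M T1 T2) x = \<theta>2 x"
    and s_phi: "\<And>x. x \<in> pts M \<Longrightarrow> pullback M (bundleY M T1 T2) s (Yphi M T1 T2) x = (\<lambda>V. 0)"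
    and s_psi: "\<And>x V. x \<in> pts M \<Longrightarrow> V \<in> tangent M x \<Longrightarrow>
      pullback M (bundleY M T1 T2) s \<psi> x V = e2 x * \<theta>1 x V - e1 x * \<theta>2 x V + G x * \<theta> x V"
begin

abbreviation "Y \<equiv> bundleY M T1 T2"
abbreviation "a11 \<equiv> pullback M Y s \<omega>11"
abbreviation "p1 \<equiv> pullback M Y s \<phi>1"
abbreviation "p2 \<equiv> pullback M Y s \<phi>2"

lemma Y_rep: "x \<in> pts M \<Longrightarrow> has_representations M Y s x"
  using Y_section_representations[OF s] \<theta>_fibre s_omega by blast

lemma s_pts: "x \<in> pts M \<Longrightarrow> s x \<in> pts Y"
  using s unfolding Ysection_def smooth_map_def by blast

lemma smooth_canonical: "smooth_form_on Y (pts Y) \<omega>11" "smooth_form_on Y (pts Y) \<phi>1" "smooth_form_on Y (pts Y) \<phi>2"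
  using canonical unfolding canonical_forms_def Let_def by blast+

lemma canonical_covectors:
  assumes "x \<in> pts M"
  shows "a11 x \<in> covectors M x" "p1 x \<in> covectors M x" "p2 x \<in> covectors M x"
  using pullback_covector[OF M Y_rep[OF assms] assms] smooth_canonical s_pts[OF assms]
  unfolding smooth_form_on_def by blast+

lemma push_values:
  assumes x: "x \<in> pts M" and V: "V \<in> tangent M x"
  shows "Yomega M T1 T2 (s x) (push Y s x V) = \<theta> x V"
    "Yomega1 M T1 T2 (s x) (push Y s x V) = \<theta>1 x V"
    "Yomega2 M T1 T2 (s x) (push Y s x V) = \<theta>2 x V"
    "Yphi M T1 T2 (s x) (push Y s x V) = 0"
    "\<omega>11 (s x) (push Y s x V) = a11 x V"
    "\<phi>1 (s x) (push Y s x V) = p1 x V"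
    "\<phi>2 (s x) (push Y s x V) = p2 x V"
    "\<psi> (s x) (push Y s x V) = e2 x * \<theta>1 x V - e1 x * \<theta>2 x V + G x * \<theta> x V"
  using s_omega[OF x] s_omega1[OF x] s_omega2[OF x] s_phi[OF x] s_psi[OF x V]
    pullback_eq_push[OF V, where P = Y and f = s] by metis+

lemma Y_structure_equations:
  assumes x: "x \<in> pts M"
  shows "has_ext_deriv M \<theta>1 x (\<lambda>V W. (\<theta>1 x \<^bold>\<and> a11 x) V W + (\<theta> x \<^bold>\<and> p1 x) V W)"
    "has_ext_deriv M \<theta>2 x (\<lambda>V W. - (\<theta>2 x \<^bold>\<and> a11 x) V W + (\<theta> x \<^bold>\<and> p2 x) V W)"
    "has_ext_deriv M (\<lambda>y V. 0) x (\<lambda>V W. (\<theta>1 x \<^bold>\<and> p2 x) V W - (\<theta>2 x \<^bold>\<and> p1 x) V W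
      + (\<theta> x \<^bold>\<and> (\<lambda>V. e2 x * \<theta>1 x V - e1 x * \<theta>2 x V + G x * \<theta> x V)) V W)"
    "has_ext_deriv M a11 x (\<lambda>V W. 3/2 * (\<theta>2 x \<^bold>\<and> p1 x) V W + 3/2 * (\<theta>1 x \<^bold>\<and> p2 x) V W)"
proof -
  let ?w = "Yomega M T1 T2" and ?w1 = "Yomega1 M T1 T2" and ?w2 = "Yomega2 M T1 T2" and ?f = "Yphi M T1 T2"
  have d: "has_ext_deriv Y ?w1 (s x) (\<lambda>V W.
          1/2 * (?w1 (s x) \<^bold>\<and> ?f (s x)) V W + (?w1 (s x) \<^bold>\<and> \<omega>11 (s x)) V W + (?w (s x) \<^bold>\<and> \<phi>1 (s x)) V W)"
    "has_ext_deriv Y ?w2 (s x) (\<lambda>V W.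
          1/2 * (?w2 (s x) \<^bold>\<and> ?f (s x)) V W - (?w2 (s x) \<^bold>\<and> \<omega>11 (s x)) V W + (?w (s x) \<^bold>\<and> \<phi>2 (s x)) V W)"
    "has_ext_deriv Y ?f (s x) (\<lambda>V W.
          (?w1 (s x) \<^bold>\<and> \<phi>2 (s x)) V W - (?w2 (s x) \<^bold>\<and> \<phi>1 (s x)) V W + (?w (s x) \<^bold>\<and> \<psi> (s x)) V W)"
    "has_ext_deriv Y \<omega>11 (s x) (\<lambda>V W.
          3/2 * (?w2 (s x) \<^bold>\<and> \<phi>1 (s x)) V W + 3/2 * (?w1 (s x) \<^bold>\<and> \<phi>2 (s x)) V W)"
    using canonical s_pts[OF x] unfolding canonical_forms_def Let_def by blast+
  note dom = fibre_charts.total_chart_domain[OF fibre_charts_Y]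
  note pull = has_ext_deriv_pullback[OF M Y_rep[OF x]]
  show "has_ext_deriv M \<theta>1 x (\<lambda>V W. (\<theta>1 x \<^bold>\<and> a11 x) V W + (\<theta> x \<^bold>\<and> p1 x) V W)"
    by (rule has_ext_deriv_cong[OF M x _ _ pull[OF Y_forms_linear(1) d(1)]])
      (simp_all add: s_omega1 wedge_def push_values[OF x])
  show "has_ext_deriv M \<theta>2 x (\<lambda>V W. - (\<theta>2 x \<^bold>\<and> a11 x) V W + (\<theta> x \<^bold>\<and> p2 x) V W)"
    by (rule has_ext_deriv_cong[OF M x _ _ pull[OF Y_forms_linear(2) d(2)]])
      (simp_all add: s_omega2 wedge_def push_values[OF x])
  show "has_ext_deriv M (\<lambda>y V. 0) x (\<lambda>V W. (\<theta>1 x \<^bold>\<and> p2 x) V W - (\<theta>2 x \<^bold>\<and> p1 x) V W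
      + (\<theta> x \<^bold>\<and> (\<lambda>V. e2 x * \<theta>1 x V - e1 x * \<theta>2 x V + G x * \<theta> x V)) V W)"
    by (rule has_ext_deriv_cong[OF M x _ _ pull[OF Y_forms_linear(3) d(3)]])
      (simp_all add: s_phi wedge_def push_values[OF x])
  show "has_ext_deriv M a11 x (\<lambda>V W. 3/2 * (\<theta>2 x \<^bold>\<and> p1 x) V W + 3/2 * (\<theta>1 x \<^bold>\<and> p2 x) V W)"
    by (rule has_ext_deriv_cong[OF M x _ _ pull[OF smooth_form_linear[OF smooth_canonical(1) dom] d(4)]])
      (simp_all add: wedge_def push_values[OF x])
qed

lemma connection_comparison:
  assumes x: "x \<in> pts M"
  obtains d where "a11 x = (\<lambda>V. b11 x V + d * \<theta> x V)"
    "p1 x = (\<lambda>V. e1 x * \<theta> x V + d * \<theta>1 x V + \<tau>12 (\<sigma> x) * \<theta>2 x V)"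
    "p2 x = (\<lambda>V. e2 x * \<theta> x V + \<tau>21 (\<sigma> x) * \<theta>1 x V - d * \<theta>2 x V)"
proof (rule compare_structure_equations[OF coframe[OF x] canonical_covectors(1)[OF x] b11_covector[OF x]
      canonical_covectors(2,3)[OF x]])
  note u = has_ext_deriv_unique[OF _ _ x]
  show "(\<theta>1 x \<^bold>\<and> a11 x) V W + (\<theta> x \<^bold>\<and> p1 x) V W
    = (\<theta>1 x \<^bold>\<and> b11 x) V W + (\<theta> x \<^bold>\<and> (\<lambda>V. \<tau>12 (\<sigma> x) * \<theta>2 x V)) V W"
    if "V \<in> tangent M x" "W \<in> tangent M x" for V W
    using u[OF Y_structure_equations(1)[OF x] X_structure_equations(1)[OF x] that] .
  show "- (\<theta>2 x \<^bold>\<and> a11 x) V W + (\<theta> x \<^bold>\<and> p2 x) V W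
    = - (\<theta>2 x \<^bold>\<and> b11 x) V W + (\<theta> x \<^bold>\<and> (\<lambda>V. \<tau>21 (\<sigma> x) * \<theta>1 x V)) V W"
    if "V \<in> tangent M x" "W \<in> tangent M x" for V W
    using u[OF Y_structure_equations(2)[OF x] X_structure_equations(2)[OF x] that] .
  show "(\<theta>1 x \<^bold>\<and> p2 x) V W - (\<theta>2 x \<^bold>\<and> p1 x) V W
      + (\<theta> x \<^bold>\<and> (\<lambda>V. e2 x * \<theta>1 x V - e1 x * \<theta>2 x V + G x * \<theta> x V)) V W = 0"
    if "V \<in> tangent M x" "W \<in> tangent M x" for V W
    using u[OF Y_structure_equations(3)[OF x] has_ext_deriv_zero that] .
qed (rule that)

text \<open>It remains to find the factor \<open>c\<close> in \<open>a11 = b11 + c \<theta>\<close>.  The structure equations give \<open>-3 c\<close> and \<open>R\<close> as the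
coefficients of \<open>\<theta>\<^sup>1 \<and> \<theta>\<^sup>2\<close> in the exterior derivatives of \<open>a11\<close> and \<open>b11\<close>.  These differ by \<open>d(c \<theta>)\<close>, whose coefficient
is \<open>c\<close>, so \<open>c = - R / 4\<close>.\<close>

lemma connection_pullback:
  assumes x: "x \<in> pts M"
  shows "a11 x = (\<lambda>V. b11 x V - R (\<sigma> x) / 4 * \<theta> x V)"
    "p1 x = (\<lambda>V. e1 x * \<theta> x V - R (\<sigma> x) / 4 * \<theta>1 x V + \<tau>12 (\<sigma> x) * \<theta>2 x V)"
    "p2 x = (\<lambda>V. e2 x * \<theta> x V + \<tau>21 (\<sigma> x) * \<theta>1 x V + R (\<sigma> x) / 4 * \<theta>2 x V)"
proof -
  have "\<forall>y\<in>pts M. \<exists>d. a11 y = (\<lambda>V. b11 y V + d * \<theta> y V)"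
  proof
    fix y assume "y \<in> pts M"
    then show "\<exists>d. a11 y = (\<lambda>V. b11 y V + d * \<theta> y V)" by (rule connection_comparison) (rule exI)
  qed
  from bchoice[OF this] obtain c where "\<forall>y\<in>pts M. a11 y = (\<lambda>V. b11 y V + c y * \<theta> y V)" ..
  then have c: "a11 y = (\<lambda>V. b11 y V + c y * \<theta> y V)" if "y \<in> pts M" for y using that by (rule bspec)
  obtain d where d: "a11 x = (\<lambda>V. b11 x V + d * \<theta> x V)"
    "p1 x = (\<lambda>V. e1 x * \<theta> x V + d * \<theta>1 x V + \<tau>12 (\<sigma> x) * \<theta>2 x V)"
    "p2 x = (\<lambda>V. e2 x * \<theta> x V + \<tau>21 (\<sigma> x) * \<theta>1 x V - d * \<theta>2 x V)"
    using connection_comparison[OF x] .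
  obtain U V W where t: "U \<in> tangent M x" "V \<in> tangent M x" "W \<in> tangent M x"
    and vol: "(\<theta> x \<^bold>\<and>\<^sub>2 (\<theta>1 x \<^bold>\<and> \<theta>2 x)) U V W \<noteq> 0"
    using coframe_volume_nonzero[OF coframe[OF x]] .
  obtain Z where Z: "Z \<in> tangent M x" "\<theta> x Z \<noteq> 0" using contact_covector_nonzero[OF x \<theta>_fibre[OF x]] .
  have "b11 x Z + d * \<theta> x Z = b11 x Z + c x * \<theta> x Z" 
    by (rule fun_cong[OF trans[OF sym[OF d(1)] c[OF x]]])
  then have cd: "c x = d" using Z(2) by simp
  have e: "(\<theta> x \<^bold>\<and>\<^sub>2 (\<lambda>V W. 3/2 * (\<theta>2 x \<^bold>\<and> p1 x) V W + 3/2 * (\<theta>1 x \<^bold>\<and> p2 x) V W)) U V W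
    - (\<theta> x \<^bold>\<and>\<^sub>2 (\<lambda>V W. R (\<sigma> x) * (\<theta>1 x \<^bold>\<and> \<theta>2 x) V W
      + W1 (\<sigma> x) * (\<theta>1 x \<^bold>\<and> \<theta> x) V W + W2 (\<sigma> x) * (\<theta>2 x \<^bold>\<and> \<theta> x) V W)) U V W
    = c x * (\<theta> x \<^bold>\<and>\<^sub>2 (\<theta>1 x \<^bold>\<and> \<theta>2 x)) U V W"
    by (rule ext_deriv_of_multiple[OF x \<theta>_fibre[OF x] c Y_structure_equations(4)[OF x]
        X_structure_equations(3)[OF x] d\<theta>[OF x] t])
  have "(- 3 * d - R (\<sigma> x) - d) * (\<theta> x \<^bold>\<and>\<^sub>2 (\<theta>1 x \<^bold>\<and> \<theta>2 x)) U V W = 0"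
    using e unfolding cd d(2,3) wedge12_def wedge_def by (simp add: field_simps) algebra
  then have "- 4 * d = R (\<sigma> x)" using vol by simp
  then have "R (\<sigma> x) = - 4 * d" by simp
  then have dR: "d = - R (\<sigma> x) / 4" by simp
  show "a11 x = (\<lambda>V. b11 x V - R (\<sigma> x) / 4 * \<theta> x V)"
    "p1 x = (\<lambda>V. e1 x * \<theta> x V - R (\<sigma> x) / 4 * \<theta>1 x V + \<tau>12 (\<sigma> x) * \<theta>2 x V)"
    "p2 x = (\<lambda>V. e2 x * \<theta> x V + \<tau>21 (\<sigma> x) * \<theta>1 x V + R (\<sigma> x) / 4 * \<theta>2 x V)"
    unfolding d(1) d(2) d(3) dR by simp_all
qed

end

section \<open>The Chern-Simons form of the adapted connection\<close>

text \<open>The connection matrix with \<open>\<phi> = 0\<close>.  By cyclic symmetry of the trace, \<open>tr(\<pi> \<and> \<pi> \<and> \<pi>)\<close> is three times the sum of the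
products along the two 3-cycles of indices and of the terms \<open>(\<pi>\<^sub>i\<^sub>i - \<pi>\<^sub>j\<^sub>j) \<and> \<pi>\<^sub>i\<^sub>j \<and> \<pi>\<^sub>j\<^sub>i\<close> over \<open>i < j\<close>.  The pair \<open>(1, 3)\<close> contributes
nothing because its diagonal entries agree.\<close>

lemma trace_cube_adapted:
  fixes \<pi> :: "'p tan \<Rightarrow> complex^3^3"
  assumes \<pi>: "\<And>V. \<pi> V = vector [vector [- (1/3) * a V, - p2 V, - (1/4) * ps V],
      vector [t1 V, 2/3 * a V, 1/2 * p1 V], vector [2 * t V, 2 * t2 V, - (1/3) * a V]]"
  shows "trace (mwedge12 \<pi> (mwedge \<pi> \<pi>) U V W) =
    3 * ((p1 \<^bold>\<and>\<^sub>2 (p2 \<^bold>\<and> t)) U V W + 1/2 * (ps \<^bold>\<and>\<^sub>2 (t1 \<^bold>\<and> t2)) U V W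
       + (a \<^bold>\<and>\<^sub>2 (p2 \<^bold>\<and> t1)) U V W + (a \<^bold>\<and>\<^sub>2 (p1 \<^bold>\<and> t2)) U V W)"
  unfolding mwedge12_def mwedge_def trace_def matrix_matrix_mult_def \<pi> wedge12_def wedge_def
  by (simp add: sum_3 vector_3 field_simps)

context adapted_section
begin

lemma Chern_Simons_pullback:
  assumes x: "x \<in> pts M" and t: "U \<in> tangent M x" "V \<in> tangent M x" "W \<in> tangent M x"
  shows "pullback3 Y s (TC2 (adapted_connection M T1 T2 \<omega>11 \<phi>1 \<phi>2 \<psi>)) x U V W =
     1 / (8 * (of_real pi)\<^sup>2) *
     ((1/2 * G x + 1/16 * (R (\<sigma> x))\<^sup>2 - \<tau>12 (\<sigma> x) * \<tau>21 (\<sigma> x)) * (\<theta> x \<^bold>\<and>\<^sub>2 (\<theta>1 x \<^bold>\<and> \<theta>2 x)) U V W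
      + (b11 x \<^bold>\<and>\<^sub>2 (\<lambda>V W. e2 x * (\<theta> x \<^bold>\<and> \<theta>1 x) V W + e1 x * (\<theta> x \<^bold>\<and> \<theta>2 x) V W
            - R (\<sigma> x) / 2 * (\<theta>1 x \<^bold>\<and> \<theta>2 x) V W)) U V W)"
proof -
  let ?ps = "\<lambda>V. e2 x * \<theta>1 x V - e1 x * \<theta>2 x V + G x * \<theta> x V"
  define \<pi> :: "'a tan \<Rightarrow> complex^3^3" where "\<pi> V = vector [
      vector [- (1/3) * a11 x V, - p2 x V, - (1/4) * ?ps V],
      vector [\<theta>1 x V, 2/3 * a11 x V, 1/2 * p1 x V],
      vector [2 * \<theta> x V, 2 * \<theta>2 x V, - (1/3) * a11 x V]]" for V
  have \<pi>: "adapted_connection M T1 T2 \<omega>11 \<phi>1 \<phi>2 \<psi> (s x) (push Y s x V) = \<pi> V" if "V \<in> tangent M x" for V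
    unfolding adapted_connection_def Let_def \<pi>_def push_values[OF x that] by simp
  have scale: "1 / (24 * p) * (3 * c) = 1 / (8 * p) * c" for p c :: complex by simp
  have "pullback3 Y s (TC2 (adapted_connection M T1 T2 \<omega>11 \<phi>1 \<phi>2 \<psi>)) x U V W
    = 1 / (24 * (of_real pi)\<^sup>2) * trace (mwedge12 \<pi> (mwedge \<pi> \<pi>) U V W)"
    unfolding pullback3_def TC2_def mwedge12_def mwedge_def \<pi>[OF t(1)] \<pi>[OF t(2)] \<pi>[OF t(3)] ..
  also have "\<dots> = 1 / (8 * (of_real pi)\<^sup>2) *
      ((p1 x \<^bold>\<and>\<^sub>2 (p2 x \<^bold>\<and> \<theta> x)) U V W + 1/2 * (?ps \<^bold>\<and>\<^sub>2 (\<theta>1 x \<^bold>\<and> \<theta>2 x)) U V W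
       + (a11 x \<^bold>\<and>\<^sub>2 (p2 x \<^bold>\<and> \<theta>1 x)) U V W + (a11 x \<^bold>\<and>\<^sub>2 (p1 x \<^bold>\<and> \<theta>2 x)) U V W)"
    unfolding trace_cube_adapted[of \<pi> "a11 x" "p2 x" ?ps "\<theta>1 x" "p1 x" "\<theta> x" "\<theta>2 x", OF \<pi>_def] by (rule scale)
  also have "(p1 x \<^bold>\<and>\<^sub>2 (p2 x \<^bold>\<and> \<theta> x)) U V W + 1/2 * (?ps \<^bold>\<and>\<^sub>2 (\<theta>1 x \<^bold>\<and> \<theta>2 x)) U V W
       + (a11 x \<^bold>\<and>\<^sub>2 (p2 x \<^bold>\<and> \<theta>1 x)) U V W + (a11 x \<^bold>\<and>\<^sub>2 (p1 x \<^bold>\<and> \<theta>2 x)) U V W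
    = (1/2 * G x + 1/16 * (R (\<sigma> x))\<^sup>2 - \<tau>12 (\<sigma> x) * \<tau>21 (\<sigma> x)) * (\<theta> x \<^bold>\<and>\<^sub>2 (\<theta>1 x \<^bold>\<and> \<theta>2 x)) U V W
      + (b11 x \<^bold>\<and>\<^sub>2 (\<lambda>V W. e2 x * (\<theta> x \<^bold>\<and> \<theta>1 x) V W + e1 x * (\<theta> x \<^bold>\<and> \<theta>2 x) V W
            - R (\<sigma> x) / 2 * (\<theta>1 x \<^bold>\<and> \<theta>2 x) V W)) U V W"
    unfolding connection_pullback[OF x] wedge12_def wedge_def by (simp add: field_simps power2_eq_square)
  finally show ?thesis .
qed

end

theorem proposition7p2:
  fixes M :: "('m, real^3) mfd"
    and T1 T2 :: "'m \<Rightarrow> 'm ctan set"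
    and \<theta> \<theta>1 \<theta>2 :: "'m \<Rightarrow> 'm cov"
    and \<omega>11 \<phi>1 \<phi>2 \<psi> :: "'m ypoint \<Rightarrow> 'm ypoint cov"
    and \<theta>11 \<tau>1 \<tau>2 :: "'m xpoint \<Rightarrow> 'm xpoint cov"
    and \<tau>12 \<tau>21 R W1 W2 R0 R1 R2 E1 E2 :: "'m xpoint \<Rightarrow> complex"
    and \<sigma> :: "'m \<Rightarrow> 'm xpoint"
    and s :: "'m \<Rightarrow> 'm ypoint"
    and G :: "'m \<Rightarrow> complex"
  assumes "smooth_manifold M"
    and "flag_structure M T1 T2"
    and "contact_form M T1 T2 \<theta>"
    and "canonical_forms M T1 T2 \<omega>11 \<phi>1 \<phi>2 \<psi>"
    and "pseudo_flag_forms M T1 T2 \<theta> \<theta>11 \<tau>1 \<tau>2"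
    and "pseudo_flag_functions M T1 T2 \<theta> \<theta>11 \<tau>1 \<tau>2 \<tau>12 \<tau>21 R W1 W2 R0 R1 R2"
    and "\<And>p. E1 p = 2/3 * (W2 p - 1/4 * R2 p)"
    and "\<And>p. E2 p = 2/3 * (W1 p - 1/4 * R1 p)"
    and "Xsection M T1 T2 \<theta> \<theta>1 \<theta>2"
    and "\<And>x. x \<in> pts M \<Longrightarrow> \<sigma> x = (x, \<theta>1 x, \<theta>2 x)"
    and "Ysection M T1 T2 s"
    and "Yfactors_through_X M T1 T2 \<theta> \<sigma> s"
    and "\<And>x. x \<in> pts M \<Longrightarrow> pullback M (bundleY M T1 T2) s (Yomega M T1 T2) x = \<theta> x"
    and "\<And>x. x \<in> pts M \<Longrightarrow> pullback M (bundleY M T1 T2) s (Yomega1 M T1 T2) x = \<theta>1 x"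
    and "\<And>x. x \<in> pts M \<Longrightarrow> pullback M (bundleY M T1 T2) s (Yomega2 M T1 T2) x = \<theta>2 x"
    and "\<And>x. x \<in> pts M \<Longrightarrow> pullback M (bundleY M T1 T2) s (Yphi M T1 T2) x = (\<lambda>V. 0)"
    and "\<And>x V. x \<in> pts M \<Longrightarrow> V \<in> tangent M x \<Longrightarrow>
           pullback M (bundleY M T1 T2) s \<psi> x V = E2 (\<sigma> x) * \<theta>1 x V - E1 (\<sigma> x) * \<theta>2 x V + G x * \<theta> x V"
  shows "\<forall>x\<in>pts M. \<forall>U\<in>tangent M x. \<forall>V\<in>tangent M x. \<forall>W\<in>tangent M x.
     pullback3 (bundleY M T1 T2) s (TC2 (adapted_connection M T1 T2 \<omega>11 \<phi>1 \<phi>2 \<psi>)) x U V W =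
       1 / (8 * (of_real pi)\<^sup>2) *
       ((1/2 * G x + 1/16 * (R (\<sigma> x))\<^sup>2 - \<tau>12 (\<sigma> x) * \<tau>21 (\<sigma> x))
          * (\<theta> x \<^bold>\<and>\<^sub>2 (\<theta>1 x \<^bold>\<and> \<theta>2 x)) U V W
        + (pullback M (bundleX M T1 T2 \<theta>) \<sigma> \<theta>11 x \<^bold>\<and>\<^sub>2
             (\<lambda>V W. E2 (\<sigma> x) * (\<theta> x \<^bold>\<and> \<theta>1 x) V W
                  + E1 (\<sigma> x) * (\<theta> x \<^bold>\<and> \<theta>2 x) V W
                  - R (\<sigma> x) / 2 * (\<theta>1 x \<^bold>\<and> \<theta>2 x) V W)) U V W)"
proof -
  interpret adapted_section M T1 T2 \<theta> \<theta>11 \<tau>1 \<tau>2 \<tau>12 \<tau>21 R W1 W2 R0 R1 R2 \<theta>1 \<theta>2 \<sigma> \<omega>11 \<phi>1 \<phi>2 \<psi> s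
    "\<lambda>x. E1 (\<sigma> x)" "\<lambda>x. E2 (\<sigma> x)" G
    by unfold_locales (fact assms)+
  show ?thesis by (intro ballI Chern_Simons_pullback)
qed

end
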